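(* The type-B bipartite biCambrian congruence on the weak order on $B_n$ is generated by contracting the following join-irreducible elements: for each $i=1,\ldots,n-3$, the elements $s_is_{i+1}s_{i+2}$ and $s_{i+2}s_{i+1}s_i$, corresponding to the ordinary arcs with endpoints $i$ and $i+3$ passing to the same side of $i+1$ and $i+2$; the elements $s_0s_1s_0s_2s_1s_0$ and $s_2s_1s_0$, corresponding to the orbifold arcs with upper endpoint $3$ passing to the same side of $1$ and $2$; and the elements $s_0s_1s_2$ and $s_2s_1s_0s_1$, corresponding to the long arcs with endpoints at $1$ and $3$ passing to the same side of $1$ and $2$.
   Context: $B_n$: signed permutations of $\{\pm1,\ldots,\pm n\}$ ($\pi(-i)=-\pi(i)$), with weak order (the right weak order of the Coxeter group $B_n$), a finite lattice. Simple reflections in one-line notation: $s_0=(-1)2\cdots n$, $s_i=1\cdots(i-1)(i+1)i(i+2)\cdots n$ for $1\le i\le n-1$; products are compositions of maps (rightmost applied first). Lattice congruences are equivalence relations compatible with $\wedge,\vee$; a congruence contracts a join-irreducible $j$ (an element covering exactly one element $j_*$) if $j\equiv j_*$; the meet of two congruences contracts $j$ iff both do; "generated by" means the finest congruence contracting the given elements. Cambrian congruences: designate each of $1,\ldots,n-1$ as a left or right point; the associated Cambrian congruence is generated by contracting $s_0s_1$ and $s_0s_1s_0$ if $1$ is right, or $s_1s_0$ and $s_1s_0s_1$ if $1$ is left, and for $2\le i\le n-1$, $s_{i-1}s_i$ if $i$ is right or $s_is_{i-1}$ if $i$ is left. The two bipartite Cambrian congruences are those for the designation with even numbers left and odd numbers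 right, and the opposite designation; the bipartite biCambrian congruence is their meet. Type-B arcs (orbifold model; join-irreducibles of $B_n$ are in bijection with type-B arcs via the map $\delta^\circ$, which sends a signed permutation to the image of its centrally symmetric noncrossing arc diagram on points $\pm1,\ldots,\pm n$ under identifying $x$ with $-x$): numbered points $1,\ldots,n$ on a vertical line above an orbifold point $\times$; ordinary arcs join two numbered points, passing left or right of the numbered points between; orbifold arcs join a numbered point (upper endpoint) to $\times$, passing left or right of the numbered points below; long arcs have two disjoint pieces descending from two distinct numbered endpoints and joined by passing around below $\times$, each piece passing left or right of numbered points below its endpoint. *)

theory Defs
  imports "HOL-Algebra.Lattice" "HOL-Combinatorics.Permutations"
begin

section \<open>Signed permutations and the weak order\<close>

definition signed_perms :: "nat \<Rightarrow> (int \<Rightarrow> int) set" where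
  "signed_perms n = {\<pi>. \<pi> permutes ({- int n..int n} - {0}) \<and> (\<forall>i. \<pi> (- i) = - \<pi> i)}"

definition simple_refl :: "nat \<Rightarrow> int \<Rightarrow> int" where
  "simple_refl i =
     (if i = 0 then transpose (- 1) 1
      else transpose (int i) (int i + 1) \<circ> transpose (- int i) (- int i - 1))"

text \<open>The word \<open>[i, j, \<dots>, k]\<close> stands for the composition
  \<open>s\<^sub>i \<circ> s\<^sub>j \<circ> \<dots> \<circ> s\<^sub>k\<close>, so the last letter acts first.\<close>

definition word_prod :: "nat list \<Rightarrow> int \<Rightarrow> int" where
  "word_prod ws = foldr (\<circ>) (map simple_refl ws) id"

definition coxeter_length :: "nat \<Rightarrow> (int \<Rightarrow> int) \<Rightarrow> nat" where
  "coxeter_length n w = (LEAST k. \<exists>ws. set ws \<subseteq> {..<n} \<and> length ws = k \<and> word_prod ws = w)"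

text \<open>Right weak order: \<open>u \<le> w\<close> iff a reduced word of \<open>u\<close> is a prefix of a reduced
  word of \<open>w\<close>.\<close>

definition weak_le :: "nat \<Rightarrow> (int \<Rightarrow> int) \<Rightarrow> (int \<Rightarrow> int) \<Rightarrow> bool" where
  "weak_le n u w \<longleftrightarrow>
     (\<exists>v\<in>signed_perms n. w = u \<circ> v \<and> coxeter_length n w = coxeter_length n u + coxeter_length n v)"

definition weak_order :: "nat \<Rightarrow> (int \<Rightarrow> int) gorder" where
  "weak_order n = \<lparr>carrier = signed_perms n, eq = (=), le = weak_le n\<rparr>"


section \<open>Lattice congruences\<close>

definition covers :: "('a, 'b) gorder_scheme \<Rightarrow> 'a \<Rightarrow> 'a \<Rightarrow> bool" where
  "covers L y x \<longleftrightarrow> x \<in> carrier L \<and> y \<in> carrier L \<and> x \<sqsubset>\<^bsub>L\<^esub> y \<and>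
     \<not> (\<exists>z\<in>carrier L. x \<sqsubset>\<^bsub>L\<^esub> z \<and> z \<sqsubset>\<^bsub>L\<^esub> y)"

definition join_irreducible :: "('a, 'b) gorder_scheme \<Rightarrow> 'a \<Rightarrow> bool" where
  "join_irreducible L j \<longleftrightarrow> j \<in> carrier L \<and> (\<exists>!x. covers L j x)"

text \<open>Meaningful only for join-irreducible \<open>j\<close>, where it is \<open>j\<^sub>*\<close>.\<close>

definition lower_elem :: "('a, 'b) gorder_scheme \<Rightarrow> 'a \<Rightarrow> 'a" where
  "lower_elem L j = (THE x. covers L j x)"

definition lattice_congruence :: "('a, 'b) gorder_scheme \<Rightarrow> 'a rel \<Rightarrow> bool" where
  "lattice_congruence L \<theta> \<longleftrightarrow> equiv (carrier L) \<theta> \<and>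
     (\<forall>x x' y y'. (x, x') \<in> \<theta> \<longrightarrow> (y, y') \<in> \<theta> \<longrightarrow>
        (x \<sqinter>\<^bsub>L\<^esub> y, x' \<sqinter>\<^bsub>L\<^esub> y') \<in> \<theta> \<and> (x \<squnion>\<^bsub>L\<^esub> y, x' \<squnion>\<^bsub>L\<^esub> y') \<in> \<theta>)"

definition contracts :: "('a, 'b) gorder_scheme \<Rightarrow> 'a rel \<Rightarrow> 'a \<Rightarrow> bool" where
  "contracts L \<theta> j \<longleftrightarrow> (j, lower_elem L j) \<in> \<theta>"

text \<open>Congruences are closed under intersection, so this is the finest congruence contracting
  every element of \<open>J\<close>.\<close>

definition congruence_generated_by :: "('a, 'b) gorder_scheme \<Rightarrow> 'a set \<Rightarrow> 'a rel" where
  "congruence_generated_by L J = \<Inter> {\<theta>. lattice_congruence L \<theta> \<and> (\<forall>j\<in>J. contracts L \<theta> j)}"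


section \<open>Cambrian and bipartite biCambrian congruences\<close>

text \<open>A designation of \<open>1, \<dots>, n - 1\<close> as left or right points is given by the set \<open>R\<close> of
  right points; only \<open>R \<inter> {1..n - 1}\<close> matters.\<close>

definition cambrian_generators :: "nat \<Rightarrow> nat set \<Rightarrow> (int \<Rightarrow> int) set" where
  "cambrian_generators n R =
     (if 1 \<le> n - 1
      then (if 1 \<in> R then {word_prod [0, 1], word_prod [0, 1, 0]}
            else {word_prod [1, 0], word_prod [1, 0, 1]})
      else {}) \<union>
     {if i \<in> R then word_prod [i - 1, i] else word_prod [i, i - 1] | i. i \<in> {2..n - 1}}"

definition cambrian_congruence :: "nat \<Rightarrow> nat set \<Rightarrow> (int \<Rightarrow> int) rel" where
  "cambrian_congruence n R = congruence_generated_by (weak_order n) (cambrian_generators n R)"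

text \<open>The meet of congruences in the refinement order is their intersection.\<close>

definition bipartite_biCambrian_congruence :: "nat \<Rightarrow> (int \<Rightarrow> int) rel" where
  "bipartite_biCambrian_congruence n =
     cambrian_congruence n {i. odd i} \<inter> cambrian_congruence n {i. even i}"

text \<open>For \<open>n < 3\<close> the reflection \<open>s\<^sub>2\<close> and the numbered point \<open>3\<close> do not exist, and
  there are no generators.\<close>

definition bipartite_generators :: "nat \<Rightarrow> (int \<Rightarrow> int) set" where
  "bipartite_generators n =
     (\<Union>i\<in>{1..n - 3}. {word_prod [i, i + 1, i + 2], word_prod [i + 2, i + 1, i]}) \<union>
     (if 3 \<le> n
      then {word_prod [0, 1, 0, 2, 1, 0], word_prod [2, 1, 0]} \<union>
           {word_prod [0, 1, 2], word_prod [2, 1, 0, 1]}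
      else {})"


section \<open>Type-B arcs in the orbifold model\<close>

text \<open>An arc or a piece of an arc is monotone, so up to isotopy it is determined by its endpoints
  and the set of those numbered points it passes that lie on its left side.
  \<^item> \<open>Ordinary p q S\<close> joins \<open>p < q\<close>, with the points of \<open>S\<close> on its left.
  \<^item> \<open>Orbifold q S\<close> joins \<open>q\<close> to the orbifold point, with the points of \<open>S\<close> on its left.
  \<^item> \<open>Long p q S T\<close> has endpoints \<open>p < q\<close>; \<open>S\<close> and \<open>T\<close> are the points on the
    left of the pieces descending from \<open>p\<close> and from \<open>q\<close>, respectively.\<close>

datatype type_B_arc =
    Ordinary int int "int set"
  | Orbifold int "int set"
  | Long int int "int set" "int set"

text \<open>For long arcs, disjointness of the two pieces means that the piece from \<open>q\<close> stays, at all
  heights below \<open>p\<close>, on the side of the other piece on which it passes \<open>p\<close>.\<close>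

fun is_type_B_arc :: "nat \<Rightarrow> type_B_arc \<Rightarrow> bool" where
  "is_type_B_arc n (Ordinary p q S) \<longleftrightarrow> 1 \<le> p \<and> p < q \<and> q \<le> int n \<and> S \<subseteq> {p<..<q}"
| "is_type_B_arc n (Orbifold q S) \<longleftrightarrow> 1 \<le> q \<and> q \<le> int n \<and> S \<subseteq> {1..<q}"
| "is_type_B_arc n (Long p q S T) \<longleftrightarrow>
     1 \<le> p \<and> p < q \<and> q \<le> int n \<and> S \<subseteq> {1..<p} \<and> T \<subseteq> {1..<q} \<and>
     (if p \<in> T then S \<subseteq> T else T \<inter> {1..<p} \<subseteq> S)"

text \<open>The noncrossing arc diagram of \<open>\<pi>\<close>: plot the points \<open>(i, \<pi> i)\<close>, join consecutive
  points by a segment at each descent, and slide all points horizontally onto a vertical line.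
  The triple \<open>(p, q, S)\<close> is an arc from \<open>p\<close> up to \<open>q\<close> with \<open>S\<close> the set of points on its
  left. One-line notation is \<open>\<pi> (- n) \<dots> \<pi> (- 1) \<pi> 1 \<dots> \<pi> n\<close>, so position
  \<open>- 1\<close> is followed by position \<open>1\<close>.\<close>

definition next_pos :: "int \<Rightarrow> int" where
  "next_pos a = (if a = - 1 then 1 else a + 1)"

definition arc_diagram :: "nat \<Rightarrow> (int \<Rightarrow> int) \<Rightarrow> (int \<times> int \<times> int set) set" where
  "arc_diagram n \<pi> =
     {(\<pi> (next_pos a), \<pi> a, \<pi> ` ({- int n..<a} - {0}) \<inter> {\<pi> (next_pos a)<..<\<pi> a}) | a.
        a \<in> {- int n..<int n} - {0} \<and> \<pi> (next_pos a) < \<pi> a}"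

text \<open>Image of an arc under the identification of \<open>x\<close> with \<open>- x\<close>, the half-turn about the
  orbifold point. The half-turn exchanges left and right; this accounts for the complements taken
  among points with negative labels. In a centrally symmetric noncrossing diagram an arc from
  \<open>- q\<close> to \<open>q\<close> is its own image under the half-turn.\<close>

definition orbifold_image :: "int \<times> int \<times> int set \<Rightarrow> type_B_arc" where
  "orbifold_image = (\<lambda>(p, q, S).
     if 0 < p then Ordinary p q S
     else if q < 0 then Ordinary (- q) (- p) {k \<in> {- q<..<- p}. - k \<notin> S}
     else if p = - q then Orbifold q (S \<inter> {0<..})
     else if - p < q then Long (- p) q {k \<in> {0<..<- p}. - k \<notin> S} (S \<inter> {0<..})
     else Long q (- p) (S \<inter> {0<..}) {k \<in> {0<..<- p}. - k \<notin> S})"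

definition delta_orb :: "nat \<Rightarrow> (int \<Rightarrow> int) \<Rightarrow> type_B_arc set" where
  "delta_orb n \<pi> = orbifold_image ` arc_diagram n \<pi>"

end

theory Submission
  imports Defs
begin

text \<open>
  In terms of inversion sets, \<open>B\<^sub>n\<close> is the sublattice of centrally symmetric permutations of
  \<open>\<plusminus>1, \<dots>, \<plusminus>n\<close>, and a cover exchanges
  the values \<open>p < q\<close> in two neighbouring positions; its arc joins \<open>p\<close> and \<open>q\<close>.
  Two covers with the same arc are contracted by the same congruences.

  A designation of the points, extended to negative points by symmetry, defines an equivalence: two
  elements are equivalent iff they lie above the same arcs that pass to the left of all right points
  and to the right of all left points. This is a congruence that contains the Cambrian congruence, and
  a cover in it passes some point on the wrong side. In the bipartite designations left and right
  alternate along \<open>- n, \<dots>, - 1, 1, \<dots>, n\<close>. So a cover that belongs to both congruences passes some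
  two consecutive points on the same side.

  Conversely, in a hexagon or an octagon of the weak order, contracting a bottom edge contracts all
  side edges. So endpoints of an arc may be moved inwards, and an arc that passes two consecutive points
  on the same side reduces by induction on its length to one of the generators. The same moves reduce
  the generators to the Cambrian generators.
\<close>

section \<open>Signed permutations and their inversions\<close>

text \<open>The Cambrian congruences are never computed. The proof closes a circle of inclusions:
  the biCambrian congruence lies in the intersection of two designation equivalences, every edge in
  this intersection is forced by the generators, and the generators are contracted by both Cambrian
  congruences. The obstacle is the half-turn. An edge inverts a pair together with its negative, so
  moving an endpoint to \<open>m\<close> drags \<open>- m\<close> along. If \<open>- m\<close> lies
  between the endpoints too, it may be carried across the arc, and the hexagon then speaks about a
  different arc. If the moved endpoint is \<open>- m\<close> itself, or if the arc is its own
  half-turn, the polygon is an octagon. Most of the case analysis in the forcing argument is the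
  search for an admissible \<open>m\<close>. Since an edge matters only through its arc, a polygon
  may be built wherever convenient: its vertices are prescribed by odd injective keys on the values,
  and all other points only have to keep their sides.\<close>

locale hyperoctahedral =
  fixes n :: nat
begin

abbreviation Bn :: "(int \<Rightarrow> int) set" where "Bn \<equiv> signed_perms n"

definition V :: "int set" where "V = {- int n..int n} - {0}"

text \<open>\<open>inv w a\<close> is the position of the value \<open>a\<close> in one-line
  notation. Right multiplication by a simple reflection exchanges neighbouring positions, so the
  right weak order is governed by which values precede which.\<close>

definition before :: "(int \<Rightarrow> int) \<Rightarrow> int \<Rightarrow> int \<Rightarrow> bool" where
  "before w a b \<longleftrightarrow> inv w a < inv w b"

abbreviation ordered_by :: "(int \<Rightarrow> int) \<Rightarrow> (int \<Rightarrow> int) \<Rightarrow> bool" where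
  "ordered_by f w \<equiv> \<forall>a\<in>V. \<forall>b\<in>V. before w a b \<longleftrightarrow> f a < f b"

definition inversions :: "(int \<Rightarrow> int) \<Rightarrow> int rel" where
  "inversions w = {(a, b). a \<in> V \<and> b \<in> V \<and> a < b \<and> before w b a}"

abbreviation weakly_below :: "(int \<Rightarrow> int) \<Rightarrow> (int \<Rightarrow> int) \<Rightarrow> bool" (infix "\<preceq>" 50) where
  "u \<preceq> w \<equiv> inversions u \<subseteq> inversions w"

lemma finite_V [simp]: "finite V"
  by (simp add: V_def)

lemma uminus_V_iff [simp]: "- v \<in> V \<longleftrightarrow> v \<in> V"
  by (auto simp: V_def)

lemma zero_notin_V [simp]: "0 \<notin> V"
  by (simp add: V_def)

lemma card_V: "card V = 2 * n"
  by (simp add: V_def)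

lemma signed_perms_iff: "w \<in> Bn \<longleftrightarrow> w permutes V \<and> (\<forall>i. w (- i) = - w i)"
  by (simp add: signed_perms_def V_def)

lemma signed_perm_uminus: "w \<in> Bn \<Longrightarrow> w (- i) = - w i"
  by (simp add: signed_perms_iff)

lemma signed_perm_permutes: "w \<in> Bn \<Longrightarrow> w permutes V"
  by (simp add: signed_perms_iff)

lemma signed_perm_bij: "w \<in> Bn \<Longrightarrow> bij w"
  using permutes_bij signed_perm_permutes by blast

lemma signed_perm_inv: assumes "w \<in> Bn" shows "inv w \<in> Bn"
proof -
  have "inv w (- i) = - inv w i" for i
    using assms by (metis permutes_inv_eq signed_perm_permutes signed_perm_uminus)
  then show ?thesis
    using permutes_inv[OF signed_perm_permutes[OF assms]] by (simp add: signed_perms_iff)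
qed

lemma signed_perm_id: "id \<in> Bn"
  by (simp add: signed_perms_iff permutes_id)

lemma signed_perm_comp:
  "\<lbrakk>u \<in> Bn; w \<in> Bn\<rbrakk> \<Longrightarrow> u \<circ> w \<in> Bn"
  by (simp add: signed_perms_iff permutes_compose)

lemma signed_perm_in_V: "w \<in> Bn \<Longrightarrow> w v \<in> V \<longleftrightarrow> v \<in> V"
  by (metis permutes_in_image signed_perm_permutes)

lemma inv_in_V: "w \<in> Bn \<Longrightarrow> inv w v \<in> V \<longleftrightarrow> v \<in> V"
  using signed_perm_in_V signed_perm_inv by blast

lemma inv_eqI: "\<lbrakk>w \<in> Bn; w x = y\<rbrakk> \<Longrightarrow> inv w y = x"
  by (metis permutes_inv_eq signed_perm_permutes)

lemma apply_inv: "w \<in> Bn \<Longrightarrow> w (inv w y) = y"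
  by (meson inv_eqI permutes_inverses(1) signed_perm_permutes)

lemma inv_apply: "w \<in> Bn \<Longrightarrow> inv w (w y) = y"
  by (simp add: inv_eqI)

lemma inv_uminus: "w \<in> Bn \<Longrightarrow> inv w (- y) = - inv w y"
  using signed_perm_inv signed_perm_uminus by blast

lemma inv_eq_iff: "w \<in> Bn \<Longrightarrow> inv w a = inv w b \<longleftrightarrow> a = b"
  by (metis apply_inv)

lemma before_uminus: "w \<in> Bn \<Longrightarrow> before w (- a) (- b) \<longleftrightarrow> before w b a"
  by (simp add: before_def inv_uminus)

lemma before_uminus_left: "w \<in> Bn \<Longrightarrow> before w (- a) b \<longleftrightarrow> before w (- b) a"
  by (metis before_uminus minus_minus)

lemma not_before: "\<lbrakk>w \<in> Bn; a \<noteq> b\<rbrakk> \<Longrightarrow> \<not> before w a b \<longleftrightarrow> before w b a"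
  by (metis before_def inv_eq_iff not_less_iff_gr_or_eq)

lemma before_trans: "\<lbrakk>before w a b; before w b c\<rbrakk> \<Longrightarrow> before w a c"
  by (simp add: before_def)

lemma before_irrefl [simp]: "\<not> before w a a"
  by (simp add: before_def)

lemma before_asym: "before w a b \<Longrightarrow> \<not> before w b a"
  by (simp add: before_def)

lemma inversions_iff: "(a, b) \<in> inversions w \<longleftrightarrow> a \<in> V \<and> b \<in> V \<and> a < b \<and> before w b a"
  by (simp add: inversions_def)

lemma finite_inversions [simp]: "finite (inversions w)"
  by (rule finite_subset[of _ "V \<times> V"]) (auto simp: inversions_def)

lemma inversions_uminus:
  "w \<in> Bn \<Longrightarrow> (- b, - a) \<in> inversions w \<longleftrightarrow> (a, b) \<in> inversions w"
  by (auto simp: inversions_iff before_uminus)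

lemma inversions_uminus_left:
  "w \<in> Bn \<Longrightarrow> (- b, a) \<in> inversions w \<longleftrightarrow> (- a, b) \<in> inversions w"
  by (metis inversions_uminus minus_minus)

lemma inversions_trans:
  "\<lbrakk>(a, b) \<in> inversions w; (b, c) \<in> inversions w\<rbrakk> \<Longrightarrow> (a, c) \<in> inversions w"
  by (auto simp: inversions_iff before_def)

lemma inversions_cotrans:
  "\<lbrakk>(a, c) \<in> inversions w; b \<in> V; a < b; b < c\<rbrakk> \<Longrightarrow> (a, b) \<in> inversions w \<or> (b, c) \<in> inversions w"
  by (auto simp: inversions_iff before_def)

section \<open>Signed permutations from keys and from inversion sets\<close>

text \<open>Sorting \<open>V\<close> by \<open>f\<close> gives the one-line notation. Negation
  exchanges the number \<open>r\<close> of smaller keys with the number \<open>r'\<close> of larger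
  ones, which makes the sorted word antisymmetric. The vertices of hexagons and octagons are
  prescribed in this way.\<close>

lemma signed_perm_of_key:
  fixes f :: "int \<Rightarrow> int"
  assumes odd: "\<And>v. v \<in> V \<Longrightarrow> f (- v) = - f v" and inj: "inj_on f V"
  obtains w where "w \<in> Bn" "ordered_by f w"
proof -
  define r where "r v = card {u \<in> V. f u < f v}" for v
  define r' where "r' v = card {u \<in> V. f v < f u}" for v
  have rr: "r v + r' v + 1 = 2 * n" if "v \<in> V" for v
  proof -
    have "f u < f v \<or> f v < f u" if "u \<in> V" "u \<noteq> v" for u
      using inj_onD[OF inj, of u v] that \<open>v \<in> V\<close> by linarith
    then have "V = {u \<in> V. f u < f v} \<union> {u \<in> V. f v < f u} \<union> {v}"
      using that by blast
    then have "card V = card ({u \<in> V. f u < f v} \<union> {u \<in> V. f v < f u} \<union> {v})"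
      by simp
    also have "\<dots> = r v + r' v + 1"
      unfolding r_def r'_def by (subst card_Un_disjoint, auto)+
    finally show ?thesis by (simp add: card_V)
  qed
  have r_neg: "r (- v) = r' v" if "v \<in> V" for v
  proof -
    have "{u \<in> V. f u < f (- v)} = uminus ` {u \<in> V. f v < f u}"
    proof (intro equalityI subsetI)
      fix u assume "u \<in> {u \<in> V. f u < f (- v)}"
      then have "u \<in> V" "f v < f (- u)" using odd that by (auto simp: odd)
      then show "u \<in> uminus ` {u \<in> V. f v < f u}"
        by (intro image_eqI[of _ _ "- u"]) auto
    qed (use odd that in auto)
    then show ?thesis
      by (simp add: r_def r'_def card_image)
  qed
  have r_mono: "r a < r b" if "a \<in> V" "b \<in> V" "f a < f b" for a b
    unfolding r_def by (rule psubset_card_mono) (use that in auto)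
  \<comment> \<open>Ranks \<open>0\<close> to \<open>n - 1\<close> become the positions
    \<open>- n\<close> to \<open>- 1\<close>, the other ranks become \<open>1\<close> to
    \<open>n\<close>; the summand \<open>1\<close> skips the missing position
    \<open>0\<close>.\<close>
  define pos where
    "pos v = (if v \<in> V then if r v < n then int (r v) - int n else int (r v) - int n + 1 else v)" for v
  have pos_mono: "pos a < pos b" if "a \<in> V" "b \<in> V" "f a < f b" for a b
    using r_mono[OF that] that by (auto simp: pos_def)
  have pos_inj: "inj_on pos V"
    by (rule inj_onI) (metis inj inj_onD linorder_cases order_less_irrefl pos_mono)
  have "pos v \<in> V" if "v \<in> V" for v
    using rr[OF that] that by (auto simp: pos_def V_def)
  then have "pos ` V = V"
    by (intro endo_inj_surj[OF finite_V _ pos_inj]) blast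
  then have "bij_betw pos V V"
    using pos_inj by (simp add: bij_betw_def)
  then have perm: "pos permutes V"
    by (rule bij_imp_permutes) (simp add: pos_def)
  have "pos (- v) = - pos v" for v
    using rr[of v] r_neg[of v] by (auto simp: pos_def)
  with perm have pos: "pos \<in> Bn"
    by (simp add: signed_perms_iff)
  show thesis
  proof
    \<comment> \<open>\<open>pos\<close> sends values to positions, so the signed permutation is its
      inverse.\<close>
    show "inv pos \<in> Bn"
      using pos by (rule signed_perm_inv)
    have "inv (inv pos) = pos"
      by (rule inv_inv_eq[OF permutes_bij[OF perm]])
    moreover have "pos a < pos b \<longleftrightarrow> f a < f b" if "a \<in> V" "b \<in> V" for a b
      using pos_mono[OF that] pos_mono[of b a] that inj_onD[OF inj, of a b]
      by (cases "f a" "f b" rule: linorder_cases) auto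
    ultimately show "ordered_by f (inv pos)"
      by (simp add: before_def)
  qed
qed

text \<open>Symmetric sets that are closed and coclosed are inversion sets. Reversing exactly the
  pairs of \<open>T\<close> in the natural order gives \<open>lt\<close>, and the two conditions on
  triples make it transitive. The number of predecessors minus the number of successors is then an
  odd key for \<open>lt\<close>.\<close>

lemma signed_perm_of_inversions:
  assumes sub: "\<And>a b. (a, b) \<in> T \<Longrightarrow> a \<in> V \<and> b \<in> V \<and> a < b"
    and sym: "\<And>a b. (a, b) \<in> T \<Longrightarrow> (- b, - a) \<in> T"
    and tr: "\<And>a b c. (a, b) \<in> T \<Longrightarrow> (b, c) \<in> T \<Longrightarrow> (a, c) \<in> T"
    and cotr: "\<And>a b c. (a, c) \<in> T \<Longrightarrow> b \<in> V \<Longrightarrow> a < b \<Longrightarrow> b < c \<Longrightarrow> (a, b) \<in> T \<or> (b, c) \<in> T"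
  obtains w where "w \<in> Bn" "inversions w = T"
proof -
  define lt where "lt a b \<longleftrightarrow> a < b \<and> (a, b) \<notin> T \<or> (b, a) \<in> T" for a b
  have lt_trans: "lt a c" if "lt a b" "lt b c" "a \<in> V" "b \<in> V" "c \<in> V" for a b c
    using that tr[of c b a] cotr[of a c b] tr[of a c b] cotr[of c b a] tr[of b a c] cotr[of b a c]
      sub[of a b] sub[of b a] sub[of b c] sub[of c b] sub[of a c] sub[of c a]
    unfolding lt_def by (smt (verit))
  have lt_irrefl: "\<not> lt a a" for a
    using sub by (auto simp: lt_def)
  have lt_asym: "\<not> lt b a" if "lt a b" "a \<in> V" "b \<in> V" for a b
    using lt_trans lt_irrefl that by blast
  have lt_total: "lt a b \<or> lt b a" if "a \<noteq> b" for a b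
    using that by (auto simp: lt_def)
  have lt_neg: "lt (- b) (- a) \<longleftrightarrow> lt a b" for a b
    using sym[of a b] sym[of "- b" "- a"] sym[of b a] sym[of "- a" "- b"] by (auto simp: lt_def)
  define f where "f v = int (card {u \<in> V. lt u v}) - int (card {u \<in> V. lt v u})" for v
  have f_mono: "f a < f b" if "a \<in> V" "b \<in> V" "lt a b" for a b
  proof -
    have "{u \<in> V. lt u a} \<subset> {u \<in> V. lt u b}" "{u \<in> V. lt b u} \<subset> {u \<in> V. lt a u}"
      using that lt_trans lt_irrefl by blast+
    then have "card {u \<in> V. lt u a} < card {u \<in> V. lt u b}" "card {u \<in> V. lt b u} < card {u \<in> V. lt a u}"
      by (simp_all add: psubset_card_mono)
    then show ?thesis by (simp add: f_def)
  qed
  have f_iff: "lt a b \<longleftrightarrow> f a < f b" if "a \<in> V" "b \<in> V" for a b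
    using f_mono lt_total that by (metis not_less_iff_gr_or_eq)
  have f_odd: "f (- v) = - f v" for v
  proof -
    have "{u \<in> V. lt u (- v)} = uminus ` {u \<in> V. lt v u}" for v
    proof (intro equalityI subsetI)
      fix u assume "u \<in> {u \<in> V. lt u (- v)}"
      then have "u \<in> V" "lt v (- u)" using lt_neg[of "- u" v] by simp_all
      then show "u \<in> uminus ` {u \<in> V. lt v u}"
        by (intro image_eqI[of _ _ "- u"]) auto
    qed (use lt_neg in auto)
    then have *: "card {u \<in> V. lt u (- v)} = card {u \<in> V. lt v u}" for v
      by (simp add: card_image)
    show ?thesis
      using *[of v] *[of "- v"] by (simp add: f_def)
  qed
  have "inj_on f V"
    using f_mono lt_total by (metis inj_onI order_less_irrefl)
  then obtain w where w: "w \<in> Bn"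
      "ordered_by f w"
    using signed_perm_of_key[of f] f_odd by blast
  have "(a, b) \<in> inversions w \<longleftrightarrow> (a, b) \<in> T" for a b
  proof (cases "a \<in> V \<and> b \<in> V \<and> a < b")
    case True
    then have "(a, b) \<in> inversions w \<longleftrightarrow> lt b a"
      using w f_iff by (simp add: inversions_iff)
    also have "\<dots> \<longleftrightarrow> (a, b) \<in> T"
      using True by (auto simp: lt_def)
    finally show ?thesis .
  qed (use sub in \<open>auto simp: inversions_iff\<close>)
  then have "inversions w = T" by (metis subrelI subset_antisym)
  with w(1) that show thesis by blast
qed

text \<open>The inversion set determines how many values precede \<open>v\<close>. This is also the
  number of positions left of the position of \<open>v\<close>, so every position can be
  recovered.\<close>

lemma inversions_inject:
  assumes "u \<in> Bn" "w \<in> Bn" "inversions u = inversions w"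
  shows "u = w"
proof -
  have bef: "before u a b \<longleftrightarrow> before w a b" if "a \<in> V" "b \<in> V" for a b
  proof (cases a b rule: linorder_cases)
    case less
    then show ?thesis
      using assms that by (metis inversions_iff not_before order_less_imp_not_eq)
  next
    case greater
    then show ?thesis
      using assms that by (metis inversions_iff)
  qed simp
  have rank: "card {x \<in> V. before w x v} = card {x \<in> V. x < inv w v}" if "w \<in> Bn" for w v
  proof -
    have "x \<in> inv w ` {x \<in> V. before w x v}" if "x \<in> V" "x < inv w v" for x
      using that \<open>w \<in> Bn\<close>
      by (intro image_eqI[of _ _ "w x"]) (auto simp: before_def inv_apply signed_perm_in_V)
    then have "{x \<in> V. x < inv w v} = inv w ` {x \<in> V. before w x v}"
      using that by (auto simp: before_def inv_in_V)
    moreover have "inj_on (inv w) A" for A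
      by (rule inj_onI) (simp add: inv_eq_iff that)
    ultimately show ?thesis
      by (simp add: card_image)
  qed
  have mono: "card {x \<in> V. x < a} < card {x \<in> V. x < b}" if "a \<in> V" "a < b" for a b
    by (rule psubset_card_mono) (use that in auto)
  have eq: "inv u v = inv w v" if "v \<in> V" for v
  proof -
    have "{x \<in> V. before u x v} = {x \<in> V. before w x v}"
      using bef that by auto
    then have "card {x \<in> V. x < inv u v} = card {x \<in> V. x < inv w v}"
      using rank assms by metis
    moreover have "inv u v \<in> V" "inv w v \<in> V"
      using that assms by (simp_all add: inv_in_V)
    ultimately show ?thesis
      using mono[of "inv u v" "inv w v"] mono[of "inv w v" "inv u v"] by linarith
  qed
  have "inv u v = inv w v" for v
  proof (cases "v \<in> V")
    case False
    then show ?thesis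
      using signed_perm_inv[OF assms(1)] signed_perm_inv[OF assms(2)]
      by (simp add: signed_perms_iff permutes_def)
  qed (rule eq)
  then have "inv u = inv w" by blast
  then show ?thesis
    by (metis assms(1,2) inv_inv_eq signed_perm_bij)
qed

section \<open>Simple reflections and edges of the weak order\<close>

text \<open>The neighbouring positions exchanged by the simple reflection with index
  \<open>k\<close>. As there is no position \<open>0\<close>, they are \<open>- 1\<close> and
  \<open>1\<close> for \<open>k = 0\<close>, so the sign change is an exchange of neighbours like
  the others.\<close>

definition lo :: "nat \<Rightarrow> int" where "lo k = (if k = 0 then - 1 else int k)"
definition hi :: "nat \<Rightarrow> int" where "hi k = int k + 1"

lemma lo_in_V: "k < n \<Longrightarrow> lo k \<in> V" and hi_in_V: "k < n \<Longrightarrow> hi k \<in> V"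
  by (auto simp: lo_def hi_def V_def)

lemma lo_less_hi: "lo k < hi k"
  by (auto simp: lo_def hi_def)

lemma consecutive_positions:
  assumes "x \<in> V" "y \<in> V" "x < y" "\<And>z. z \<in> V \<Longrightarrow> x < z \<Longrightarrow> \<not> z < y"
  obtains k where "k < n" "x = lo k \<and> y = hi k \<or> x = - hi k \<and> y = - lo k"
proof -
  have y: "y = next_pos x"
    using assms(1-3) assms(4)[of "next_pos x"] by (auto simp: next_pos_def V_def)
  define k where "k = (if x = - 1 then 0 else if x > 0 then nat x else nat (- x - 1))"
  show thesis
    by (rule that[of k])
      (use assms(1-3) in \<open>auto simp: y k_def lo_def hi_def next_pos_def V_def split: if_splits\<close>)
qed

lemma simple_refl_lo [simp]: "simple_refl k (lo k) = hi k"
  and simple_refl_hi [simp]: "simple_refl k (hi k) = lo k"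
  by (auto simp: simple_refl_def lo_def hi_def transpose_def)

lemma simple_refl_involutory [simp]: "simple_refl k (simple_refl k x) = x"
  by (auto simp: simple_refl_def transpose_def)

lemma simple_refl_comp [simp]: "simple_refl k \<circ> simple_refl k = id"
  by (simp add: fun_eq_iff)

lemma inv_simple_refl [simp]: "inv (simple_refl k) = simple_refl k"
  by (rule inv_unique_comp) simp_all

lemma simple_refl_uminus: "simple_refl k (- x) = - simple_refl k x"
  by (auto simp: simple_refl_def transpose_def)

lemma simple_refl_signed_perm: assumes "k < n" shows "simple_refl k \<in> Bn"
proof -
  have "simple_refl k permutes V"
  proof (rule bij_imp_permutes)
    have "simple_refl k x \<in> V" if "x \<in> V" for x
      using that assms by (auto simp: simple_refl_def transpose_def V_def)
    then show "bij_betw (simple_refl k) (V) (V)"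
      by (intro bij_betwI[of _ _ _ "simple_refl k"]) auto
    show "simple_refl k x = x" if "x \<notin> V" for x
      using that assms by (auto simp: simple_refl_def transpose_def V_def)
  qed
  then show ?thesis
    by (simp add: signed_perms_iff simple_refl_uminus)
qed

lemma simple_refl_less_iff:
  assumes "x < y" "x \<noteq> 0" "y \<noteq> 0"
  shows "simple_refl k y < simple_refl k x \<longleftrightarrow> x = lo k \<and> y = hi k \<or> x = - hi k \<and> y = - lo k"
proof (cases "k = 0")
  case True
  then show ?thesis
    using assms by (auto simp: simple_refl_def transpose_def lo_def hi_def)
next
  case False
  have "simple_refl k z = (if z = int k then int k + 1 else if z = int k + 1 then int k
      else if z = - int k then - int k - 1 else if z = - int k - 1 then - int k else z)" for z
    using False by (simp add: simple_refl_def transpose_def)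
  then show ?thesis
    using assms False by (simp add: lo_def hi_def)
qed

text \<open>The pairs \<open>(p, q)\<close> and \<open>(- q, - p)\<close> are the endpoints of an arc and of its half-turn; they
  coincide for orbifold arcs.\<close>

definition edge :: "(int \<Rightarrow> int) \<Rightarrow> (int \<Rightarrow> int) \<Rightarrow> int \<Rightarrow> int \<Rightarrow> bool" where
  "edge u w p q \<longleftrightarrow> u \<in> Bn \<and> w \<in> Bn \<and> p \<in> V \<and> q \<in> V \<and> p < q \<and>
     (p, q) \<notin> inversions u \<and> inversions w = inversions u \<union> {(p, q), (- q, - p)}"

lemma edge_uminus: "edge u w p q \<Longrightarrow> edge u w (- q) (- p)"
  by (auto simp: edge_def inversions_uminus inversions_uminus_left)

lemma inversions_simple_refl:
  assumes "w \<in> Bn" "k < n" "w (lo k) < w (hi k)"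
  shows "edge w (w \<circ> simple_refl k) (w (lo k)) (w (hi k))"
proof -
  have s: "simple_refl k \<in> Bn"
    using assms(2) by (rule simple_refl_signed_perm)
  have ws: "w \<circ> simple_refl k \<in> Bn"
    using assms(1) s by (rule signed_perm_comp)
  have bef: "before (w \<circ> simple_refl k) a b \<longleftrightarrow> simple_refl k (inv w a) < simple_refl k (inv w b)" for a b
    using signed_perm_bij[OF assms(1)] signed_perm_bij[OF s] by (simp add: before_def o_inv_distrib)
  have "(a, b) \<in> inversions (w \<circ> simple_refl k) \<longleftrightarrow>
      (a, b) \<in> inversions w \<union> {(w (lo k), w (hi k)), (- w (hi k), - w (lo k))}" for a b
  proof (cases "a \<in> V \<and> b \<in> V \<and> a < b")
    case True
    define x y where "x = inv w a" and "y = inv w b"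
    have ab: "a = w x" "b = w y"
      using assms(1) by (simp_all add: x_def y_def apply_inv)
    have xy: "x \<in> V" "y \<in> V" "x \<noteq> y"
      using True assms(1) by (auto simp: x_def y_def inv_in_V inv_eq_iff)
    then have nz: "x \<noteq> 0" "y \<noteq> 0" by (auto simp: V_def)
    have w_eq: "w i = w j \<longleftrightarrow> i = j" for i j
      using assms(1) by (metis inv_apply)
    have neg: "- w i = w (- i)" for i
      using assms(1) by (simp add: signed_perm_uminus)
    have "(a, b) \<in> inversions (w \<circ> simple_refl k) \<longleftrightarrow> simple_refl k y < simple_refl k x"
      using True by (simp add: inversions_iff bef x_def y_def)
    also have "\<dots> \<longleftrightarrow> y < x \<or> x = lo k \<and> y = hi k \<or> x = - hi k \<and> y = - lo k"
    proof (cases "x < y")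
      case True
      then show ?thesis using simple_refl_less_iff[of x y k] nz by auto
    next
      case False
      then have "y < x" using xy by simp
      moreover have "\<not> simple_refl k x < simple_refl k y"
      proof
        assume "simple_refl k x < simple_refl k y"
        then have "y = lo k \<and> x = hi k \<or> y = - hi k \<and> x = - lo k"
          using simple_refl_less_iff[of y x k] nz \<open>y < x\<close> by simp
        then show False
          using True assms(3) ab neg by (metis neg_less_iff_less order_less_asym)
      qed
      moreover have "simple_refl k x \<noteq> simple_refl k y"
        using xy by (metis simple_refl_involutory)
      ultimately show ?thesis by auto
    qed
    also have "\<dots> \<longleftrightarrow> (a, b) \<in> inversions w \<union> {(w (lo k), w (hi k)), (- w (hi k), - w (lo k))}"
      using True by (auto simp: inversions_iff before_def neg w_eq ab inv_apply assms(1))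
    finally show ?thesis .
  next
    case False
    have "w (lo k) \<in> V" "w (hi k) \<in> V"
      using assms by (simp_all add: signed_perm_in_V lo_in_V hi_in_V)
    then show ?thesis
      using False assms(3) by (auto simp: inversions_iff)
  qed
  then have "inversions (w \<circ> simple_refl k) = inversions w \<union> {(w (lo k), w (hi k)), (- w (hi k), - w (lo k))}"
    by (metis subrelI subset_antisym)
  moreover have "(w (lo k), w (hi k)) \<notin> inversions w"
    using assms(1) by (simp add: inversions_iff before_def inv_apply lo_less_hi order_less_imp_le not_less)
  ultimately show ?thesis
    using assms ws by (simp add: edge_def signed_perm_in_V lo_in_V hi_in_V)
qed

lemma inversions_simple_refl':
  assumes "w \<in> Bn" "k < n" "w (hi k) < w (lo k)"
  shows "edge (w \<circ> simple_refl k) w (w (hi k)) (w (lo k))"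
proof -
  have "edge (w \<circ> simple_refl k) (w \<circ> simple_refl k \<circ> simple_refl k) (w (hi k)) (w (lo k))"
    using inversions_simple_refl[of "w \<circ> simple_refl k" k] assms
    by (simp add: signed_perm_comp simple_refl_signed_perm)
  then show ?thesis by (simp add: comp_assoc)
qed

lemma edge_before:
  assumes "edge u w p q" "a \<in> V" "b \<in> V" "{a, b} \<noteq> {p, q}" "{a, b} \<noteq> {- p, - q}"
  shows "before u a b \<longleftrightarrow> before w a b"
proof (cases a b rule: linorder_cases)
  case less
  have "(a, b) \<in> inversions w \<longleftrightarrow> (a, b) \<in> inversions u"
    using assms by (auto simp: edge_def)
  then show ?thesis
    using less assms by (metis edge_def inversions_iff not_before order_less_imp_not_eq)
next
  case greater
  have "(b, a) \<in> inversions w \<longleftrightarrow> (b, a) \<in> inversions u"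
    using assms by (auto simp: edge_def)
  then show ?thesis
    using greater assms by (simp add: inversions_iff)
qed simp

lemma edge_before_top: "edge u w p q \<Longrightarrow> before w q p"
  by (auto simp: edge_def inversions_def)

lemma edge_before_bot: "edge u w p q \<Longrightarrow> before u p q"
  unfolding edge_def inversions_iff by (metis not_before order_less_irrefl)

text \<open>Only the pair \<open>p\<close>, \<open>q\<close> and its negative change their order
  along the edge. A value between \<open>q\<close> and \<open>p\<close> in \<open>w\<close> would
  therefore still follow \<open>q\<close> and precede \<open>p\<close> in \<open>u\<close>, where
  \<open>p\<close> precedes \<open>q\<close>.\<close>

lemma edge_adjacent:
  assumes e: "edge u w p q" and y: "y \<in> V" "y \<noteq> p" "y \<noteq> q"
  shows "before w y q \<longleftrightarrow> before w y p"
proof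
  assume "before w y q"
  then show "before w y p" using edge_before_top[OF e] before_trans by blast
next
  assume yp: "before w y p"
  show "before w y q"
  proof (rule ccontr)
    assume "\<not> before w y q"
    then have qy: "before w q y"
      using e y by (metis edge_def not_before)
    have pq: "p \<in> V" "q \<in> V" "p < q" using e by (auto simp: edge_def)
    have nz: "p \<noteq> 0" "q \<noteq> 0" "y \<noteq> 0" using pq y by auto
    have "before u q y"
      using qy edge_before[OF e, of q y] pq y nz by (auto simp: doubleton_eq_iff)
    moreover have "before u y p"
      using yp edge_before[OF e, of y p] pq y nz by (auto simp: doubleton_eq_iff)
    ultimately show False
      using edge_before_bot[OF e] before_trans before_asym by blast
  qed
qed

text \<open>By \<open>edge_adjacent\<close> nothing stands between \<open>q\<close> and
  \<open>p\<close>, so they are neighbours. The final disjunction records whether their positions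
  are those exchanged by a simple reflection or the mirror images of these.\<close>

lemma edge_position:
  assumes e: "edge u w p q"
  obtains k where "k < n" "u = w \<circ> simple_refl k" "w (hi k) < w (lo k)"
    "w (lo k) = q \<and> w (hi k) = p \<or> w (lo k) = - p \<and> w (hi k) = - q"
proof -
  have w: "w \<in> Bn" and u: "u \<in> Bn" and pq: "p \<in> V" "q \<in> V" "p < q"
    using e by (auto simp: edge_def)
  obtain k where k: "k < n" "inv w q = lo k \<and> inv w p = hi k \<or> inv w q = - hi k \<and> inv w p = - lo k"
  proof (rule consecutive_positions)
    show "inv w q \<in> V" "inv w p \<in> V" using w pq by (simp_all add: inv_in_V)
    show "inv w q < inv w p" using edge_before_top[OF e] by (simp add: before_def)
    fix z assume z: "z \<in> V" "inv w q < z"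
    show "\<not> z < inv w p"
    proof
      assume "z < inv w p"
      then have "before w q (w z)" "before w (w z) p" "w z \<in> V"
        using w z by (simp_all add: before_def inv_apply signed_perm_in_V)
      then show False
        using edge_adjacent[OF e, of "w z"] before_asym by (metis before_irrefl)
    qed
  qed
  have "w (lo k) = q \<and> w (hi k) = p \<or> w (- hi k) = q \<and> w (- lo k) = p"
    using k(2) apply_inv[OF w] by metis
  then have k2: "w (lo k) = q \<and> w (hi k) = p \<or> w (lo k) = - p \<and> w (hi k) = - q"
    using signed_perm_uminus[OF w] by auto
  then have k3: "w (hi k) < w (lo k)" using pq by auto
  have e': "edge (w \<circ> simple_refl k) w (w (hi k)) (w (lo k))"
    using inversions_simple_refl'[OF w k(1) k3] .
  have *: "inversions u = inversions w - {(p, q), (- q, - p)}" if "edge u w p q" for u w p q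
    using that by (auto simp: edge_def inversions_uminus)
  have "inversions u = inversions (w \<circ> simple_refl k)"
    unfolding *[OF e] *[OF e'] using k2 by (elim disjE) (simp_all add: insert_commute)
  then have "u = w \<circ> simple_refl k"
    using e' u inversions_inject unfolding edge_def by blast
  then show thesis using that k k2 k3 by blast
qed

text \<open>Take a pair inverted in \<open>w\<close> but not in \<open>u\<close> whose positions in
  \<open>u\<close> are as close as possible. A value standing between them in \<open>u\<close>
  would, by transitivity, form a closer pair of the same kind with one of the two.\<close>

lemma exists_edge_below:
  assumes u: "u \<in> Bn" and w: "w \<in> Bn"
    and sub: "inversions u \<subset> inversions w"
  obtains k where "k < n" "u (lo k) < u (hi k)" "(u (lo k), u (hi k)) \<in> inversions w"
proof -
  define D where "D = inversions w - inversions u"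
  define d where "d = (\<lambda>(a, b). nat (inv u b - inv u a))"
  have "\<exists>x. x \<in> D" using sub by (auto simp: D_def)
  then obtain x where x: "x \<in> D" "\<And>y. y \<in> D \<Longrightarrow> d x \<le> d y"
    using ex_has_least_nat[of "\<lambda>x. x \<in> D" _ d] by blast
  obtain a b where xab: "x = (a, b)" by force
  have ab: "(a, b) \<in> inversions w" "a \<in> V" "b \<in> V" "a < b" "before u a b" "before w b a"
    using x(1) u by (auto simp: xab D_def inversions_iff not_before)
  obtain k where k: "k < n" "inv u a = lo k \<and> inv u b = hi k \<or> inv u a = - hi k \<and> inv u b = - lo k"
  proof (rule consecutive_positions)
    show "inv u a \<in> V" "inv u b \<in> V" using u ab by (simp_all add: inv_in_V)
    show "inv u a < inv u b" using ab by (simp add: before_def)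
    fix z assume z: "z \<in> V" "inv u a < z"
    show "\<not> z < inv u b"
    proof
      assume "z < inv u b"
      define c where "c = u z"
      have c: "c \<in> V" "inv u c = z" using u z by (simp_all add: c_def signed_perm_in_V inv_apply)
      have ac: "before u a c" "before u c b" using c z \<open>z < inv u b\<close> by (simp_all add: before_def)
      have ne: "c \<noteq> a" "c \<noteq> b" using ac by auto
      have no: "(a, c) \<notin> D" "(c, b) \<notin> D"
        using x(2)[of "(a, c)"] x(2)[of "(c, b)"] z \<open>z < inv u b\<close> by (auto simp: xab d_def c)
      have su: "before w y x" if "x \<in> V" "y \<in> V" "x < y" "before u y x" for x y
        using that sub by (meson inversions_iff psubsetD)
      have mem: "(x, y) \<in> D" if "x \<in> V" "y \<in> V" "x < y" "before u x y" "before w y x" for x y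
        using that by (auto simp: D_def inversions_iff before_asym)
      consider "c < a" | "a < c" "c < b" | "b < c" using ne by linarith
      then show False
      proof cases
        case 1
        then have "before w b c" using su[of c a] ac ab c before_trans by blast
        then show False using mem[of c b] no 1 ab ac c by auto
      next
        case 2
        have "before w c a \<or> before w b c"
          using ab(6) not_before[OF w ne(1)] before_trans by blast
        then show False using mem[of c b] mem[of a c] no 2 ab ac c by auto
      next
        case 3
        then have "before w c a" using su[of b c] ac ab c before_trans by blast
        then show False using mem[of a c] no 3 ab ac c by auto
      qed
    qed
  qed
  have "u (lo k) = a \<and> u (hi k) = b \<or> u (- hi k) = a \<and> u (- lo k) = b"
    using k(2) apply_inv[OF u] by metis
  then have "u (lo k) = a \<and> u (hi k) = b \<or> u (lo k) = - b \<and> u (hi k) = - a"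
    using signed_perm_uminus[OF u] by auto
  then show thesis
    using that[OF k(1)] ab inversions_uminus[OF w] by auto
qed

section \<open>Coxeter length and the weak order\<close>

text \<open>One representative of each orbit \<open>{(a, b), (- b, - a)}\<close>.\<close>

definition half_inversions :: "(int \<Rightarrow> int) \<Rightarrow> int rel" where
  "half_inversions w = {(a, b) \<in> inversions w. 0 \<le> a + b}"

definition inv_count :: "(int \<Rightarrow> int) \<Rightarrow> nat" where
  "inv_count w = card (half_inversions w)"

lemma finite_half_inversions [simp]: "finite (half_inversions w)"
  by (rule finite_subset[OF _ finite_inversions[of w]]) (auto simp: half_inversions_def)

lemma inv_count_edge: assumes "edge u w p q" shows "inv_count w = Suc (inv_count u)"
proof -
  have notin: "(p, q) \<notin> inversions u" "(- q, - p) \<notin> inversions u"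
    using assms by (auto simp: edge_def inversions_uminus)
  have inv: "inversions w = inversions u \<union> {(p, q), (- q, - p)}"
    using assms by (simp add: edge_def)
  obtain a b where ab: "half_inversions w = insert (a, b) (half_inversions u)" "(a, b) \<notin> half_inversions u"
  proof (cases "0 \<le> p + q")
    case True
    show thesis
    proof (rule that[of p q])
      show "half_inversions w = insert (p, q) (half_inversions u)"
        using True by (auto simp: half_inversions_def inv)
    qed (use notin in \<open>auto simp: half_inversions_def\<close>)
  next
    case False
    show thesis
    proof (rule that[of "- q" "- p"])
      show "half_inversions w = insert (- q, - p) (half_inversions u)"
        using False by (auto simp: half_inversions_def inv)
    qed (use notin in \<open>auto simp: half_inversions_def\<close>)
  qed
  then show ?thesis by (simp add: inv_count_def)
qed

lemma inversions_id [simp]: "inversions id = {}"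
  by (auto simp: inversions_def before_def)

lemma inv_count_id [simp]: "inv_count id = 0"
  by (simp add: inv_count_def half_inversions_def)

lemma word_prod_Nil [simp]: "word_prod [] = id"
  by (simp add: word_prod_def)

lemma word_prod_Cons: "word_prod (k # ws) = simple_refl k \<circ> word_prod ws"
  by (simp add: word_prod_def)

lemma word_prod_append: "word_prod (us @ ws) = word_prod us \<circ> word_prod ws"
  by (induction us) (simp_all add: word_prod_Cons comp_assoc)

lemma word_prod_snoc: "word_prod (ws @ [k]) = word_prod ws \<circ> simple_refl k"
  by (simp add: word_prod_append word_prod_Cons)

lemma word_prod_signed_perm: "set ws \<subseteq> {..<n} \<Longrightarrow> word_prod ws \<in> Bn"
  by (induction ws) (auto simp: word_prod_Cons signed_perm_id intro!: signed_perm_comp simple_refl_signed_perm)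

lemma lo_hi_neq: "w \<in> Bn \<Longrightarrow> w (lo k) \<noteq> w (hi k)"
  using lo_less_hi[of k] by (metis inv_apply order_less_irrefl)

lemma inv_count_simple_refl:
  assumes "w \<in> Bn" "k < n"
  shows "inv_count (w \<circ> simple_refl k) = Suc (inv_count w) \<or> inv_count w = Suc (inv_count (w \<circ> simple_refl k))"
  using inversions_simple_refl[OF assms] inversions_simple_refl'[OF assms] inv_count_edge
    lo_hi_neq[OF assms(1)] by (meson linorder_cases)

lemma inv_count_word_prod: "set ws \<subseteq> {..<n} \<Longrightarrow> inv_count (word_prod ws) \<le> length ws"
proof (induction ws rule: rev_induct)
  case (snoc k ws)
  then have "inv_count (word_prod ws) \<le> length ws" "word_prod ws \<in> Bn" "k < n"
    by (simp_all add: word_prod_signed_perm)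
  then show ?case
    using inv_count_simple_refl[of "word_prod ws" k] unfolding word_prod_snoc length_append_singleton
    by linarith
qed simp

lemma inversions_empty_iff: "w \<in> Bn \<Longrightarrow> inversions w = {} \<longleftrightarrow> w = id"
  using inversions_inject signed_perm_id inversions_id by metis

lemma inversions_empty_if_inv_count: assumes "w \<in> Bn" "inv_count w = 0" shows "w = id"
proof -
  have "(a, b) \<notin> inversions w" for a b
  proof
    assume "(a, b) \<in> inversions w"
    then have "(a, b) \<in> half_inversions w \<or> (- b, - a) \<in> half_inversions w"
      using inversions_uminus[OF assms(1)] by (auto simp: half_inversions_def)
    then show False using assms(2) by (auto simp: inv_count_def)
  qed
  then have "inversions w = {}" by auto
  then show ?thesis using assms(1) by (simp add: inversions_empty_iff)
qed

text \<open>The inverse of \<open>w\<close> is above the identity, so some edge from the identity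
  stays below it. The pair of positions inverted by this edge is a descent of
  \<open>w\<close>.\<close>

lemma exists_descent:
  assumes "w \<in> Bn" "w \<noteq> id"
  obtains k where "k < n" "w (hi k) < w (lo k)"
proof -
  have "\<exists>k<n. w (hi k) < w (lo k)"
  proof (rule ccontr)
    assume "\<not> ?thesis"
    then have asc: "w (lo k) < w (hi k)" if "k < n" for k
      using that lo_hi_neq[OF assms(1)] by (meson linorder_cases)
    have "inversions id \<subset> inversions (inv w)"
      using assms by (metis inversions_empty_iff inversions_id inv_inv_eq signed_perm_bij signed_perm_id
        signed_perm_inv inv_id psubsetI empty_subsetI)
    then obtain k where "k < n" "(lo k, hi k) \<in> inversions (inv w)"
      using exists_edge_below[OF signed_perm_id signed_perm_inv[OF assms(1)]] by (metis id_apply)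
    then show False
      using asc[of k] signed_perm_bij[OF assms(1)]
      by (auto simp: inversions_iff before_def inv_inv_eq)
  qed
  then show thesis using that by blast
qed

lemma exists_word: "w \<in> Bn \<Longrightarrow>
  \<exists>ws. set ws \<subseteq> {..<n} \<and> length ws = inv_count w \<and> word_prod ws = w"
proof (induction "inv_count w" arbitrary: w)
  case 0
  then have "w = id" using inversions_empty_if_inv_count by simp
  then show ?case unfolding \<open>w = id\<close> inv_count_id by (intro exI[of _ "[]"]) simp
next
  case (Suc m)
  then have "w \<noteq> id" by auto
  then obtain k where k: "k < n" "w (hi k) < w (lo k)"
    using exists_descent Suc.prems by blast
  define v where "v = w \<circ> simple_refl k"
  have "edge v w (w (hi k)) (w (lo k))"
    using inversions_simple_refl'[OF Suc.prems k] by (simp add: v_def)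
  then have "inv_count v = m" "v \<in> Bn"
    using inv_count_edge Suc.hyps(2) by (auto simp: edge_def)
  then obtain ws where ws: "set ws \<subseteq> {..<n}" "length ws = m" "word_prod ws = v"
    using Suc.hyps(1) by blast
  show ?case
    using ws k Suc.hyps(2) by (intro exI[of _ "ws @ [k]"]) (simp add: word_prod_snoc v_def comp_assoc)
qed

lemma coxeter_length_eq: assumes "w \<in> Bn" shows "coxeter_length n w = inv_count w"
  unfolding coxeter_length_def
proof (rule Least_equality)
  show "\<exists>ws. set ws \<subseteq> {..<n} \<and> length ws = inv_count w \<and> word_prod ws = w"
    using assms by (rule exists_word)
qed (use inv_count_word_prod in blast)

lemma inv_count_comp_le:
  assumes "u \<in> Bn" "v \<in> Bn"
  shows "inv_count (u \<circ> v) \<le> inv_count u + inv_count v"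
proof -
  obtain us vs where "set us \<subseteq> {..<n}" "length us = inv_count u" "word_prod us = u"
    "set vs \<subseteq> {..<n}" "length vs = inv_count v" "word_prod vs = v"
    using exists_word assms by metis
  then show ?thesis
    using inv_count_word_prod[of "us @ vs"] by (simp add: word_prod_append)
qed

text \<open>Remove the last letter of \<open>v\<close>. Subadditivity of the count forces the
  lengths to remain additive, so the removed letter was an ascent and only enlarged the inversion
  set.\<close>

lemma inversions_subset_if_inv_count:
  assumes "u \<in> Bn" "v \<in> Bn" "inv_count (u \<circ> v) = inv_count u + inv_count v"
  shows "u \<preceq> (u \<circ> v)"
  using assms(2,3)
proof (induction "inv_count v" arbitrary: v)
  case 0
  then have "v = id" using inversions_empty_if_inv_count by simp
  then show ?case by simp
next
  case (Suc m)
  then have "v \<noteq> id" by auto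
  then obtain k where k: "k < n" "v (hi k) < v (lo k)"
    using exists_descent Suc.prems by blast
  define v' where "v' = v \<circ> simple_refl k"
  have e: "edge v' v (v (hi k)) (v (lo k))"
    using inversions_simple_refl'[OF Suc.prems(1) k] by (simp add: v'_def)
  then have v': "inv_count v' = m" "v' \<in> Bn"
    using inv_count_edge Suc.hyps(2) by (auto simp: edge_def)
  have uv': "u \<circ> v' \<in> Bn"
    using assms(1) v' signed_perm_comp by blast
  have v: "u \<circ> v' \<circ> simple_refl k = u \<circ> v"
    by (simp add: v'_def comp_assoc)
  have cnt: "inv_count (u \<circ> v) = Suc (inv_count (u \<circ> v'))"
    using inv_count_simple_refl[OF uv' k(1)] inv_count_comp_le[OF assms(1) v'(2)] Suc.prems(2) Suc.hyps(2) v'(1)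
    unfolding v by linarith
  then have "u \<preceq> (u \<circ> v')"
    using Suc v' by auto
  moreover have "(u \<circ> v') (lo k) < (u \<circ> v') (hi k)"
  proof (rule ccontr)
    assume "\<not> ?thesis"
    then have "(u \<circ> v') (hi k) < (u \<circ> v') (lo k)"
      using lo_hi_neq[OF uv'] by (meson linorder_cases)
    from inv_count_edge[OF inversions_simple_refl'[OF uv' k(1) this]] show False
      using cnt unfolding v by linarith
  qed
  then have "(u \<circ> v') \<preceq> (u \<circ> v)"
    using inversions_simple_refl[OF uv' k(1)] v by (auto simp: edge_def)
  ultimately show ?case by blast
qed

text \<open>An ascent of \<open>u\<close> that stays below \<open>w\<close> adds one to the count of
  \<open>u\<close> and lowers the count of \<open>inv u \<circ> w\<close> by at most one. Together
  with subadditivity this yields equality.\<close>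

lemma inv_count_if_inversions_subset:
  assumes "u \<in> Bn" "w \<in> Bn" "u \<preceq> w"
  shows "inv_count u + inv_count (inv u \<circ> w) \<le> inv_count w"
  using assms(1,3)
proof (induction "card (inversions w - inversions u)" arbitrary: u rule: less_induct)
  case less
  show ?case
  proof (cases "inversions u = inversions w")
    case True
    then have "u = w" using inversions_inject less.prems assms(2) by blast
    moreover have "inv w \<circ> w = id" using assms(2) by (simp add: fun_eq_iff inv_apply)
    ultimately show ?thesis by simp
  next
    case False
    then have "inversions u \<subset> inversions w" using less.prems by blast
    then obtain k where k: "k < n" "u (lo k) < u (hi k)" "(u (lo k), u (hi k)) \<in> inversions w"
      using exists_edge_below less.prems assms(2) by blast
    define u' where "u' = u \<circ> simple_refl k"
    have e: "edge u u' (u (lo k)) (u (hi k))"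
      unfolding u'_def by (rule inversions_simple_refl) (use less.prems k in auto)
    then have u': "u' \<in> Bn" "u' \<preceq> w" "inv_count u' = Suc (inv_count u)"
      using inv_count_edge k less.prems assms(2) by (auto simp: edge_def inversions_uminus)
    have "card (inversions w - inversions u') < card (inversions w - inversions u)"
      by (rule psubset_card_mono) (use e k in \<open>auto simp: edge_def\<close>)
    then have IH: "inv_count u' + inv_count (inv u' \<circ> w) \<le> inv_count w"
      using less.hyps u' by blast
    have "inv u' = simple_refl k \<circ> inv u"
      using signed_perm_bij[OF less.prems(1)] signed_perm_bij[OF simple_refl_signed_perm[OF k(1)]]
      by (simp add: u'_def o_inv_distrib)
    then have "inv u \<circ> w = simple_refl k \<circ> (inv u' \<circ> w)"
      by (simp add: fun_eq_iff)
    moreover have "inv_count (simple_refl k) \<le> 1"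
      using inv_count_word_prod[of "[k]"] k by (simp add: word_prod_Cons)
    ultimately have "inv_count (inv u \<circ> w) \<le> 1 + inv_count (inv u' \<circ> w)"
      using inv_count_comp_le[OF simple_refl_signed_perm[OF k(1)], of "inv u' \<circ> w"] u'(1) assms(2)
        signed_perm_inv signed_perm_comp by fastforce
    then show ?thesis using IH u'(3) by linarith
  qed
qed

lemma weak_le_iff:
  assumes "u \<in> Bn" "w \<in> Bn"
  shows "weak_le n u w \<longleftrightarrow> u \<preceq> w"
proof
  assume "weak_le n u w"
  then show "u \<preceq> w"
    using assms inversions_subset_if_inv_count by (auto simp: weak_le_def coxeter_length_eq)
next
  assume *: "u \<preceq> w"
  define v where "v = inv u \<circ> w"
  have v: "v \<in> Bn" "w = u \<circ> v"
    using assms by (auto simp: v_def signed_perm_comp signed_perm_inv fun_eq_iff apply_inv)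
  have "inv_count w = inv_count u + inv_count v"
    using inv_count_comp_le[OF assms(1) v(1)] inv_count_if_inversions_subset[OF assms *]
    unfolding v_def[symmetric] v(2)[symmetric] by linarith
  then show "weak_le n u w"
    using v assms by (auto simp: weak_le_def coxeter_length_eq)
qed

section \<open>Joins and meets by transitive closure\<close>

text \<open>The complement of the inversion set among increasing pairs. It satisfies the same two
  conditions on triples, so meets are transitive closures of noninversions just as joins are
  transitive closures of inversions.\<close>

definition noninversions :: "(int \<Rightarrow> int) \<Rightarrow> int rel" where
  "noninversions w = {(a, b). a \<in> V \<and> b \<in> V \<and> a < b \<and> before w a b}"

lemma noninversions_iff:
  assumes "w \<in> Bn"
  shows "(a, b) \<in> noninversions w \<longleftrightarrow> a \<in> V \<and> b \<in> V \<and> a < b \<and> (a, b) \<notin> inversions w"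
  unfolding noninversions_def inversions_iff mem_Collect_eq case_prod_conv
  by (metis assms not_before order_less_irrefl)

lemma noninversions_trans:
  "\<lbrakk>(a, b) \<in> noninversions w; (b, c) \<in> noninversions w\<rbrakk> \<Longrightarrow> (a, c) \<in> noninversions w"
  by (auto simp: noninversions_def before_def)

lemma noninversions_cotrans:
  "\<lbrakk>(a, c) \<in> noninversions w; b \<in> V; a < b; b < c\<rbrakk>
    \<Longrightarrow> (a, b) \<in> noninversions w \<or> (b, c) \<in> noninversions w"
  by (auto simp: noninversions_def before_def)

lemma noninversions_subset_iff:
  assumes "u \<in> Bn" "w \<in> Bn"
  shows "noninversions w \<subseteq> noninversions u \<longleftrightarrow> u \<preceq> w"
  using assms by (auto simp: subset_iff noninversions_iff) (auto simp: inversions_iff)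

text \<open>An increasing chain from \<open>a\<close> to \<open>c\<close> either visits
  \<open>b\<close> or jumps over it in a single link, and that link splits at
  \<open>b\<close>.\<close>

lemma trancl_cotrans:
  assumes sub: "\<And>a b. (a, b) \<in> I \<Longrightarrow> a \<in> V \<and> b \<in> V \<and> a < b"
    and cotr: "\<And>a b c. (a, c) \<in> I \<Longrightarrow> b \<in> V \<Longrightarrow> a < b \<Longrightarrow> b < c \<Longrightarrow> (a, b) \<in> I \<or> (b, c) \<in> I"
    and ac: "(a, c) \<in> I\<^sup>+" and b: "b \<in> V" "a < b" "b < c"
  shows "(a, b) \<in> I\<^sup>+ \<or> (b, c) \<in> I\<^sup>+"
  using ac b
proof (induction rule: trancl_induct)
  case (base y)
  then show ?case using cotr by blast
next
  case (step y z)
  consider "b < y" | "b = y" | "y < b" by linarith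
  then show ?case
  proof cases
    case 1
    then show ?thesis using step by (meson trancl_into_trancl)
  next
    case 2
    then show ?thesis using step by simp
  next
    case 3
    then show ?thesis using step cotr by (meson r_into_trancl trancl_into_trancl)
  qed
qed

lemma trancl_bounds:
  assumes "\<And>a b. (a, b) \<in> I \<Longrightarrow> a \<in> V \<and> b \<in> V \<and> a < b" "(a, b) \<in> I\<^sup>+"
  shows "a \<in> V \<and> b \<in> V \<and> a < b"
  using assms(2) by (induction rule: trancl_induct) (use assms(1) in force)+

lemma trancl_uminus:
  assumes "\<And>a b. (a, b) \<in> I \<Longrightarrow> (- b, - a) \<in> (I :: int rel)" "(a, b) \<in> I\<^sup>+"
  shows "(- b, - a) \<in> I\<^sup>+"
  using assms(2)
  by (induction rule: trancl_induct) (use assms(1) in \<open>auto intro: trancl_into_trancl2\<close>)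

lemma exists_join:
  assumes "x \<in> Bn" "y \<in> Bn"
  obtains z where "z \<in> Bn" "inversions z = (inversions x \<union> inversions y)\<^sup>+"
proof -
  let ?I = "inversions x \<union> inversions y"
  have sub: "a \<in> V \<and> b \<in> V \<and> a < b" if "(a, b) \<in> ?I" for a b
    using that by (auto simp: inversions_iff)
  have cotr: "(a, b) \<in> ?I \<or> (b, c) \<in> ?I" if "(a, c) \<in> ?I" "b \<in> V" "a < b" "b < c" for a b c
    using that inversions_cotrans by blast
  have sym: "(- b, - a) \<in> ?I" if "(a, b) \<in> ?I" for a b
    using that assms by (auto simp: inversions_uminus)
  show thesis
  proof (rule signed_perm_of_inversions[of "?I\<^sup>+"])
    show "\<And>a b. (a, b) \<in> ?I\<^sup>+ \<Longrightarrow> a \<in> V \<and> b \<in> V \<and> a < b"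
      using trancl_bounds[of ?I] sub by blast
    show "\<And>a b. (a, b) \<in> ?I\<^sup>+ \<Longrightarrow> (- b, - a) \<in> ?I\<^sup>+"
      using trancl_uminus[of ?I] sym by blast
    show "\<And>a b c. (a, c) \<in> ?I\<^sup>+ \<Longrightarrow> b \<in> V \<Longrightarrow> a < b \<Longrightarrow> b < c \<Longrightarrow> (a, b) \<in> ?I\<^sup>+ \<or> (b, c) \<in> ?I\<^sup>+"
      using trancl_cotrans[of ?I] sub cotr by blast
  qed (use that in auto)
qed

text \<open>Taking complements interchanges transitivity and cotransitivity, so the complement of
  the closure is again an inversion set.\<close>

lemma exists_meet:
  assumes "x \<in> Bn" "y \<in> Bn"
  obtains z where "z \<in> Bn" "noninversions z = (noninversions x \<union> noninversions y)\<^sup>+"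
proof -
  let ?I = "noninversions x \<union> noninversions y"
  have sub: "a \<in> V \<and> b \<in> V \<and> a < b" if "(a, b) \<in> ?I" for a b
    using that by (auto simp: noninversions_def)
  have cotr: "(a, b) \<in> ?I \<or> (b, c) \<in> ?I" if "(a, c) \<in> ?I" "b \<in> V" "a < b" "b < c" for a b c
    using that noninversions_cotrans by blast
  have sym: "(- b, - a) \<in> ?I" if "(a, b) \<in> ?I" for a b
    using that assms by (auto simp: noninversions_iff inversions_uminus)
  have tsub: "a \<in> V \<and> b \<in> V \<and> a < b" if "(a, b) \<in> ?I\<^sup>+" for a b
    using trancl_bounds[of ?I] sub that by blast
  have tsym: "(- b, - a) \<in> ?I\<^sup>+" if "(a, b) \<in> ?I\<^sup>+" for a b
    using trancl_uminus[of ?I] sym that by blast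
  have tcotr: "(a, b) \<in> ?I\<^sup>+ \<or> (b, c) \<in> ?I\<^sup>+" if "(a, c) \<in> ?I\<^sup>+" "b \<in> V" "a < b" "b < c" for a b c
    using trancl_cotrans[of ?I] sub cotr that by blast
  let ?T = "{(a, b). a \<in> V \<and> b \<in> V \<and> a < b \<and> (a, b) \<notin> ?I\<^sup>+}"
  show thesis
  proof (rule signed_perm_of_inversions[of ?T])
    show "\<And>a b. (a, b) \<in> ?T \<Longrightarrow> (- b, - a) \<in> ?T"
      using tsym by fastforce
    show "\<And>a b c. (a, b) \<in> ?T \<Longrightarrow> (b, c) \<in> ?T \<Longrightarrow> (a, c) \<in> ?T"
      using tcotr by fastforce
    show "\<And>a b c. (a, c) \<in> ?T \<Longrightarrow> b \<in> V \<Longrightarrow> a < b \<Longrightarrow> b < c \<Longrightarrow> (a, b) \<in> ?T \<or> (b, c) \<in> ?T"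
      using tsub by (auto intro: trancl_trans)
  next
    fix w assume w: "w \<in> Bn" "inversions w = ?T"
    have "(a, b) \<in> noninversions w \<longleftrightarrow> (a, b) \<in> ?I\<^sup>+" for a b
      using tsub[of a b] by (auto simp: noninversions_iff[OF w(1)] w(2))
    then have "noninversions w = ?I\<^sup>+" by (metis subrelI subset_antisym)
    with w(1) show thesis by (rule that)
  qed auto
qed

lemma carrier_weak_order [simp]: "carrier (weak_order n) = Bn"
  by (simp add: weak_order_def)

lemma le_weak_order:
  "\<lbrakk>u \<in> Bn; w \<in> Bn\<rbrakk> \<Longrightarrow> u \<sqsubseteq>\<^bsub>weak_order n\<^esub> w \<longleftrightarrow> u \<preceq> w"
  by (simp add: weak_order_def weak_le_iff)

lemma lless_weak_order:
  "\<lbrakk>u \<in> Bn; w \<in> Bn\<rbrakk> \<Longrightarrow> u \<sqsubset>\<^bsub>weak_order n\<^esub> w \<longleftrightarrow> inversions u \<subset> inversions w"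
  using inversions_inject by (auto simp: lless_def le_weak_order) (auto simp: weak_order_def)

abbreviation weak_join :: "(int \<Rightarrow> int) \<Rightarrow> (int \<Rightarrow> int) \<Rightarrow> int \<Rightarrow> int" where
  "weak_join x y \<equiv> x \<squnion>\<^bsub>weak_order n\<^esub> y"

abbreviation weak_meet :: "(int \<Rightarrow> int) \<Rightarrow> (int \<Rightarrow> int) \<Rightarrow> int \<Rightarrow> int" where
  "weak_meet x y \<equiv> x \<sqinter>\<^bsub>weak_order n\<^esub> y"

lemma weak_join_eqI:
  assumes "x \<in> Bn" "y \<in> Bn" "z \<in> Bn"
    and "x \<preceq> z" "y \<preceq> z"
    and "\<And>u. u \<in> Bn \<Longrightarrow> x \<preceq> u \<Longrightarrow> y \<preceq> u
      \<Longrightarrow> z \<preceq> u"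
  shows "weak_join x y = z"
proof -
  have upper: "u \<in> Upper (weak_order n) {x, y} \<longleftrightarrow> u \<in> Bn \<and> x \<preceq> u \<and> y \<preceq> u" for u
  proof -
    have "u \<in> Upper (weak_order n) {x, y} \<longleftrightarrow> u \<in> Bn \<and> x \<sqsubseteq>\<^bsub>weak_order n\<^esub> u \<and> y \<sqsubseteq>\<^bsub>weak_order n\<^esub> u"
      unfolding Upper_def carrier_weak_order using assms(1,2) by blast
    then show ?thesis
      using assms(1,2) by (cases "u \<in> Bn") (simp_all add: le_weak_order)
  qed
  \<comment> \<open>Suprema are defined by choice; once \<open>z\<close> is known to be the only
    least upper bound, the chosen value is determined.\<close>
  have least: "least (weak_order n) u (Upper (weak_order n) {x, y}) \<longleftrightarrow> u = z" for u
  proof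
    assume "least (weak_order n) u (Upper (weak_order n) {x, y})"
    moreover have z: "z \<in> Upper (weak_order n) {x, y}"
      using assms(3-5) by (simp add: upper)
    ultimately have "u \<in> Upper (weak_order n) {x, y}" "u \<sqsubseteq>\<^bsub>weak_order n\<^esub> z"
      unfolding least_def by blast+
    then have "u \<in> Bn" "inversions u = inversions z"
      using assms(3) assms(6)[of u] unfolding upper by (simp_all add: le_weak_order subset_antisym)
    then show "u = z" using assms(3) inversions_inject by blast
  next
    assume u: "u = z"
    have "z \<in> Upper (weak_order n) {x, y}" using assms(3-5) by (simp add: upper)
    moreover have "z \<sqsubseteq>\<^bsub>weak_order n\<^esub> v" if "v \<in> Upper (weak_order n) {x, y}" for v
      using that assms(3,6) unfolding upper by (simp add: le_weak_order)
    ultimately show "least (weak_order n) u (Upper (weak_order n) {x, y})"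
      unfolding least_def u carrier_weak_order using upper by blast
  qed
  show ?thesis
    unfolding join_def Lattice.sup_def least by simp
qed

lemma weak_meet_eqI:
  assumes "x \<in> Bn" "y \<in> Bn" "z \<in> Bn"
    and "z \<preceq> x" "z \<preceq> y"
    and "\<And>u. u \<in> Bn \<Longrightarrow> u \<preceq> x \<Longrightarrow> u \<preceq> y
      \<Longrightarrow> u \<preceq> z"
  shows "weak_meet x y = z"
proof -
  have lower: "u \<in> Lower (weak_order n) {x, y} \<longleftrightarrow> u \<in> Bn \<and> u \<preceq> x \<and> u \<preceq> y" for u
  proof -
    have "u \<in> Lower (weak_order n) {x, y} \<longleftrightarrow> u \<in> Bn \<and> u \<sqsubseteq>\<^bsub>weak_order n\<^esub> x \<and> u \<sqsubseteq>\<^bsub>weak_order n\<^esub> y"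
      unfolding Lower_def carrier_weak_order using assms(1,2) by blast
    then show ?thesis
      using assms(1,2) by (cases "u \<in> Bn") (simp_all add: le_weak_order)
  qed
  have greatest: "greatest (weak_order n) u (Lower (weak_order n) {x, y}) \<longleftrightarrow> u = z" for u
  proof
    assume "greatest (weak_order n) u (Lower (weak_order n) {x, y})"
    moreover have z: "z \<in> Lower (weak_order n) {x, y}"
      using assms(3-5) by (simp add: lower)
    ultimately have "u \<in> Lower (weak_order n) {x, y}" "z \<sqsubseteq>\<^bsub>weak_order n\<^esub> u"
      unfolding greatest_def by blast+
    then have "u \<in> Bn" "inversions u = inversions z"
      using assms(3) assms(6)[of u] unfolding lower by (simp_all add: le_weak_order subset_antisym)
    then show "u = z" using assms(3) inversions_inject by blast
  next
    assume u: "u = z"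
    have "z \<in> Lower (weak_order n) {x, y}" using assms(3-5) by (simp add: lower)
    moreover have "v \<sqsubseteq>\<^bsub>weak_order n\<^esub> z" if "v \<in> Lower (weak_order n) {x, y}" for v
      using that assms(3,6) unfolding lower by (simp add: le_weak_order)
    ultimately show "greatest (weak_order n) u (Lower (weak_order n) {x, y})"
      unfolding greatest_def u carrier_weak_order using lower by blast
  qed
  show ?thesis
    unfolding meet_def Lattice.inf_def greatest by simp
qed

lemma weak_join:
  assumes "x \<in> Bn" "y \<in> Bn"
  shows weak_join_closed: "weak_join x y \<in> Bn"
    and inversions_weak_join: "inversions (weak_join x y) = (inversions x \<union> inversions y)\<^sup>+"
proof -
  obtain z where z: "z \<in> Bn" "inversions z = (inversions x \<union> inversions y)\<^sup>+"
    using exists_join[OF assms] .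
  have "weak_join x y = z"
  proof (rule weak_join_eqI[OF assms z(1)])
    fix u assume "x \<preceq> u" "y \<preceq> u"
    then have "(inversions x \<union> inversions y)\<^sup>+ \<subseteq> (inversions u)\<^sup>+"
      by (intro trancl_mono_subset) blast
    moreover have "trans (inversions u)"
      using inversions_trans by (rule transI)
    ultimately show "z \<preceq> u" by (simp add: z(2))
  qed (auto simp: z(2))
  then show "weak_join x y \<in> Bn" "inversions (weak_join x y) = (inversions x \<union> inversions y)\<^sup>+"
    using z by simp_all
qed

lemma weak_meet:
  assumes "x \<in> Bn" "y \<in> Bn"
  shows weak_meet_closed: "weak_meet x y \<in> Bn"
    and noninversions_weak_meet: "noninversions (weak_meet x y) = (noninversions x \<union> noninversions y)\<^sup>+"
proof -
  obtain z where z: "z \<in> Bn" "noninversions z = (noninversions x \<union> noninversions y)\<^sup>+"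
    using exists_meet[OF assms] .
  have "weak_meet x y = z"
  proof (rule weak_meet_eqI[OF assms z(1)])
    fix u assume "u \<in> Bn" "u \<preceq> x" "u \<preceq> y"
    then have "(noninversions x \<union> noninversions y)\<^sup>+ \<subseteq> (noninversions u)\<^sup>+"
      using assms by (intro trancl_mono_subset) (simp add: noninversions_subset_iff)
    moreover have "trans (noninversions u)"
      using noninversions_trans by (rule transI)
    ultimately show "u \<preceq> z"
      using z \<open>u \<in> Bn\<close> by (simp flip: noninversions_subset_iff)
  qed (use z assms in \<open>auto simp flip: noninversions_subset_iff\<close>)
  then show "weak_meet x y \<in> Bn" "noninversions (weak_meet x y) = (noninversions x \<union> noninversions y)\<^sup>+"
    using z by simp_all
qed

lemma inversions_weak_meet_subset:
  assumes "x \<in> Bn" "y \<in> Bn"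
  shows "inversions (weak_meet x y) \<subseteq> inversions x \<inter> inversions y"
  using noninversions_weak_meet[OF assms] weak_meet_closed[OF assms] assms
  by (auto simp flip: noninversions_subset_iff)

lemma weak_join_absorb:
  "\<lbrakk>x \<in> Bn; y \<in> Bn; x \<preceq> y\<rbrakk> \<Longrightarrow> weak_join x y = y"
  by (rule weak_join_eqI) auto

lemma weak_meet_absorb:
  "\<lbrakk>x \<in> Bn; y \<in> Bn; x \<preceq> y\<rbrakk> \<Longrightarrow> weak_meet x y = x"
  by (rule weak_meet_eqI) auto

lemma weak_join_comm: "weak_join x y = weak_join y x"
  by (simp add: join_def insert_commute)

lemma weak_meet_comm: "weak_meet x y = weak_meet y x"
  by (simp add: meet_def insert_commute)

section \<open>Lattice congruences of the weak order\<close>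

abbreviation congruence :: "(int \<Rightarrow> int) rel \<Rightarrow> bool" where
  "congruence \<equiv> lattice_congruence (weak_order n)"

lemma congruence_closed: "\<lbrakk>congruence \<theta>; (x, y) \<in> \<theta>\<rbrakk> \<Longrightarrow> x \<in> Bn \<and> y \<in> Bn"
  by (auto simp: lattice_congruence_def equiv_def refl_on_def)

lemma congruence_refl: "\<lbrakk>congruence \<theta>; x \<in> Bn\<rbrakk> \<Longrightarrow> (x, x) \<in> \<theta>"
  by (auto simp: lattice_congruence_def equiv_def refl_on_def)

lemma congruence_sym: "\<lbrakk>congruence \<theta>; (x, y) \<in> \<theta>\<rbrakk> \<Longrightarrow> (y, x) \<in> \<theta>"
  by (auto simp: lattice_congruence_def equiv_def dest: symD)

lemma congruence_trans: "\<lbrakk>congruence \<theta>; (x, y) \<in> \<theta>; (y, z) \<in> \<theta>\<rbrakk> \<Longrightarrow> (x, z) \<in> \<theta>"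
  by (auto simp: lattice_congruence_def equiv_def dest: transD)

lemma congruence_join:
  "\<lbrakk>congruence \<theta>; (x, y) \<in> \<theta>; z \<in> Bn\<rbrakk> \<Longrightarrow> (weak_join x z, weak_join y z) \<in> \<theta>"
  using congruence_refl by (simp add: lattice_congruence_def)

lemma congruence_meet:
  "\<lbrakk>congruence \<theta>; (x, y) \<in> \<theta>; z \<in> Bn\<rbrakk> \<Longrightarrow> (weak_meet x z, weak_meet y z) \<in> \<theta>"
  using congruence_refl by (simp add: lattice_congruence_def)

lemma congruence_convex:
  assumes "congruence \<theta>" "(x, z) \<in> \<theta>" "y \<in> Bn"
    and "x \<preceq> y" "y \<preceq> z"
  shows "(x, y) \<in> \<theta>" "(y, z) \<in> \<theta>"
proof -
  have "x \<in> Bn" "z \<in> Bn"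
    using congruence_closed assms by auto
  then have "weak_join x y = y" "weak_join z y = z" "weak_meet x y = x" "weak_meet z y = y"
    using assms by (simp_all add: weak_join_absorb weak_meet_absorb weak_join_comm[of z] weak_meet_comm[of z])
  then show "(x, y) \<in> \<theta>" "(y, z) \<in> \<theta>"
    using congruence_join[OF assms(1-3)] congruence_meet[OF assms(1-3)] by simp_all
qed

text \<open>Joining the contracted edge with \<open>b\<close> carries it to the opposite side of the
  polygon, and meeting the result with \<open>a'\<close> carries it back. There it covers the whole
  chain from \<open>x\<close> to \<open>a'\<close>, hence also the side edges above
  \<open>a\<close>.\<close>

lemma congruence_polygon:
  assumes "congruence \<theta>" and B: "{x, a, a', b, y} \<subseteq> Bn"
    and "(x, a) \<in> \<theta>"
    and le: "x \<preceq> a'" "a' \<preceq> y"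
      "x \<preceq> b" "b \<preceq> y" "a \<preceq> y"
    and join: "\<And>z. z \<in> Bn \<Longrightarrow> a \<preceq> z \<Longrightarrow> b \<preceq> z
      \<Longrightarrow> y \<preceq> z"
    and meet: "inversions a' \<inter> inversions b \<subseteq> inversions x"
  shows "(b, y) \<in> \<theta>" "(x, a') \<in> \<theta>"
proof -
  have "weak_join x b = b"
    using B le by (auto intro!: weak_join_absorb)
  moreover have "weak_join a b = y"
    using B le by (intro weak_join_eqI join) auto
  ultimately show by_edge: "(b, y) \<in> \<theta>"
    using congruence_join[of \<theta> x a b] assms(1,3) B by simp
  have "weak_meet b a' = x" "weak_meet y a' = a'"
    using B le meet by (auto intro!: weak_meet_eqI)
  then show "(x, a') \<in> \<theta>"
    using congruence_meet[OF assms(1) by_edge, of a'] B by simp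
qed

text \<open>Membership in a congruence thus becomes a question about edges:
  \<open>exists_edge_below\<close> supplies a first edge inside the interval, and induction treats
  the rest.\<close>

lemma congruence_chain:
  assumes "congruence \<theta>" "u \<in> Bn" "w \<in> Bn" "u \<preceq> w"
    and "\<And>v v' p q. \<lbrakk>edge v v' p q; u \<preceq> v; v' \<preceq> w\<rbrakk> \<Longrightarrow> (v, v') \<in> \<theta>"
  shows "(u, w) \<in> \<theta>"
  using assms(2,4,5)
proof (induction "card (inversions w - inversions u)" arbitrary: u rule: less_induct)
  case less
  show ?case
  proof (cases "inversions u = inversions w")
    case True
    then have "u = w" using inversions_inject less.prems assms(3) by blast
    then show ?thesis using congruence_refl assms(1,3) by blast
  next
    case False
    then have "inversions u \<subset> inversions w" using less.prems by blast
    then obtain k where k: "k < n" "u (lo k) < u (hi k)" "(u (lo k), u (hi k)) \<in> inversions w"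
      using exists_edge_below less.prems assms(3) by blast
    define u' where "u' = u \<circ> simple_refl k"
    have e: "edge u u' (u (lo k)) (u (hi k))"
      unfolding u'_def by (rule inversions_simple_refl) (use less.prems k in auto)
    then have u': "u' \<in> Bn" "u' \<preceq> w" "u \<preceq> u'"
      using k less.prems assms(3) by (auto simp: edge_def inversions_uminus)
    have "card (inversions w - inversions u') < card (inversions w - inversions u)"
      by (rule psubset_card_mono) (use e k in \<open>auto simp: edge_def\<close>)
    then have "(u', w) \<in> \<theta>"
      using less.hyps[of u'] less.prems(3) u' by blast
    moreover have "(u, u') \<in> \<theta>"
      using less.prems(3)[OF e] u' by blast
    ultimately show ?thesis using congruence_trans assms(1) by blast
  qed
qed

section \<open>Covers and join-irreducible elements\<close>

lemma covers_iff_edge: "covers (weak_order n) w u \<longleftrightarrow> (\<exists>p q. edge u w p q)"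
proof
  assume c: "covers (weak_order n) w u"
  then have uw: "u \<in> Bn" "w \<in> Bn" "inversions u \<subset> inversions w"
    by (auto simp: covers_def lless_weak_order)
  obtain k where k: "k < n" "u (lo k) < u (hi k)" "(u (lo k), u (hi k)) \<in> inversions w"
    using exists_edge_below[OF uw] .
  define u' where "u' = u \<circ> simple_refl k"
  have e: "edge u u' (u (lo k)) (u (hi k))"
    unfolding u'_def by (rule inversions_simple_refl) (use uw k in auto)
  then have u': "u' \<in> Bn" "u' \<preceq> w" "inversions u \<subset> inversions u'"
    using k uw by (auto simp: edge_def inversions_uminus)
  then have "inversions u' = inversions w"
    using c uw by (auto simp: covers_def lless_weak_order)
  then have "u' = w" using u' uw inversions_inject by blast
  with e show "\<exists>p q. edge u w p q" by blast
next
  assume "\<exists>p q. edge u w p q"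
  then obtain p q where e: "edge u w p q" by blast
  then have uw: "u \<in> Bn" "w \<in> Bn" "inversions u \<subset> inversions w"
    by (auto simp: edge_def)
  have False if z: "z \<in> Bn" "inversions u \<subset> inversions z" "inversions z \<subset> inversions w" for z
  proof -
    \<comment> \<open>The two pairs added by an edge are negatives of each other, so a symmetric set
      contains both or neither and cannot lie strictly in between.\<close>
    have "(p, q) \<in> inversions z \<longleftrightarrow> (- q, - p) \<in> inversions z"
      using inversions_uminus[OF z(1)] by blast
    then show False using z(2,3) e by (auto simp: edge_def)
  qed
  then show "covers (weak_order n) w u"
    using uw by (auto simp: covers_def lless_weak_order)
qed

lemma unique_descent:
  assumes "w \<in> Bn" "k < n" "\<And>i. i < n \<Longrightarrow> w (hi i) < w (lo i) \<longleftrightarrow> i = k"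
  shows "join_irreducible (weak_order n) w" "lower_elem (weak_order n) w = w \<circ> simple_refl k"
    "edge (w \<circ> simple_refl k) w (w (hi k)) (w (lo k))"
proof -
  show e: "edge (w \<circ> simple_refl k) w (w (hi k)) (w (lo k))"
    using assms inversions_simple_refl' by blast
  have c: "covers (weak_order n) w u \<longleftrightarrow> u = w \<circ> simple_refl k" for u
    using e assms(3) edge_position unfolding covers_iff_edge by metis
  show "join_irreducible (weak_order n) w" "lower_elem (weak_order n) w = w \<circ> simple_refl k"
    using assms(1) by (simp_all add: join_irreducible_def lower_elem_def c)
qed

section \<open>Congruences defined by a designation of the points\<close>

text \<open>The chain starts at \<open>p\<close> or in \<open>R\<close> and ends at \<open>q\<close>
  or outside \<open>R\<close>. Some link must make this change, and it is a link of the kind that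
  \<open>arc_below\<close> tests.\<close>

lemma trancl_crossing:
  fixes p q :: int
  assumes "(a, b) \<in> N\<^sup>+" "\<And>c d. (c, d) \<in> N \<Longrightarrow> c < d" "p \<le> a" "a = p \<or> a \<in> R"
    and "b \<le> q" "b = q \<or> b \<notin> R"
  obtains c d where "(c, d) \<in> N" "p \<le> c" "d \<le> q" "c = p \<or> c \<in> R" "d = q \<or> d \<notin> R"
proof -
  have "\<exists>c d. (c, d) \<in> N \<and> p \<le> c \<and> d \<le> q \<and> (c = p \<or> c \<in> R) \<and> (d = q \<or> d \<notin> R)"
    using assms(1,5,6)
  proof (induction rule: trancl_induct)
    case (base y)
    then show ?case using assms by blast
  next
    case (step y z)
    have "a < y"
      using step(1) by (induction rule: trancl_induct) (use assms(2) in force)+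
    moreover have "y < z" using assms(2) step by blast
    ultimately show ?case
      using step assms(3) by (cases "y \<in> R") fastforce+
  qed
  then show thesis using that by blast
qed

text \<open>For a set \<open>R\<close> of right points, \<open>arc_below\<close> says that \<open>x\<close> lies above the join-irreducible
  element whose arc from \<open>p\<close> to \<open>q\<close> leaves exactly the points of \<open>R\<close> on its right, and \<open>arc_above\<close>
  that \<open>x\<close> lies below the meet-irreducible element whose arc leaves exactly these points on its left.\<close>

definition arc_below :: "int set \<Rightarrow> int \<Rightarrow> int \<Rightarrow> (int \<Rightarrow> int) \<Rightarrow> bool" where
  "arc_below R p q x \<longleftrightarrow> (\<forall>a\<in>V. \<forall>b\<in>V. p \<le> a \<longrightarrow> a < b \<longrightarrow> b \<le> q \<longrightarrow> a = p \<or> a \<in> R \<longrightarrow> b = q \<or> b \<notin> R \<longrightarrow>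
     (a, b) \<in> inversions x)"

definition arc_above :: "int set \<Rightarrow> int \<Rightarrow> int \<Rightarrow> (int \<Rightarrow> int) \<Rightarrow> bool" where
  "arc_above R p q x \<longleftrightarrow> (\<forall>a\<in>V. \<forall>b\<in>V. p \<le> a \<longrightarrow> a < b \<longrightarrow> b \<le> q \<longrightarrow> a = p \<or> a \<notin> R \<longrightarrow> b = q \<or> b \<in> R \<longrightarrow>
     (a, b) \<notin> inversions x)"

definition designation_rel :: "int set \<Rightarrow> (int \<Rightarrow> int) rel" where
  "designation_rel R = {(x, y). x \<in> Bn \<and> y \<in> Bn \<and>
     (\<forall>p\<in>V. \<forall>q\<in>V. p < q \<longrightarrow> arc_below R p q x = arc_below R p q y)}"

lemma arc_belowD:
  "\<lbrakk>arc_below R p q x; a \<in> V; b \<in> V; p \<le> a; a < b; b \<le> q; a = p \<or> a \<in> R; b = q \<or> b \<notin> R\<rbrakk>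
    \<Longrightarrow> (a, b) \<in> inversions x"
  unfolding arc_below_def by blast

text \<open>A pair not inverted in the meet is a chain of pairs not inverted in \<open>x\<close> or
  in \<open>y\<close>. By \<open>trancl_crossing\<close> one link of this chain already violates the
  condition for \<open>x\<close> or for \<open>y\<close>.\<close>

lemma arc_below_meet:
  assumes "x \<in> Bn" "y \<in> Bn"
  shows "arc_below R p q (weak_meet x y) \<longleftrightarrow> arc_below R p q x \<and> arc_below R p q y"
proof
  assume "arc_below R p q (weak_meet x y)"
  then show "arc_below R p q x \<and> arc_below R p q y"
    using inversions_weak_meet_subset[OF assms] unfolding arc_below_def by blast
next
  assume xy: "arc_below R p q x \<and> arc_below R p q y"
  show "arc_below R p q (weak_meet x y)"
    unfolding arc_below_def
  proof (intro ballI impI, rule ccontr)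
    fix a b assume ab: "a \<in> V" "b \<in> V" "p \<le> a" "a < b" "b \<le> q" "a = p \<or> a \<in> R" "b = q \<or> b \<notin> R"
      and "(a, b) \<notin> inversions (weak_meet x y)"
    then have "(a, b) \<in> noninversions (weak_meet x y)"
      using weak_meet_closed[OF assms] by (simp add: noninversions_iff)
    then have chain: "(a, b) \<in> (noninversions x \<union> noninversions y)\<^sup>+"
      using noninversions_weak_meet[OF assms] by simp
    obtain c d where cd: "(c, d) \<in> noninversions x \<union> noninversions y" "p \<le> c" "d \<le> q"
        "c = p \<or> c \<in> R" "d = q \<or> d \<notin> R"
      by (rule trancl_crossing[OF chain _ ab(3,6,5,7)]) (auto simp: noninversions_def)
    then have "c \<in> V" "d \<in> V" "c < d" "(c, d) \<notin> inversions x \<or> (c, d) \<notin> inversions y"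
      using assms by (auto simp: noninversions_iff)
    then show False using xy cd unfolding arc_below_def by blast
  qed
qed

lemma arc_above_join:
  assumes "x \<in> Bn" "y \<in> Bn"
  shows "arc_above R p q (weak_join x y) \<longleftrightarrow> arc_above R p q x \<and> arc_above R p q y"
proof
  assume "arc_above R p q (weak_join x y)"
  then show "arc_above R p q x \<and> arc_above R p q y"
    using inversions_weak_join[OF assms] unfolding arc_above_def by blast
next
  assume xy: "arc_above R p q x \<and> arc_above R p q y"
  show "arc_above R p q (weak_join x y)"
    unfolding arc_above_def
  proof (intro ballI impI notI)
    fix a b assume ab: "a \<in> V" "b \<in> V" "p \<le> a" "a < b" "b \<le> q" "a = p \<or> a \<notin> R" "b = q \<or> b \<in> R"
      and "(a, b) \<in> inversions (weak_join x y)"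
    then have chain: "(a, b) \<in> (inversions x \<union> inversions y)\<^sup>+"
      using inversions_weak_join[OF assms] by simp
    have ab': "a = p \<or> a \<in> - R" "b = q \<or> b \<notin> - R" using ab by auto
    obtain c d where cd: "(c, d) \<in> inversions x \<union> inversions y" "p \<le> c" "d \<le> q"
        "c = p \<or> c \<in> - R" "d = q \<or> d \<notin> - R"
      by (rule trancl_crossing[OF chain _ ab(3) ab'(1) ab(5) ab'(2)]) (auto simp: inversions_iff)
    then have "c \<in> V" "d \<in> V" "c < d"
      by (auto simp: inversions_iff)
    then show False using xy cd unfolding arc_above_def by blast
  qed
qed

text \<open>An inverted pair \<open>(a, b)\<close> as below with \<open>b - a\<close> minimal already lies on an arc below \<open>x\<close>. So the
  equivalence defined by the arcs below, which respects meets, is also the one defined by the arcs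
  above, which respects joins.\<close>

lemma arc_above_iff:
  assumes "x \<in> Bn"
  shows "arc_above R p q x \<longleftrightarrow> \<not> (\<exists>a\<in>V. \<exists>b\<in>V. p \<le> a \<and> a < b \<and> b \<le> q \<and> (a = p \<or> a \<notin> R) \<and> (b = q \<or> b \<in> R) \<and>
     arc_below R a b x)"
proof
  assume "arc_above R p q x"
  then show "\<not> (\<exists>a\<in>V. \<exists>b\<in>V. p \<le> a \<and> a < b \<and> b \<le> q \<and> (a = p \<or> a \<notin> R) \<and> (b = q \<or> b \<in> R) \<and> arc_below R a b x)"
    unfolding arc_above_def arc_below_def by (metis order_refl)
next
  assume none: "\<not> (\<exists>a\<in>V. \<exists>b\<in>V. p \<le> a \<and> a < b \<and> b \<le> q \<and> (a = p \<or> a \<notin> R) \<and> (b = q \<or> b \<in> R) \<and> arc_below R a b x)"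
  have "(a, b) \<notin> inversions x"
    if "a \<in> V" "b \<in> V" "p \<le> a" "a < b" "b \<le> q" "a = p \<or> a \<notin> R" "b = q \<or> b \<in> R" for a b
    using that
  proof (induction "nat (b - a)" arbitrary: a b rule: less_induct)
    case less
    show ?case
    proof
      assume "(a, b) \<in> inversions x"
      then have ba: "before x b a" by (simp add: inversions_iff)
      have "arc_below R a b x"
        unfolding arc_below_def
      proof (intro ballI impI)
        fix c d assume cd: "c \<in> V" "d \<in> V" "a \<le> c" "c < d" "d \<le> b" "c = a \<or> c \<in> R" "d = b \<or> d \<notin> R"
        have "c = a \<or> before x a c"
        proof (cases "c = a")
          case False
          then have "(a, c) \<notin> inversions x"
            using less.hyps[of c a] less.prems cd by auto
          then show ?thesis using False cd less.prems assms not_before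
            by (metis inversions_iff order_le_less)
        qed simp
        moreover have "d = b \<or> before x d b"
        proof (cases "d = b")
          case False
          then have "(d, b) \<notin> inversions x"
            using less.hyps[of b d] less.prems cd by auto
          then show ?thesis using False cd less.prems assms not_before
            by (metis inversions_iff order_le_less)
        qed simp
        ultimately have "before x d c"
          using ba before_trans by blast
        then show "(c, d) \<in> inversions x" using cd by (simp add: inversions_iff)
      qed
      then show False using none less.prems by blast
    qed
  qed
  then show "arc_above R p q x" unfolding arc_above_def by blast
qed

lemma arc_below_iff:
  assumes "x \<in> Bn"
  shows "arc_below R p q x \<longleftrightarrow> \<not> (\<exists>a\<in>V. \<exists>b\<in>V. p \<le> a \<and> a < b \<and> b \<le> q \<and> (a = p \<or> a \<in> R) \<and> (b = q \<or> b \<notin> R) \<and>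
     arc_above R a b x)"
proof
  assume "arc_below R p q x"
  then show "\<not> (\<exists>a\<in>V. \<exists>b\<in>V. p \<le> a \<and> a < b \<and> b \<le> q \<and> (a = p \<or> a \<in> R) \<and> (b = q \<or> b \<notin> R) \<and> arc_above R a b x)"
    unfolding arc_above_def arc_below_def by (metis order_refl)
next
  assume none: "\<not> (\<exists>a\<in>V. \<exists>b\<in>V. p \<le> a \<and> a < b \<and> b \<le> q \<and> (a = p \<or> a \<in> R) \<and> (b = q \<or> b \<notin> R) \<and> arc_above R a b x)"
  have "(a, b) \<in> inversions x"
    if "a \<in> V" "b \<in> V" "p \<le> a" "a < b" "b \<le> q" "a = p \<or> a \<in> R" "b = q \<or> b \<notin> R" for a b
    using that
  proof (induction "nat (b - a)" arbitrary: a b rule: less_induct)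
    case less
    show ?case
    proof (rule ccontr)
      assume "(a, b) \<notin> inversions x"
      then have ab: "before x a b"
        using less.prems assms not_before by (metis inversions_iff order_less_irrefl)
      have "arc_above R a b x"
        unfolding arc_above_def
      proof (intro ballI impI)
        fix c d assume cd: "c \<in> V" "d \<in> V" "a \<le> c" "c < d" "d \<le> b" "c = a \<or> c \<notin> R" "d = b \<or> d \<in> R"
        have "c = a \<or> before x c a"
          using less.hyps[of c a] less.prems cd by (auto simp: inversions_iff order_le_less)
        moreover have "d = b \<or> before x b d"
          using less.hyps[of b d] less.prems cd by (auto simp: inversions_iff order_le_less)
        ultimately have "before x c d"
          using ab before_trans by blast
        then show "(c, d) \<notin> inversions x" using before_asym by (auto simp: inversions_iff)
      qed
      then show False using none less.prems by blast
    qed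
  qed
  then show "arc_below R p q x" unfolding arc_below_def by blast
qed

lemma designation_rel_above:
  assumes "x \<in> Bn" "y \<in> Bn"
  shows "(x, y) \<in> designation_rel R \<longleftrightarrow> (\<forall>p\<in>V. \<forall>q\<in>V. p < q \<longrightarrow> arc_above R p q x = arc_above R p q y)"
proof
  assume "(x, y) \<in> designation_rel R"
  then have *: "arc_below R p q x = arc_below R p q y" if "p \<in> V" "q \<in> V" "p < q" for p q
    using that by (auto simp: designation_rel_def)
  show "\<forall>p\<in>V. \<forall>q\<in>V. p < q \<longrightarrow> arc_above R p q x = arc_above R p q y"
    unfolding arc_above_iff[OF assms(1)] arc_above_iff[OF assms(2)] by (simp add: * cong: conj_cong)
next
  assume *: "\<forall>p\<in>V. \<forall>q\<in>V. p < q \<longrightarrow> arc_above R p q x = arc_above R p q y"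
  have "arc_below R p q x = arc_below R p q y" if "p \<in> V" "q \<in> V" "p < q" for p q
    unfolding arc_below_iff[OF assms(1)] arc_below_iff[OF assms(2)] by (simp add: * cong: conj_cong)
  then show "(x, y) \<in> designation_rel R"
    using assms by (simp add: designation_rel_def)
qed

lemma congruence_designation_rel: "congruence (designation_rel R)"
  unfolding lattice_congruence_def carrier_weak_order
proof (intro conjI allI impI)
  show "equiv (Bn) (designation_rel R)"
    by (intro equivI refl_onI symI transI) (auto simp: designation_rel_def)
next
  fix x x' y y' assume xy: "(x, x') \<in> designation_rel R" "(y, y') \<in> designation_rel R"
  then have B: "x \<in> Bn" "x' \<in> Bn" "y \<in> Bn" "y' \<in> Bn"
    by (auto simp: designation_rel_def)
  show "(weak_meet x y, weak_meet x' y') \<in> designation_rel R"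
    using xy by (auto simp: designation_rel_def arc_below_meet weak_meet_closed)
  show "(weak_join x y, weak_join x' y') \<in> designation_rel R"
    using xy B by (simp add: designation_rel_above arc_above_join weak_join_closed)
qed

text \<open>An arc below \<open>w\<close> whose condition involves \<open>(p, q)\<close> would also
  require \<open>(i, q)\<close> or \<open>(p, i)\<close> to be inverted, depending on whether
  \<open>i\<close> is in \<open>R\<close>; but \<open>i\<close> lies on the wrong side for this. For
  the negative pair the same argument uses \<open>- i\<close>. So no arc is gained along the
  edge.\<close>

lemma edge_in_designation_rel:
  assumes e: "edge u w p q" and R: "\<And>v. v \<in> V \<Longrightarrow> - v \<in> R \<longleftrightarrow> v \<notin> R"
    and i: "i \<in> V" "p < i" "i < q" "i \<in> R \<longleftrightarrow> before w i q"
  shows "(u, w) \<in> designation_rel R"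
proof -
  have uw: "u \<in> Bn" "w \<in> Bn" "inversions w = inversions u \<union> {(p, q), (- q, - p)}"
      "p \<in> V" "q \<in> V"
    using e by (auto simp: edge_def)
  have "arc_below R a b w = arc_below R a b u" for a b
  proof
    assume "arc_below R a b u"
    then show "arc_below R a b w" using uw(3) unfolding arc_below_def by blast
  next
    have iq: "before w i q \<longleftrightarrow> before w i p"
      using edge_adjacent[OF e, of i] i by auto
    have iq': "\<not> before w i q \<longleftrightarrow> before w q i"
      using not_before[OF uw(2), of i q] i by simp
    assume w: "arc_below R a b w"
    have no: False if "a \<le> p" "q \<le> b" "p = a \<or> p \<in> R" "q = b \<or> q \<notin> R"
    proof (cases "i \<in> R")
      case True
      then have "(i, q) \<in> inversions w"
        by (intro arc_belowD[OF w]) (use that i uw in auto)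
      then show False using True i by (auto simp: inversions_iff before_def)
    next
      case False
      then have "(p, i) \<in> inversions w"
        by (intro arc_belowD[OF w]) (use that i uw in auto)
      then show False using False i iq by (auto simp: inversions_iff before_def)
    qed
    have no': False if "a \<le> - q" "- p \<le> b" "- q = a \<or> - q \<in> R" "- p = b \<or> - p \<notin> R"
    proof (cases "i \<in> R")
      case True
      then have "- i \<notin> R" using R[of i] i by simp
      then have "(- q, - i) \<in> inversions w"
        by (intro arc_belowD[OF w]) (use that i uw in auto)
      then show False
        unfolding inversions_uminus[OF uw(2)] using True i by (auto simp: inversions_iff before_def)
    next
      case False
      then have "- i \<in> R" using R[of i] i by simp
      then have "(- i, - p) \<in> inversions w"
        by (intro arc_belowD[OF w]) (use that i uw in auto)
      then show False
        unfolding inversions_uminus[OF uw(2)] using False i iq by (auto simp: inversions_iff before_def)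
    qed
    show "arc_below R a b u"
      unfolding arc_below_def
    proof (intro ballI impI)
      fix c d assume cd: "c \<in> V" "d \<in> V" "a \<le> c" "c < d" "d \<le> b" "c = a \<or> c \<in> R" "d = b \<or> d \<notin> R"
      then have "(c, d) \<in> inversions w" using w unfolding arc_below_def by blast
      moreover have "(c, d) \<noteq> (p, q)" "(c, d) \<noteq> (- q, - p)" using no no' cd by auto
      ultimately show "(c, d) \<in> inversions u" using uw(3) by blast
    qed
  qed
  then show ?thesis using uw by (simp add: designation_rel_def)
qed

text \<open>The arc from \<open>p\<close> to \<open>q\<close> is not below \<open>u\<close>, since
  \<open>(p, q)\<close> itself is not inverted, and hence not below \<open>w\<close>. A pair
  responsible for this failure has an end strictly between \<open>p\<close> and \<open>q\<close>
  that lies on the wrong side.\<close>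

lemma edge_in_designation_relD:
  assumes e: "edge u w p q" and uw: "(u, w) \<in> designation_rel R"
  obtains i where "i \<in> V" "p < i" "i < q" "i \<in> R \<longleftrightarrow> before w i q"
proof -
  have B: "w \<in> Bn" "p \<in> V" "q \<in> V" "p < q" "(p, q) \<notin> inversions u"
    using e by (auto simp: edge_def)
  then have "\<not> arc_below R p q u"
    unfolding arc_below_def by auto
  then have "\<not> arc_below R p q w"
    using uw B by (auto simp: designation_rel_def)
  then obtain a b where ab: "a \<in> V" "b \<in> V" "p \<le> a" "a < b" "b \<le> q" "a = p \<or> a \<in> R" "b = q \<or> b \<notin> R"
      "(a, b) \<notin> inversions w"
    unfolding arc_below_def by blast
  then have bef: "before w a b"
    using not_before[OF B(1), of a b] by (auto simp: inversions_iff)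
  have qp: "before w q p" using edge_before_top[OF e] .
  have ab': "b \<noteq> p" "a \<noteq> q" using ab by auto
  show thesis
  proof (cases "a \<noteq> p \<and> before w a q")
    case True
    then show thesis using that[of a] ab by auto
  next
    case False
    then have "a = p \<or> before w q a"
      using not_before[OF B(1), of a q] ab' by auto
    then have "a = p \<or> before w p a"
      using edge_adjacent[OF e, of a] ab ab' not_before[OF B(1)] by blast
    then have "before w p b" using bef before_trans by blast
    then have "before w q b" "b \<noteq> q"
      using qp before_trans before_asym by blast+
    then show thesis using that[of b] ab before_asym by (auto simp: order_le_less)
  qed
qed

text \<open>The meet of the two top elements still lies above the arc, so it joins with the second bottom
  element to the second top element.\<close>

lemma edge_transfer:
  assumes \<theta>: "congruence \<theta>" and e: "edge u w p q" and e': "edge u' w' p q"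
    and side: "\<And>y. y \<in> V \<Longrightarrow> p < y \<Longrightarrow> y < q \<Longrightarrow> before w y q \<longleftrightarrow> before w' y q"
    and uw: "(u, w) \<in> \<theta>"
  shows "(u', w') \<in> \<theta>"
proof -
  have B: "u \<in> Bn" "w \<in> Bn" "u' \<in> Bn" "w' \<in> Bn"
    and pq: "p \<in> V" "q \<in> V" "p < q"
    and inv: "inversions w = inversions u \<union> {(p, q), (- q, - p)}"
      "inversions w' = inversions u' \<union> {(p, q), (- q, - p)}" "(p, q) \<notin> inversions u" "(p, q) \<notin> inversions u'"
    using e e' by (auto simp: edge_def)
  let ?m = "weak_meet w w'" and ?m' = "weak_meet u w'"
  have m: "?m \<in> Bn" "?m' \<in> Bn"
    using B weak_meet_closed by auto
  have pqm: "(p, q) \<in> inversions ?m"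
  proof (rule ccontr)
    assume "(p, q) \<notin> inversions ?m"
    then have "(p, q) \<in> noninversions ?m"
      using m pq by (simp add: noninversions_iff)
    then have chain: "(p, q) \<in> (noninversions w \<union> noninversions w')\<^sup>+"
      using noninversions_weak_meet B by simp
    \<comment> \<open>The set consists of the points on the right of the arc. The link found goes
      from \<open>p\<close> or a right-hand point to \<open>q\<close> or a left-hand point, so it is
      inverted in \<open>w\<close>, and also in \<open>w'\<close>, which has the same sides.\<close>
    obtain c d where cd: "(c, d) \<in> noninversions w \<union> noninversions w'" "p \<le> c" "d \<le> q"
        "c = p \<or> c \<in> {y. before w q y}" "d = q \<or> d \<notin> {y. before w q y}"
      by (rule trancl_crossing[OF chain, of p "{y. before w q y}" q]) (auto simp: noninversions_def)
    then have cdV: "c \<in> V" "d \<in> V" "c < d" "before w c d \<or> before w' c d"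
      by (auto simp: noninversions_def)
    have "before w q c" "d = q \<or> before w d q"
      using cd edge_before_top[OF e] not_before[OF B(2)] by auto
    moreover have "before w' q c" "d = q \<or> before w' d q"
      using cd cdV edge_before_top[OF e'] side[of c] side[of d] not_before[OF B(2)] not_before[OF B(4)]
      by (auto simp: order_le_less before_asym)
    ultimately have "before w d c" "before w' d c"
      using before_trans by blast+
    then show False using cdV before_asym by blast
  qed
  have sub: "inversions ?m \<subseteq> inversions w'" "inversions ?m' \<subseteq> inversions u'"
    using inversions_weak_meet_subset[OF B(2,4)] inversions_weak_meet_subset[OF B(1,4)] inv B(1)
    by (auto simp: inversions_uminus)
  have "weak_join ?m u' = w'"
  proof (rule weak_join_eqI[OF m(1) B(3,4) sub(1)])
    fix z assume "z \<in> Bn" "inversions ?m \<subseteq> inversions z" "u' \<preceq> z"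
    then show "w' \<preceq> z"
      using pqm inv by (auto simp: inversions_uminus)
  qed (use inv in auto)
  moreover have "weak_join ?m' u' = u'"
    using m B sub by (simp add: weak_join_absorb)
  ultimately show ?thesis
    using congruence_join[OF \<theta> congruence_meet[OF \<theta> uw B(4)] B(3)] by simp
qed

section \<open>Hexagons and octagons\<close>

lemma block_arith:
  fixes s t x x' :: int
  assumes "4 * t \<le> x" "x \<le> 4 * t + 2" "4 * t \<le> x'" "x' \<le> 4 * t + 2" "s \<noteq> t"
  shows "x < 4 * s \<longleftrightarrow> x' < 4 * s" "4 * s < x \<longleftrightarrow> 4 * s < x'" "x \<noteq> 4 * s"
  using assms by presburger+

text \<open>For \<open>t \<noteq> 0\<close> the block and its mirror image lie on different sides of
  zero, so offsets do not affect their comparison.\<close>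

lemma block_uminus_arith:
  fixes t x x' y y' :: int
  assumes "4 * t \<le> x" "x \<le> 4 * t + 2" "4 * t \<le> x'" "x' \<le> 4 * t + 2" "t \<noteq> 0"
    and "- (4 * t) - 2 \<le> y" "y \<le> - (4 * t)" "- (4 * t) - 2 \<le> y'" "y' \<le> - (4 * t)"
  shows "x < y \<longleftrightarrow> x' < y'" "y < x \<longleftrightarrow> y' < x'" "x \<noteq> y"
  using assms by presburger+

lemma two_blocks_cases:
  obtains "a \<in> P" "b \<in> P" | "a \<in> N" "b \<in> N" | "a \<in> P" "b \<in> N" | "a \<in> N" "b \<in> P"
    | "a \<in> P" "b \<notin> P \<union> N" | "a \<in> N" "b \<notin> P \<union> N" | "a \<notin> P \<union> N" "b \<in> P" | "a \<notin> P \<union> N" "b \<in> N"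
    | "a \<notin> P \<union> N" "b \<notin> P \<union> N"
  by blast

text \<open>Positions are multiplied by 4 to make room for \<open>p\<close>, \<open>m\<close> and \<open>q\<close> next to the old position of \<open>q\<close>,
  in the order given by the offsets \<open>i\<close>, \<open>j\<close>, \<open>k\<close>. The other points keep their order.\<close>

definition hex_key :: "(int \<Rightarrow> int) \<Rightarrow> int \<Rightarrow> int \<Rightarrow> int \<Rightarrow> int \<Rightarrow> int \<Rightarrow> int \<Rightarrow> int \<Rightarrow> int" where
  "hex_key w p m q i j k v =
     (let t = 4 * inv w q in
      if v = p then t + i else if v = m then t + j else if v = q then t + k
      else if v = - p then - t - i else if v = - m then - t - j else if v = - q then - t - k
      else 4 * inv w v)"

definition hex_pairs :: "int \<Rightarrow> int \<Rightarrow> int \<Rightarrow> int \<Rightarrow> int \<Rightarrow> int \<Rightarrow> int rel" where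
  "hex_pairs p m q i j k =
     (if j < i then {(p, m), (- m, - p)} else {}) \<union> (if k < j then {(m, q), (- q, - m)} else {}) \<union>
     (if k < i then {(p, q), (- q, - p)} else {})"

text \<open>The inversion set of the bottom vertex: the offsets \<open>0\<close>, \<open>1\<close>,
  \<open>2\<close> keep \<open>p\<close>, \<open>m\<close>, \<open>q\<close> in increasing order.
  The other vertices add pairs from \<open>hex_pairs\<close> to it.\<close>

definition hex_base :: "(int \<Rightarrow> int) \<Rightarrow> int \<Rightarrow> int \<Rightarrow> int \<Rightarrow> int rel" where
  "hex_base w p m q = {(a, b). a \<in> V \<and> b \<in> V \<and> a < b \<and> hex_key w p m q 0 1 2 b < hex_key w p m q 0 1 2 a}"

section \<open>The vertices of a hexagon\<close>

context
  fixes w :: "int \<Rightarrow> int" and p m q :: int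
  assumes w: "w \<in> Bn"
    and V: "p \<in> V" "m \<in> V" "q \<in> V"
    and ord: "p < m" "m < q" "p + q \<noteq> 0" "p + m \<noteq> 0" "m + q \<noteq> 0"
begin

lemma hex_nonzero: "p \<noteq> 0" "m \<noteq> 0" "q \<noteq> 0" "inv w q \<noteq> 0"
  using V inv_in_V[OF w, of q] by (auto simp: V_def)

lemma hex_distinct: "p \<noteq> - p" "m \<noteq> - m" "q \<noteq> - q" "p \<noteq> - q" "q \<noteq> - p" "p \<noteq> - m"
  "m \<noteq> - p" "m \<noteq> - q" "q \<noteq> - m" "p \<noteq> m" "m \<noteq> q" "p \<noteq> q"
  using ord hex_nonzero by auto

lemma hex_key_block:
  shows "hex_key w p m q i j k p = 4 * inv w q + i" "hex_key w p m q i j k m = 4 * inv w q + j"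
    "hex_key w p m q i j k q = 4 * inv w q + k" "hex_key w p m q i j k (- p) = - (4 * inv w q) - i"
    "hex_key w p m q i j k (- m) = - (4 * inv w q) - j" "hex_key w p m q i j k (- q) = - (4 * inv w q) - k"
  by (simp_all only: hex_key_def Let_def hex_distinct hex_distinct[symmetric] neg_equal_iff_equal if_False if_True refl)

lemma hex_pairs_block:
  "(p, m) \<in> hex_pairs p m q i j k \<longleftrightarrow> j < i" "(m, q) \<in> hex_pairs p m q i j k \<longleftrightarrow> k < j"
  "(p, q) \<in> hex_pairs p m q i j k \<longleftrightarrow> k < i" "(- m, - p) \<in> hex_pairs p m q i j k \<longleftrightarrow> j < i"
  "(- q, - m) \<in> hex_pairs p m q i j k \<longleftrightarrow> k < j" "(- q, - p) \<in> hex_pairs p m q i j k \<longleftrightarrow> k < i"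
  by (simp_all add: hex_pairs_def hex_distinct hex_distinct[symmetric])

lemma hex_pairs_subset:
  "(a, b) \<in> hex_pairs p m q i j k \<Longrightarrow> a \<in> V \<and> b \<in> V \<and> a < b \<and> ({a, b} \<subseteq> {p, m, q} \<or> {a, b} \<subseteq> {- p, - m, - q})"
  using V ord by (auto simp: hex_pairs_def split: if_splits)

lemma hex_base_block:
  "(p, m) \<notin> hex_base w p m q" "(m, q) \<notin> hex_base w p m q" "(p, q) \<notin> hex_base w p m q"
  "(- m, - p) \<notin> hex_base w p m q" "(- q, - m) \<notin> hex_base w p m q" "(- q, - p) \<notin> hex_base w p m q"
  by (simp_all add: hex_base_def hex_key_block)

lemma hex_key_other:
  "v \<notin> {p, m, q, - p, - m, - q} \<Longrightarrow> hex_key w p m q i j k v = 4 * inv w v"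
  by (auto simp: hex_key_def Let_def)

lemma hex_key_uminus: "hex_key w p m q i j k (- v) = - hex_key w p m q i j k v"
proof (cases "v \<in> {p, m, q, - p, - m, - q}")
  case True
  then show ?thesis by (auto simp: hex_key_block)
next
  case False
  then have "- v \<notin> {p, m, q, - p, - m, - q}" by auto
  then show ?thesis
    unfolding hex_key_other[OF False] by (simp add: hex_key_other inv_uminus[OF w])
qed

lemma hex_other_position:
  assumes "v \<notin> {p, m, q, - p, - m, - q}"
  shows "inv w v \<noteq> inv w q" "inv w v \<noteq> - inv w q"
  using assms inv_uminus[OF w, of q] by (auto simp: inv_eq_iff[OF w] simp flip: inv_uminus[OF w])

lemma hex_key_bounds:
  assumes "{i, j, k} \<subseteq> {0..2}" "v \<in> {p, m, q}"
  shows "4 * inv w q \<le> hex_key w p m q i j k v" "hex_key w p m q i j k v \<le> 4 * inv w q + 2"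
  using assms by (auto simp: hex_key_block)

lemma hex_key_uminus_bounds:
  assumes "{i, j, k} \<subseteq> {0..2}" "v \<in> {- p, - m, - q}"
  shows "- (4 * inv w q) - 2 \<le> hex_key w p m q i j k v" "hex_key w p m q i j k v \<le> - (4 * inv w q)"
  using assms by (auto simp: hex_key_block)

text \<open>The block fills a gap that contains no key of another point and does not overlap its
  mirror image, so rearranging it changes only comparisons inside the block or inside the mirror
  image.\<close>

lemma hex_key_cong:
  assumes ijk: "{i, j, k} \<subseteq> {0..2}" and "\<not> {a, b} \<subseteq> {p, m, q}" "\<not> {a, b} \<subseteq> {- p, - m, - q}"
  shows "hex_key w p m q i j k a < hex_key w p m q i j k b \<longleftrightarrow> hex_key w p m q 0 1 2 a < hex_key w p m q 0 1 2 b"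
proof -
  have base: "{0, 1, 2} \<subseteq> {0..2 :: int}" by simp
  note bounds = hex_key_bounds[OF ijk] hex_key_bounds[OF base]
    and bounds' = hex_key_uminus_bounds[OF ijk] hex_key_uminus_bounds[OF base]
  note nz = hex_nonzero(4)
  have un: "{p, m, q} \<union> {- p, - m, - q} = {p, m, q, - p, - m, - q}" by blast
  show ?thesis
  proof (cases rule: two_blocks_cases[where a = a and P = "{p, m, q}" and b = b and N = "{- p, - m, - q}", unfolded un,
        case_names PP NN 1 2 3 4 5 6 7])
    case PP
    then show ?thesis using assms(2) by simp
  next
    case NN
    then show ?thesis using assms(3) by simp
  next
    case 1
    show ?thesis
      by (rule block_uminus_arith(1)[OF bounds(1,2,3,4)[OF 1(1)] nz bounds'(1,2,3,4)[OF 1(2)]])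
  next
    case 2
    show ?thesis
      by (rule block_uminus_arith(2)[OF bounds(1,2,3,4)[OF 2(2)] nz bounds'(1,2,3,4)[OF 2(1)]])
  next
    case 3
    show ?thesis
      unfolding hex_key_other[OF 3(2)]
      by (rule block_arith(1)[OF bounds(1,2,3,4)[OF 3(1)] hex_other_position(1)[OF 3(2)]])
  next
    case 4
    have "\<And>i j k. hex_key w p m q i j k a < 4 * inv w b \<longleftrightarrow> 4 * (- inv w b) < hex_key w p m q i j k (- a)"
      by (auto simp: hex_key_uminus)
    moreover have "- a \<in> {p, m, q}" "- inv w b \<noteq> inv w q"
      using 4(1) hex_other_position(2)[OF 4(2)] by auto
    ultimately show ?thesis
      unfolding hex_key_other[OF 4(2)] using block_arith(2)[OF bounds(1,2,3,4)[of "- a"]] by blast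
  next
    case 5
    show ?thesis
      unfolding hex_key_other[OF 5(1)]
      by (rule block_arith(2)[OF bounds(1,2,3,4)[OF 5(2)] hex_other_position(1)[OF 5(1)]])
  next
    case 6
    have "\<And>i j k. 4 * inv w a < hex_key w p m q i j k b \<longleftrightarrow> hex_key w p m q i j k (- b) < 4 * (- inv w a)"
      by (auto simp: hex_key_uminus)
    moreover have "- b \<in> {p, m, q}" "- inv w a \<noteq> inv w q"
      using 6(2) hex_other_position(2)[OF 6(1)] by auto
    ultimately show ?thesis
      unfolding hex_key_other[OF 6(1)] using block_arith(1)[OF bounds(1,2,3,4)[of "- b"]] by blast
  next
    case 7
    then show ?thesis by (simp add: hex_key_other)
  qed
qed

lemma hex_key_inj:
  assumes ijk: "{i, j, k} \<subseteq> {0..2}" and "i \<noteq> j" "j \<noteq> k" "i \<noteq> k"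
  shows "inj_on (hex_key w p m q i j k) V"
proof (rule inj_onI)
  have pos: False
    if "a \<in> {p, m, q, - p, - m, - q}" "b \<notin> {p, m, q, - p, - m, - q}"
      "hex_key w p m q i j k a = hex_key w p m q i j k b" for a b
  proof (cases "a \<in> {p, m, q}")
    case True
    show False
      using that(3) block_arith(3)[OF hex_key_bounds[OF ijk True] hex_key_bounds[OF ijk True]
          hex_other_position(1)[OF that(2)]]
      unfolding hex_key_other[OF that(2)] by simp
  next
    case False
    then have neg: "- a \<in> {p, m, q}" "- inv w b \<noteq> inv w q"
      using that hex_other_position(2)[OF that(2)] by auto
    then show False
      using that(3) block_arith(3)[OF hex_key_bounds[OF ijk neg(1)] hex_key_bounds[OF ijk neg(1)] neg(2)]
      unfolding hex_key_other[OF that(2)] hex_key_uminus by simp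
  qed
  have mixed: False
    if "a \<in> {p, m, q}" "b \<in> {- p, - m, - q}" "hex_key w p m q i j k a = hex_key w p m q i j k b" for a b
    using block_uminus_arith(3)[OF hex_key_bounds[OF ijk that(1)] hex_key_bounds[OF ijk that(1)] hex_nonzero(4)
        hex_key_uminus_bounds[OF ijk that(2)] hex_key_uminus_bounds[OF ijk that(2)]] that(3) by simp
  fix a b assume eq: "hex_key w p m q i j k a = hex_key w p m q i j k b"
  have un: "{p, m, q} \<union> {- p, - m, - q} = {p, m, q, - p, - m, - q}" by blast
  show "a = b"
  proof (cases rule: two_blocks_cases[where a = a and P = "{p, m, q}" and b = b and N = "{- p, - m, - q}", unfolded un])
    case 1
    then show ?thesis using assms eq by (auto simp: hex_key_block)
  next
    case 2
    then show ?thesis using assms eq by (auto simp: hex_key_block)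
  next
    case 3
    then show ?thesis using mixed eq by blast
  next
    case 4
    then show ?thesis using mixed[of b a] eq by simp
  next
    case 9
    then show ?thesis using eq by (simp add: hex_key_other inv_eq_iff[OF w])
  qed (use pos[of a b] pos[of b a] eq in auto)
qed

lemma hex_element:
  assumes "{i, j, k} \<subseteq> {0..2}" "i \<noteq> j" "j \<noteq> k" "i \<noteq> k"
  obtains x where "x \<in> Bn" "inversions x = hex_base w p m q \<union> hex_pairs p m q i j k"
    "ordered_by (hex_key w p m q i j k) x"
proof -
  obtain x where x: "x \<in> Bn"
    "ordered_by (hex_key w p m q i j k) x"
    using signed_perm_of_key[OF hex_key_uminus hex_key_inj[OF assms]] by blast
  have "(a, b) \<in> inversions x \<longleftrightarrow> (a, b) \<in> hex_base w p m q \<union> hex_pairs p m q i j k" for a b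
  proof (cases "a \<in> V \<and> b \<in> V \<and> a < b")
    case True
    then have lhs: "(a, b) \<in> inversions x \<longleftrightarrow> hex_key w p m q i j k b < hex_key w p m q i j k a"
      using x by (simp add: inversions_iff)
    consider "{a, b} \<subseteq> {p, m, q}" | "{a, b} \<subseteq> {- p, - m, - q}"
      | "\<not> {a, b} \<subseteq> {p, m, q}" "\<not> {a, b} \<subseteq> {- p, - m, - q}" by blast
    then show ?thesis
    proof cases
      case 1
      then consider "a = p" "b = m" | "a = m" "b = q" | "a = p" "b = q" using True ord by auto
      then show ?thesis unfolding lhs
        by cases (simp_all add: hex_pairs_block hex_base_block hex_key_block)
    next
      case 2
      then consider "a = - m" "b = - p" | "a = - q" "b = - m" | "a = - q" "b = - p" using True ord by auto
      then show ?thesis unfolding lhs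
        by cases (simp_all add: hex_pairs_block hex_base_block hex_key_block)
    next
      case 3
      then have "(a, b) \<notin> hex_pairs p m q i j k" using hex_pairs_subset by blast
      then show ?thesis
        using hex_key_cong[OF assms(1), of b a] 3 True by (simp add: lhs hex_base_def insert_commute)
    qed
  next
    case False
    then show ?thesis using hex_pairs_subset by (auto simp: inversions_iff hex_base_def)
  qed
  then have "inversions x = hex_base w p m q \<union> hex_pairs p m q i j k"
    by (metis subrelI subset_antisym)
  with x that show thesis by blast
qed

end

text \<open>The keys place \<open>m\<close> next to \<open>p\<close> and \<open>q\<close>, and hence \<open>- m\<close> next to \<open>- p\<close> and \<open>- q\<close>; the last
  assumption says that this does not move \<open>- m\<close> to the other side of the arc.\<close>

lemma hexagon:
  assumes \<theta>: "congruence \<theta>" and e: "edge u w p q"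
    and m: "m \<in> V" "p < m" "m < q" and ne: "p + q \<noteq> 0" "p + m \<noteq> 0" "m + q \<noteq> 0"
    and side: "\<lbrakk>p < - m; - m < q\<rbrakk> \<Longrightarrow> before w (- m) q \<longleftrightarrow> before w (- p) q"
  shows hexagon_lower: "\<exists>u' w'. edge u' w' p m \<and>
      (\<forall>y\<in>V. p < y \<longrightarrow> y < m \<longrightarrow> before w' y m = before w y q) \<and> ((u', w') \<in> \<theta> \<longrightarrow> (u, w) \<in> \<theta>)"
    and hexagon_upper: "\<exists>u' w'. edge u' w' m q \<and>
      (\<forall>y\<in>V. m < y \<longrightarrow> y < q \<longrightarrow> before w' y q = before w y q) \<and> ((u', w') \<in> \<theta> \<longrightarrow> (u, w) \<in> \<theta>)"
proof -
  have w: "w \<in> Bn" and pq: "p \<in> V" "q \<in> V" "p < q"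
    using e by (auto simp: edge_def)
  note hyps = w pq(1) m(1) pq(2) m(2,3) ne
  note ex = hex_element[OF hyps]
  note key_block = hex_key_block[OF hyps] and key_other = hex_key_other[OF hyps]
  \<comment> \<open>The offsets belong to \<open>p\<close>, \<open>m\<close>, \<open>q\<close> in
    this order. From left to right the block reads \<open>p m q\<close> in \<open>x\<close>,
    \<open>m p q\<close> in \<open>a\<close>, \<open>m q p\<close> in \<open>a'\<close>,
    \<open>p q m\<close> in \<open>b\<close>, \<open>q p m\<close> in \<open>b'\<close>, and
    \<open>q m p\<close> in \<open>y\<close>.\<close>
  obtain x where x: "x \<in> Bn" "inversions x = hex_base w p m q \<union> hex_pairs p m q 0 1 2"
    by (rule ex[of 0 1 2]) auto
  obtain a where a: "a \<in> Bn" "inversions a = hex_base w p m q \<union> hex_pairs p m q 1 0 2"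
    "ordered_by (hex_key w p m q 1 0 2) a"
    by (rule ex[of 1 0 2]) auto
  obtain a' where a': "a' \<in> Bn" "inversions a' = hex_base w p m q \<union> hex_pairs p m q 2 0 1"
    "ordered_by (hex_key w p m q 2 0 1) a'"
    by (rule ex[of 2 0 1]) auto
  obtain b where b: "b \<in> Bn" "inversions b = hex_base w p m q \<union> hex_pairs p m q 0 2 1"
    "ordered_by (hex_key w p m q 0 2 1) b"
    by (rule ex[of 0 2 1]) auto
  obtain b' where b': "b' \<in> Bn" "inversions b' = hex_base w p m q \<union> hex_pairs p m q 1 2 0"
    "ordered_by (hex_key w p m q 1 2 0) b'"
    by (rule ex[of 1 2 0]) auto
  obtain y where y: "y \<in> Bn" "inversions y = hex_base w p m q \<union> hex_pairs p m q 2 1 0"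
    by (rule ex[of 2 1 0]) auto
  note B = x(1) a(1) a'(1) b(1) b'(1) y(1)
  note inv = x(2) a(2) a'(2) b(2) b'(2) y(2) hex_pairs_def
  note nz = hex_distinct[OF hyps]
  note block = hex_base_block[OF hyps]
  have edges: "edge x a p m" "edge x b m q" "edge a a' p q" "edge b b' p q"
    using B pq m by (simp_all add: edge_def inv block nz nz[symmetric] insert_commute)
  have le: "x \<preceq> a" "a \<preceq> a'" "a' \<preceq> y"
    "x \<preceq> b" "b \<preceq> b'" "b' \<preceq> y"
    by (auto simp: inv)
  have join: "y \<preceq> z"
    if z: "z \<in> Bn" "a \<preceq> z" "b \<preceq> z" for z
  proof -
    have "(p, m) \<in> inversions z" "(m, q) \<in> inversions z"
      using z by (auto simp: inv)
    then have "(p, q) \<in> inversions z"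
      using inversions_trans by blast
    then show ?thesis
      using z by (auto simp: inv inversions_uminus)
  qed
  have meet: "inversions a' \<inter> inversions b \<subseteq> inversions x" "inversions b' \<inter> inversions a \<subseteq> inversions x"
    using block nz m by (auto simp: inv)
  have xa: "(a, a') \<in> \<theta>" "(b, b') \<in> \<theta>" if "(x, a) \<in> \<theta>"
  proof -
    have "(b, y) \<in> \<theta>" "(x, a') \<in> \<theta>"
      using congruence_polygon[OF \<theta> _ that _ _ _ _ _ join meet(1)] B le by auto
    then show "(a, a') \<in> \<theta>" "(b, b') \<in> \<theta>"
      using congruence_convex[OF \<theta>] B le by blast+
  qed
  have xb: "(a, a') \<in> \<theta>" "(b, b') \<in> \<theta>" if "(x, b) \<in> \<theta>"
  proof -
    have "(a, y) \<in> \<theta>" "(x, b') \<in> \<theta>"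
      using congruence_polygon[OF \<theta> _ that _ _ _ _ _ join meet(2)] B le by auto
    then show "(a, a') \<in> \<theta>" "(b, b') \<in> \<theta>"
      using congruence_convex[OF \<theta>] B le by blast+
  qed
  define t where "t = inv w q"
  have t0: "t \<noteq> 0" using hex_nonzero[OF hyps] by (simp add: t_def)
  have mq: "before w (- q) q \<longleftrightarrow> 0 < t"
    by (simp add: before_def inv_uminus[OF w] t_def)
  \<comment> \<open>\<open>- q\<close> and \<open>- p\<close> are neighbours because
    \<open>q\<close> and \<open>p\<close> are, so both are on the same side of
    \<open>q\<close>.\<close>
  have mp: "before w (- p) q \<longleftrightarrow> 0 < t"
  proof -
    have "before w (- q) q \<longleftrightarrow> before w (- q) p"
      using edge_adjacent[OF e, of "- q"] pq nz by simp
    also have "\<dots> \<longleftrightarrow> before w (- p) q"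
      using before_uminus_left[OF w, of q p] .
    finally show ?thesis using mq by simp
  qed
  \<comment> \<open>\<open>l\<close> stands for the offset of the upper endpoint of an edge of the
    hexagon. The block sits at the old position of \<open>q\<close>, so points outside the two
    blocks keep their side; the mirror block is wholly left of the block iff
    \<open>0 < t\<close>.\<close>
  have side': "before w z q \<longleftrightarrow> hex_key w p m q i j k z < 4 * t + l"
    if z: "z \<in> V" "p < z" "z < q" "z \<noteq> m" and ijk: "{i, j, k, l} \<subseteq> {0..2}" for z i j k l
  proof (cases "z \<in> {- p, - m, - q}")
    case True
    have "before w z q \<longleftrightarrow> 0 < t"
      using True mp mq side z by auto
    also have "\<dots> \<longleftrightarrow> hex_key w p m q i j k z < 4 * t + l"
      using True t0 ijk by (auto simp: key_block simp flip: t_def)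
    finally show ?thesis .
  next
    case False
    then have o: "z \<notin> {p, m, q, - p, - m, - q}" using z by auto
    have "inv w z \<noteq> t"
      using z by (simp add: t_def inv_eq_iff[OF w])
    then show ?thesis
      using ijk by (auto simp: key_other[OF o] before_def simp flip: t_def)
  qed
  \<comment> \<open>The edges ending in \<open>a'\<close> and \<open>b'\<close> both have endpoints
    \<open>p\<close> and \<open>q\<close> and differ in the side on which they pass
    \<open>m\<close>. One of them has the same arc as the given edge.\<close>
  have main: "(u, w) \<in> \<theta>" if "(a, a') \<in> \<theta>" "(b, b') \<in> \<theta>"
  proof (cases "before w m q")
    case True
    have "before a' z q \<longleftrightarrow> before w z q" if z: "z \<in> V" "p < z" "z < q" for z
    proof (cases "z = m")
      case True
      then show ?thesis using \<open>before w m q\<close> pq m by (simp add: a'(3) key_block)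
    next
      case False
      then show ?thesis using side'[OF z False, of 2 0 1 1] pq z by (simp add: a'(3) key_block t_def)
    qed
    then show ?thesis using edge_transfer[OF \<theta> edges(3) e _ that(1)] by blast
  next
    case False
    have "before b' z q \<longleftrightarrow> before w z q" if z: "z \<in> V" "p < z" "z < q" for z
    proof (cases "z = m")
      case True
      then show ?thesis using \<open>\<not> before w m q\<close> pq m by (simp add: b'(3) key_block)
    next
      case False
      then show ?thesis using side'[OF z False, of 1 2 0 0] pq z by (simp add: b'(3) key_block t_def)
    qed
    then show ?thesis using edge_transfer[OF \<theta> edges(4) e _ that(2)] by blast
  qed
  show "\<exists>u' w'. edge u' w' p m \<and>
      (\<forall>y\<in>V. p < y \<longrightarrow> y < m \<longrightarrow> before w' y m = before w y q) \<and> ((u', w') \<in> \<theta> \<longrightarrow> (u, w) \<in> \<theta>)"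
  proof (intro exI conjI ballI impI)
    fix z assume "z \<in> V" "p < z" "z < m"
    then show "before a z m = before w z q"
      using side'[of z 1 0 2 0] m by (simp add: a(3) key_block t_def)
  qed (use edges xa main in auto)
  show "\<exists>u' w'. edge u' w' m q \<and>
      (\<forall>y\<in>V. m < y \<longrightarrow> y < q \<longrightarrow> before w' y q = before w y q) \<and> ((u', w') \<in> \<theta> \<longrightarrow> (u, w) \<in> \<theta>)"
  proof (intro exI conjI ballI impI)
    fix z assume "z \<in> V" "m < z" "z < q"
    then show "before b z q = before w z q"
      using side'[of z 0 2 1 1] m pq by (simp add: b(3) key_block t_def)
  qed (use edges xb main in auto)
qed

text \<open>The four points \<open>\<plusminus>m\<close> and \<open>\<plusminus>q\<close> occupy the centre, and a positive point lies left of it iff it is in \<open>S\<close>.\<close>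

definition oct_key :: "int set \<Rightarrow> int \<Rightarrow> int \<Rightarrow> int \<Rightarrow> int \<Rightarrow> int \<Rightarrow> int" where
  "oct_key S m q j k v =
     (if v = m then j else if v = q then k else if v = - m then - j else if v = - q then - k
      else if 0 < v then if v \<in> S then - 3 - v else 3 + v
      else if - v \<in> S then 3 - v else v - 3)"

definition oct_pairs :: "int \<Rightarrow> int \<Rightarrow> int \<Rightarrow> int \<Rightarrow> int rel" where
  "oct_pairs m q j k =
     (if j < 0 then {(- m, m)} else {}) \<union> (if k < 0 then {(- q, q)} else {}) \<union>
     (if k < j then {(m, q), (- q, - m)} else {}) \<union> (if k < - j then {(- m, q), (- q, m)} else {})"

definition oct_base :: "int set \<Rightarrow> int \<Rightarrow> int \<Rightarrow> int rel" where
  "oct_base S m q = {(a, b). a \<in> V \<and> b \<in> V \<and> a < b \<and> oct_key S m q 1 2 b < oct_key S m q 1 2 a}"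

section \<open>The vertices of an octagon\<close>

context
  fixes S :: "int set" and m q :: int
  assumes V: "m \<in> V" "q \<in> V" and ord: "0 < m" "m < q"
begin

lemma oct_key_block:
  "oct_key S m q j k m = j" "oct_key S m q j k q = k"
  "oct_key S m q j k (- m) = - j" "oct_key S m q j k (- q) = - k"
  using ord by (auto simp: oct_key_def)

lemma oct_key_other:
  "v \<notin> {m, q, - m, - q} \<Longrightarrow> oct_key S m q j k v =
     (if 0 < v then if v \<in> S then - 3 - v else 3 + v else if - v \<in> S then 3 - v else v - 3)"
  by (auto simp: oct_key_def)

lemma oct_key_uminus: "v \<in> V \<Longrightarrow> oct_key S m q j k (- v) = - oct_key S m q j k v"
proof (cases "v \<in> {m, q, - m, - q}")
  case False
  assume "v \<in> V"
  then have "v \<noteq> 0" by auto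
  moreover have "- v \<notin> {m, q, - m, - q}" using False by auto
  ultimately show ?thesis using False by (simp add: oct_key_other)
qed (auto simp: oct_key_block)

lemma oct_key_block_bound:
  assumes "(\<bar>j\<bar>, \<bar>k\<bar>) \<in> {(1, 2), (2, 1)}" "v \<in> {m, q, - m, - q}"
  shows "\<bar>oct_key S m q j k v\<bar> \<le> 2"
  using assms by (auto simp: oct_key_block)

text \<open>The absolute value exceeds the bound \<open>2\<close> for the four central points and
  separates the outer points from one another up to sign; oddness separates the remaining
  pairs.\<close>

lemma oct_key_other_abs:
  assumes "v \<notin> {m, q, - m, - q}"
  shows "\<bar>oct_key S m q j k v\<bar> = 3 + \<bar>v\<bar>"
  by (auto simp: oct_key_other[OF assms])

lemma oct_key_other_cong: "v \<notin> {m, q, - m, - q} \<Longrightarrow> oct_key S m q j k v = oct_key S m q 1 2 v"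
  by (simp add: oct_key_other)

lemma oct_key_inj:
  assumes jk: "(\<bar>j\<bar>, \<bar>k\<bar>) \<in> {(1, 2), (2, 1)}"
  shows "inj_on (oct_key S m q j k) V"
proof (rule inj_onI)
  fix a b assume ab: "a \<in> V" "b \<in> V" and eq: "oct_key S m q j k a = oct_key S m q j k b"
  consider "a \<in> {m, q, - m, - q}" "b \<in> {m, q, - m, - q}"
    | "a \<in> {m, q, - m, - q}" "b \<notin> {m, q, - m, - q}"
    | "a \<notin> {m, q, - m, - q}" "b \<in> {m, q, - m, - q}"
    | "a \<notin> {m, q, - m, - q}" "b \<notin> {m, q, - m, - q}" by blast
  then show "a = b"
  proof cases
    case 1
    then show ?thesis using eq jk by (auto simp: oct_key_block)
  next
    case 2
    then show ?thesis
      using eq oct_key_block_bound[OF jk 2(1)] oct_key_other_abs[OF 2(2), of j k] by linarith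
  next
    case 3
    then show ?thesis
      using eq oct_key_block_bound[OF jk 3(2)] oct_key_other_abs[OF 3(1), of j k] by linarith
  next
    case 4
    then have "\<bar>a\<bar> = \<bar>b\<bar>"
      using eq oct_key_other_abs[of a j k] oct_key_other_abs[of b j k] by linarith
    then consider "a = b" | "a = - b" by linarith
    then show ?thesis
    proof cases
      case 2
      then have "oct_key S m q j k b = 0"
        using eq oct_key_uminus[OF ab(2), of j k] by simp
      then show ?thesis using oct_key_other_abs[OF 4(2), of j k] by linarith
    qed
  qed
qed

lemma oct_key_cong:
  assumes jk: "(\<bar>j\<bar>, \<bar>k\<bar>) \<in> {(1, 2), (2, 1)}" and "\<not> {a, b} \<subseteq> {m, q, - m, - q}" "a \<in> V" "b \<in> V"
  shows "oct_key S m q j k a < oct_key S m q j k b \<longleftrightarrow> oct_key S m q 1 2 a < oct_key S m q 1 2 b"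
proof -
  have 12: "(\<bar>1 :: int\<bar>, \<bar>2 :: int\<bar>) \<in> {(1, 2), (2, 1 :: int)}" by simp
  consider "a \<in> {m, q, - m, - q}" "b \<notin> {m, q, - m, - q}"
    | "a \<notin> {m, q, - m, - q}" "b \<in> {m, q, - m, - q}"
    | "a \<notin> {m, q, - m, - q}" "b \<notin> {m, q, - m, - q}" using assms(2) by blast
  then show ?thesis
  proof cases
    case 1
    have "b \<noteq> 0" using assms by auto
    then show ?thesis
      using oct_key_block_bound[OF jk 1(1)] oct_key_block_bound[OF 12 1(1)] oct_key_other_cong[OF 1(2), of j k]
        oct_key_other_abs[OF 1(2), of 1 2] by linarith
  next
    case 2
    have "a \<noteq> 0" using assms by auto
    then show ?thesis
      using oct_key_block_bound[OF jk 2(2)] oct_key_block_bound[OF 12 2(2)] oct_key_other_cong[OF 2(1), of j k]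
        oct_key_other_abs[OF 2(1), of 1 2] by linarith
  next
    case 3
    then show ?thesis using oct_key_other_cong[of _ j k] by simp
  qed
qed

lemma oct_element:
  assumes jk: "(\<bar>j\<bar>, \<bar>k\<bar>) \<in> {(1, 2), (2, 1)}"
  obtains x where "x \<in> Bn" "inversions x = oct_base S m q \<union> oct_pairs m q j k"
    "ordered_by (oct_key S m q j k) x"
proof -
  obtain x where x: "x \<in> Bn"
    "ordered_by (oct_key S m q j k) x"
    using signed_perm_of_key[OF oct_key_uminus oct_key_inj[OF assms]] by blast
  have "(a, b) \<in> inversions x \<longleftrightarrow> (a, b) \<in> oct_base S m q \<union> oct_pairs m q j k" for a b
  proof (cases "a \<in> V \<and> b \<in> V \<and> a < b")
    case True
    then have lhs: "(a, b) \<in> inversions x \<longleftrightarrow> oct_key S m q j k b < oct_key S m q j k a"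
      using x by (simp add: inversions_iff)
    show ?thesis
    proof (cases "{a, b} \<subseteq> {m, q, - m, - q}")
      case blk: True
      then consider "a = - m" "b = m" | "a = - q" "b = q" | "a = m" "b = q" | "a = - q" "b = - m"
        | "a = - m" "b = q" | "a = - q" "b = m" using True ord by auto
      then show ?thesis unfolding lhs
        by cases (use ord True in \<open>auto simp: oct_base_def oct_pairs_def oct_key_block\<close>)
    next
      case False
      then have "(a, b) \<notin> oct_pairs m q j k" by (auto simp: oct_pairs_def)
      then show ?thesis
        using oct_key_cong[OF jk, of b a] False True by (simp add: lhs oct_base_def insert_commute)
    qed
  next
    case False
    then show ?thesis using V ord by (auto simp: inversions_iff oct_base_def oct_pairs_def)
  qed
  then have "inversions x = oct_base S m q \<union> oct_pairs m q j k"
    by (metis subrelI subset_antisym)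
  with x that show thesis by blast
qed

lemma oct_base_block:
  "(- m, m) \<notin> oct_base S m q" "(- q, q) \<notin> oct_base S m q" "(m, q) \<notin> oct_base S m q"
  "(- q, - m) \<notin> oct_base S m q" "(- m, q) \<notin> oct_base S m q" "(- q, m) \<notin> oct_base S m q"
  using ord by (auto simp: oct_base_def oct_key_block)

text \<open>The octagon consists of the chains \<open>x, a1, a2, a3, y\<close> and \<open>x, b1, b2, b3, y\<close>; its top \<open>y\<close> is only
  needed in the proof.\<close>

lemma octagon:
  assumes \<theta>: "congruence \<theta>"
  obtains x a1 a2 a3 b1 b2 b3 where "edge x a1 (- m) m" "edge x b1 m q"
    "edge a1 a2 (- m) q" "edge a2 a3 (- q) q" "edge b1 b2 (- q) q" "edge b2 b3 (- m) q"
    "(x, a1) \<in> \<theta> \<or> (x, b1) \<in> \<theta> \<Longrightarrow> {(a1, a2), (a2, a3), (b1, b2), (b2, b3)} \<subseteq> \<theta>"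
    "ordered_by (oct_key S m q (- 1) 2) a1"
    "ordered_by (oct_key S m q (- 2) 1) a2"
    "ordered_by (oct_key S m q (- 2) (- 1)) a3"
    "ordered_by (oct_key S m q 2 1) b1"
    "ordered_by (oct_key S m q 2 (- 1)) b2"
    "ordered_by (oct_key S m q 1 (- 2)) b3"
proof -
  \<comment> \<open>The offsets belong to \<open>m\<close> and \<open>q\<close>. The centre reads
    \<open>-q -m m q\<close> in \<open>x\<close>, then \<open>-q m -m q\<close>,
    \<open>m -q q -m\<close>, \<open>m q -q -m\<close> along \<open>a1\<close>, \<open>a2\<close>,
    \<open>a3\<close>, and \<open>-m -q q m\<close>, \<open>-m q -q m\<close>,
    \<open>q -m m -q\<close> along \<open>b1\<close>, \<open>b2\<close>, \<open>b3\<close>, and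
    \<open>q m -m -q\<close> in \<open>y\<close>.\<close>
  obtain x where x: "x \<in> Bn" "inversions x = oct_base S m q \<union> oct_pairs m q 1 2"
    by (rule oct_element[of 1 2]) auto
  obtain a1 where a1: "a1 \<in> Bn" "inversions a1 = oct_base S m q \<union> oct_pairs m q (- 1) 2"
    "ordered_by (oct_key S m q (- 1) 2) a1"
    by (rule oct_element[of "- 1" 2]) auto
  obtain a2 where a2: "a2 \<in> Bn" "inversions a2 = oct_base S m q \<union> oct_pairs m q (- 2) 1"
    "ordered_by (oct_key S m q (- 2) 1) a2"
    by (rule oct_element[of "- 2" 1]) auto
  obtain a3 where a3: "a3 \<in> Bn" "inversions a3 = oct_base S m q \<union> oct_pairs m q (- 2) (- 1)"
    "ordered_by (oct_key S m q (- 2) (- 1)) a3"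
    by (rule oct_element[of "- 2" "- 1"]) auto
  obtain b1 where b1: "b1 \<in> Bn" "inversions b1 = oct_base S m q \<union> oct_pairs m q 2 1"
    "ordered_by (oct_key S m q 2 1) b1"
    by (rule oct_element[of 2 1]) auto
  obtain b2 where b2: "b2 \<in> Bn" "inversions b2 = oct_base S m q \<union> oct_pairs m q 2 (- 1)"
    "ordered_by (oct_key S m q 2 (- 1)) b2"
    by (rule oct_element[of 2 "- 1"]) auto
  obtain b3 where b3: "b3 \<in> Bn" "inversions b3 = oct_base S m q \<union> oct_pairs m q 1 (- 2)"
    "ordered_by (oct_key S m q 1 (- 2)) b3"
    by (rule oct_element[of 1 "- 2"]) auto
  obtain y where y: "y \<in> Bn" "inversions y = oct_base S m q \<union> oct_pairs m q (- 1) (- 2)"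
    by (rule oct_element[of "- 1" "- 2"]) auto
  note B = x(1) a1(1) a2(1) a3(1) b1(1) b2(1) b3(1) y(1)
  note inv = x(2) a1(2) a2(2) a3(2) b1(2) b2(2) b3(2) y(2) oct_pairs_def
  note block = oct_base_block
  have edges: "edge x a1 (- m) m" "edge x b1 m q" "edge a1 a2 (- m) q" "edge a2 a3 (- q) q"
      "edge b1 b2 (- q) q" "edge b2 b3 (- m) q"
    using B V ord block by (auto simp: edge_def inv)
  have le: "x \<preceq> a1" "a1 \<preceq> a2" "a2 \<preceq> a3"
    "a3 \<preceq> y" "x \<preceq> b1" "b1 \<preceq> b2"
    "b2 \<preceq> b3" "b3 \<preceq> y"
    by (auto simp: inv)
  have le': "x \<preceq> a2" "x \<preceq> a3" "x \<preceq> b2"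
    "x \<preceq> b3" "a1 \<preceq> y" "a2 \<preceq> y"
    "b1 \<preceq> y" "b2 \<preceq> y"
    "a1 \<preceq> a3" "b1 \<preceq> b3"
    using le by blast+
  have join: "y \<preceq> z"
    if z: "z \<in> Bn" "a1 \<preceq> z" "b1 \<preceq> z" for z
  proof -
    have *: "(- m, m) \<in> inversions z" "(m, q) \<in> inversions z" "(- q, - m) \<in> inversions z"
      using z by (auto simp: inv)
    then have "(- m, q) \<in> inversions z" "(- q, m) \<in> inversions z"
      using inversions_trans by blast+
    moreover from this * have "(- q, q) \<in> inversions z"
      using inversions_trans by blast
    ultimately show ?thesis
      using * z by (auto simp: inv)
  qed
  have meet: "inversions a3 \<inter> inversions b1 \<subseteq> inversions x" "inversions b3 \<inter> inversions a1 \<subseteq> inversions x"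
    using block ord by (auto simp: inv)
  have force: "{(a1, a2), (a2, a3), (b1, b2), (b2, b3)} \<subseteq> \<theta>" if "(x, a1) \<in> \<theta> \<or> (x, b1) \<in> \<theta>"
    using that
  proof
    assume xa: "(x, a1) \<in> \<theta>"
    have b1y: "(b1, y) \<in> \<theta>" and xa3: "(x, a3) \<in> \<theta>"
      using congruence_polygon[OF \<theta> _ xa _ _ _ _ _ join meet(1)] B le le' by auto
    have "(a1, a3) \<in> \<theta>" using congruence_convex(2)[OF \<theta> xa3, of a1] B le le' by simp
    moreover have "(b1, b3) \<in> \<theta>" using congruence_convex(1)[OF \<theta> b1y, of b3] B le le' by simp
    ultimately show ?thesis
      using congruence_convex[OF \<theta>, of a1 a3 a2] congruence_convex[OF \<theta>, of b1 b3 b2] B le by simp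
  next
    assume xb: "(x, b1) \<in> \<theta>"
    have ay: "(a1, y) \<in> \<theta>" and xb3: "(x, b3) \<in> \<theta>"
      using congruence_polygon[OF \<theta> _ xb _ _ _ _ _ join meet(2)] B le le' by auto
    have "(b1, b3) \<in> \<theta>" using congruence_convex(2)[OF \<theta> xb3, of b1] B le le' by simp
    moreover have "(a1, a3) \<in> \<theta>" using congruence_convex(1)[OF \<theta> ay, of a3] B le le' by simp
    ultimately show ?thesis
      using congruence_convex[OF \<theta>, of a1 a3 a2] congruence_convex[OF \<theta>, of b1 b3 b2] B le by simp
  qed
  show thesis
    by (rule that[OF edges force a1(3) a2(3) a3(3) b1(3) b2(3) b3(3)])
qed

end

section \<open>Moving the endpoints of orbifold and long arcs\<close>

text \<open>The arc is its own half-turn, and the half-turn exchanges its sides.\<close>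

lemma edge_symmetric_before:
  assumes e: "edge u w (- q) q" and y: "y \<in> V" "y \<noteq> q" "y \<noteq> - q"
  shows "before w (- y) q \<longleftrightarrow> \<not> before w y q"
proof -
  have w: "w \<in> Bn" using e by (auto simp: edge_def)
  have "before w (- y) q \<longleftrightarrow> before w (- q) y" by (rule before_uminus_left[OF w])
  also have "\<dots> \<longleftrightarrow> \<not> before w y (- q)" using not_before[OF w, of y "- q"] y by auto
  also have "before w y (- q) \<longleftrightarrow> before w y q" using edge_adjacent[OF e, of y] y by auto
  finally show ?thesis .
qed

text \<open>Two side edges of the octagon have the endpoints \<open>- q\<close> and
  \<open>q\<close>: the one up to \<open>a3\<close> passes \<open>m\<close> on the left, the one up
  to \<open>b2\<close> on the right. With \<open>S\<close> read off from \<open>w\<close>, one of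
  them has the given arc, and either bottom edge of the octagon forces it.\<close>

lemma octagon_symmetric:
  assumes \<theta>: "congruence \<theta>" and e: "edge u w (- q) q" and m: "m \<in> V" "0 < m" "m < q"
  shows octagon_symmetric_lower: "\<exists>u' w'. edge u' w' (- m) m \<and>
      (\<forall>y\<in>V. - m < y \<longrightarrow> y < m \<longrightarrow> before w' y m = before w y q) \<and> ((u', w') \<in> \<theta> \<longrightarrow> (u, w) \<in> \<theta>)"
    and octagon_symmetric_upper: "\<exists>u' w'. edge u' w' m q \<and>
      (\<forall>y\<in>V. m < y \<longrightarrow> y < q \<longrightarrow> before w' y q = before w y q) \<and> ((u', w') \<in> \<theta> \<longrightarrow> (u, w) \<in> \<theta>)"
proof -
  have w: "w \<in> Bn" and q: "q \<in> V"
    using e by (auto simp: edge_def)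
  define S where "S = {v. before w v q}"
  note blk = oct_key_block[OF m(1) q m(2,3), of S] and oth = oct_key_other[OF m(1) q m(2,3), of _ S]
  obtain x a1 a2 a3 b1 b2 b3 where edges: "edge x a1 (- m) m" "edge x b1 m q"
    "edge a1 a2 (- m) q" "edge a2 a3 (- q) q" "edge b1 b2 (- q) q" "edge b2 b3 (- m) q"
    and force: "(x, a1) \<in> \<theta> \<or> (x, b1) \<in> \<theta> \<Longrightarrow> {(a1, a2), (a2, a3), (b1, b2), (b2, b3)} \<subseteq> \<theta>"
    and bef: "ordered_by (oct_key S m q (- 1) 2) a1"
    "ordered_by (oct_key S m q (- 2) 1) a2"
    "ordered_by (oct_key S m q (- 2) (- 1)) a3"
    "ordered_by (oct_key S m q 2 1) b1"
    "ordered_by (oct_key S m q 2 (- 1)) b2"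
    by (rule octagon[OF m(1) q m(2,3) \<theta>, of S]) (rule that; assumption)
  have side: "oct_key S m q j k z < l \<longleftrightarrow> before w z q"
    if z: "z \<in> V" "- q < z" "z < q" "z \<notin> {m, - m}" and l: "\<bar>l\<bar> \<le> 2" for z j k l
  proof -
    have o: "z \<notin> {m, q, - m, - q}" and nz: "z \<noteq> 0" using z by auto
    have neg: "before w (- z) q \<longleftrightarrow> \<not> before w z q"
      using edge_symmetric_before[OF e, of z] z by auto
    show ?thesis unfolding oth[OF o] using l nz neg by (auto simp: S_def)
  qed
  have neg_m: "before w (- m) q \<longleftrightarrow> \<not> before w m q"
    using edge_symmetric_before[OF e m(1)] m by auto
  have main: "(u, w) \<in> \<theta>" if "{(a1, a2), (a2, a3), (b1, b2), (b2, b3)} \<subseteq> \<theta>"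
  proof (cases "before w m q")
    case True
    have "before a3 z q \<longleftrightarrow> before w z q" if z: "z \<in> V" "- q < z" "z < q" for z
      using side[of z "- 1" "- 2" "- 1"] z q True neg_m by (cases "z \<in> {m, - m}") (auto simp: bef blk)
    then show ?thesis using edge_transfer[OF \<theta> edges(4) e] that by blast
  next
    case False
    have "before b2 z q \<longleftrightarrow> before w z q" if z: "z \<in> V" "- q < z" "z < q" for z
      using side[of z "- 1" 2 "- 1"] z q False neg_m by (cases "z \<in> {m, - m}") (auto simp: bef blk)
    then show ?thesis using edge_transfer[OF \<theta> edges(5) e] that by blast
  qed
  show "\<exists>u' w'. edge u' w' (- m) m \<and>
      (\<forall>y\<in>V. - m < y \<longrightarrow> y < m \<longrightarrow> before w' y m = before w y q) \<and> ((u', w') \<in> \<theta> \<longrightarrow> (u, w) \<in> \<theta>)"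
  proof (intro exI conjI ballI impI)
    fix z assume "z \<in> V" "- m < z" "z < m"
    then show "before a1 z m = before w z q"
      using side[of z "- 1" "- 1" 2] m by (simp add: bef blk)
  qed (use edges force main in auto)
  show "\<exists>u' w'. edge u' w' m q \<and>
      (\<forall>y\<in>V. m < y \<longrightarrow> y < q \<longrightarrow> before w' y q = before w y q) \<and> ((u', w') \<in> \<theta> \<longrightarrow> (u, w) \<in> \<theta>)"
  proof (intro exI conjI ballI impI)
    fix z assume "z \<in> V" "m < z" "z < q"
    then show "before b1 z q = before w z q"
      using side[of z 1 2 1] m q by (simp add: bef blk)
  qed (use edges force main in auto)
qed

text \<open>No hexagon moves the endpoint \<open>- 1\<close> to \<open>1\<close>, since these are
  negatives of each other. In the octagon with \<open>m = 1\<close> the edges up to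
  \<open>a2\<close> and \<open>b3\<close> have endpoints \<open>- 1\<close> and \<open>q\<close> and
  pass \<open>1\<close> on the left and on the right. The outer keys put \<open>v\<close> and
  \<open>- v\<close> on opposite sides; this is harmless because no negative point lies between
  \<open>- 1\<close> and \<open>q\<close>.\<close>

lemma octagon_long:
  assumes \<theta>: "congruence \<theta>" and e: "edge u w (- 1) q" and q: "1 < q"
  shows "\<exists>u' w'. edge u' w' 1 q \<and>
      (\<forall>y\<in>V. 1 < y \<longrightarrow> y < q \<longrightarrow> before w' y q = before w y q) \<and> ((u', w') \<in> \<theta> \<longrightarrow> (u, w) \<in> \<theta>)"
proof -
  have w: "w \<in> Bn" and V: "q \<in> V" "1 \<in> V"
    using e uminus_V_iff[of 1] by (auto simp: edge_def)
  define S where "S = {v. before w v q}"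
  have one: "(0::int) < 1" by simp
  note blk = oct_key_block[OF V(2,1) one q, of S] and oth = oct_key_other[OF V(2,1) one q, of _ S]
  obtain x a1 a2 a3 b1 b2 b3 where edges: "edge x a1 (- 1) 1" "edge x b1 1 q"
    "edge a1 a2 (- 1) q" "edge a2 a3 (- q) q" "edge b1 b2 (- q) q" "edge b2 b3 (- 1) q"
    and force: "(x, a1) \<in> \<theta> \<or> (x, b1) \<in> \<theta> \<Longrightarrow> {(a1, a2), (a2, a3), (b1, b2), (b2, b3)} \<subseteq> \<theta>"
    and bef: "ordered_by (oct_key S 1 q (- 2) 1) a2"
    "ordered_by (oct_key S 1 q 2 1) b1"
    "ordered_by (oct_key S 1 q 1 (- 2)) b3"
    by (rule octagon[OF V(2,1) one q \<theta>, of S]) (rule that; assumption)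
  have side: "oct_key S 1 q j k z < l \<longleftrightarrow> before w z q"
    if z: "z \<in> V" "1 < z" "z < q" and l: "\<bar>l\<bar> \<le> 2" for z j k l
  proof -
    have o: "z \<notin> {1, q, - 1, - q}" using z by auto
    show ?thesis unfolding oth[OF o] using l z by (auto simp: S_def)
  qed
  have z_eq: "z = 1 \<or> 1 < z" if "z \<in> V" "- 1 < z" for z
    using that by (auto simp: V_def)
  have main: "(u, w) \<in> \<theta>" if "{(a1, a2), (a2, a3), (b1, b2), (b2, b3)} \<subseteq> \<theta>"
  proof (cases "before w 1 q")
    case True
    have "before a2 z q \<longleftrightarrow> before w z q" if z: "z \<in> V" "- 1 < z" "z < q" for z
      using side[of z 1 "- 2" 1] z V True z_eq[OF z(1,2)] by (auto simp: bef blk)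
    then show ?thesis using edge_transfer[OF \<theta> edges(3) e] that by blast
  next
    case False
    have "before b3 z q \<longleftrightarrow> before w z q" if z: "z \<in> V" "- 1 < z" "z < q" for z
      using side[of z "- 2" 1 "- 2"] z V False z_eq[OF z(1,2)] by (auto simp: bef blk)
    then show ?thesis using edge_transfer[OF \<theta> edges(6) e] that by blast
  qed
  show ?thesis
  proof (intro exI conjI ballI impI)
    fix z assume "z \<in> V" "1 < z" "z < q"
    then show "before b1 z q = before w z q"
      using side[of z 1 2 1] V by (simp add: bef blk)
  qed (use edges force main in auto)
qed

section \<open>Generators\<close>

text \<open>An element with its only descent at \<open>k\<close>; \<open>s\<close> means that points
  lie on the left of the arc. The alternative positions allow for the half-turn. Prescribing sides
  of positive points fixes the arcs that occur: either no negative point is between the endpoints,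
  or the arc is symmetric.\<close>

definition arc_element :: "(int \<Rightarrow> int) \<Rightarrow> nat \<Rightarrow> int \<Rightarrow> int \<Rightarrow> bool \<Rightarrow> bool" where
  "arc_element g k p q s \<longleftrightarrow> g \<in> Bn \<and> k < n \<and> (\<forall>i<n. g (hi i) < g (lo i) \<longleftrightarrow> i = k) \<and>
     (g (hi k) = p \<and> g (lo k) = q \<or> g (- lo k) = p \<and> g (- hi k) = q) \<and>
     (\<forall>y\<in>V. 0 < y \<longrightarrow> p < y \<longrightarrow> y < q \<longrightarrow> before g y q = s)"

lemma arc_element:
  assumes g: "arc_element g k p q s"
  shows arc_element_signed_perm: "g \<in> Bn"
    and arc_element_join_irreducible: "join_irreducible (weak_order n) g"
    and arc_element_edge: "edge (lower_elem (weak_order n) g) g p q"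
    and arc_element_side: "\<lbrakk>y \<in> V; 0 < y; p < y; y < q\<rbrakk> \<Longrightarrow> before g y q = s"
proof -
  show B: "g \<in> Bn" and "\<lbrakk>y \<in> V; 0 < y; p < y; y < q\<rbrakk> \<Longrightarrow> before g y q = s"
    using g by (auto simp: arc_element_def)
  have "k < n" "\<And>i. i < n \<Longrightarrow> g (hi i) < g (lo i) \<longleftrightarrow> i = k"
    using g by (auto simp: arc_element_def)
  note d = unique_descent[OF B this]
  show "join_irreducible (weak_order n) g" by (rule d(1))
  show "edge (lower_elem (weak_order n) g) g p q"
    using d(2,3) edge_uminus[OF d(3)] g signed_perm_uminus[OF B] by (auto simp: arc_element_def)
qed

lemma descent_iff:
  assumes "g \<in> Bn"
  shows "g (hi k) < g (lo k) \<longleftrightarrow> (if k = 0 then g 1 < 0 else g (int k + 1) < g (int k))"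
  using signed_perm_uminus[OF assms, of 1] by (auto simp: lo_def hi_def)

lemma arc_elementI:
  assumes "g \<in> Bn" "k < n"
    and "\<And>i. i < n \<Longrightarrow> (if i = 0 then g 1 < 0 else g (int i + 1) < g (int i)) \<longleftrightarrow> i = k"
    and "(d, c) = (hi k, lo k) \<or> (d, c) = (- lo k, - hi k)" "g d = p" "g c = q"
    and "\<And>y. \<lbrakk>y \<in> V; 0 < y; p < y; y < q\<rbrakk> \<Longrightarrow> \<exists>x. g x = y \<and> (x < c \<longleftrightarrow> s)"
  shows "arc_element g k p q s"
proof -
  have "before g y q = s" if y: "y \<in> V" "0 < y" "p < y" "y < q" for y
  proof -
    obtain x where x: "g x = y" "x < c \<longleftrightarrow> s" using assms(7)[OF y] by blast
    have "inv g y = x" "inv g q = c"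
      using x(1) assms(1,6) inv_eqI by blast+
    then show ?thesis using x(2) by (simp add: before_def)
  qed
  then show ?thesis
    using assms(1-6) by (auto simp: arc_element_def descent_iff)
qed

section \<open>Evaluating the generators\<close>

lemma simple_refl_pos:
  "\<lbrakk>1 \<le> k; 0 < x\<rbrakk> \<Longrightarrow> simple_refl k x = (if x = int k then int k + 1 else if x = int k + 1 then int k else x)"
  by (auto simp: simple_refl_def transpose_def)

text \<open>For the words in the first three reflections, which fix all positions above
  \<open>3\<close>, this reduces the \<open>n\<close> possible descents to three evaluations. The
  bound on \<open>g 3\<close> excludes a descent between positions \<open>3\<close> and
  \<open>4\<close>.\<close>

lemma rank_three_descents:
  assumes "g \<in> Bn" "\<And>x. 3 < x \<Longrightarrow> g x = x" "g 3 \<le> 3"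
  shows "(if i = 0 then g 1 < 0 else g (int i + 1) < g (int i)) \<longleftrightarrow>
    i = 0 \<and> g 1 < 0 \<or> i = 1 \<and> g 2 < g 1 \<or> i = 2 \<and> g 3 < g 2"
proof -
  consider "i = 0" | "i = 1" | "i = 2" | "i = 3" | "3 < i" by linarith
  then show ?thesis
    by cases (use assms(2)[of "int i"] assms(2)[of "int i + 1"] assms(2)[of 4] assms(3) in auto)
qed

lemmas word_eval = word_prod_Cons simple_refl_def transpose_def lo_def hi_def

lemma between_one_two: "\<lbrakk>0 < y; y < 2\<rbrakk> \<Longrightarrow> y = (1 :: int)"
  and between_one_three: "\<lbrakk>0 < y; y < 3\<rbrakk> \<Longrightarrow> y = 1 \<or> y = (2 :: int)"
  by auto

lemma arc_element_01: "2 \<le> n \<Longrightarrow> arc_element (word_prod [0, 1]) 1 (- 1) 2 True"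
proof (rule arc_elementI[where d = "2" and c = "1"])
  assume "2 \<le> n"
  then show w: "word_prod [0, 1] \<in> Bn" by (intro word_prod_signed_perm) auto
  show "(if i = 0 then word_prod [0, 1] 1 < 0 else word_prod [0, 1] (int i + 1) < word_prod [0, 1] (int i)) \<longleftrightarrow> i = 1" for i
    by (subst rank_three_descents[OF w]) (auto simp: word_eval)
  \<comment> \<open>The one-line notation begins \<open>2, -1\<close>, so the value \<open>1\<close>
    stands at position \<open>- 2\<close>.\<close>
  show "\<exists>x. word_prod [0, 1] x = y \<and> (x < 1 \<longleftrightarrow> True)" if "y \<in> V" "0 < y" "(- 1) < y" "y < 2" for y
    using between_one_two[OF that(2,4)] by (intro exI[of _ "-2"]) (simp add: word_eval)
qed (simp_all add: word_eval)

lemma arc_element_010: "2 \<le> n \<Longrightarrow> arc_element (word_prod [0, 1, 0]) 0 (- 2) 2 True"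
proof (rule arc_elementI[where d = "1" and c = "-1"])
  assume "2 \<le> n"
  then show w: "word_prod [0, 1, 0] \<in> Bn" by (intro word_prod_signed_perm) auto
  show "(if i = 0 then word_prod [0, 1, 0] 1 < 0 else word_prod [0, 1, 0] (int i + 1) < word_prod [0, 1, 0] (int i)) \<longleftrightarrow> i = 0" for i
    by (subst rank_three_descents[OF w]) (auto simp: word_eval)
  show "\<exists>x. word_prod [0, 1, 0] x = y \<and> (x < -1 \<longleftrightarrow> True)" if "y \<in> V" "0 < y" "(- 2) < y" "y < 2" for y
    using between_one_two[OF that(2,4)] by (intro exI[of _ "-2"]) (simp add: word_eval)
qed (simp_all add: word_eval)

lemma arc_element_10: "2 \<le> n \<Longrightarrow> arc_element (word_prod [1, 0]) 0 (- 2) 2 False"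
proof (rule arc_elementI[where d = "1" and c = "-1"])
  assume "2 \<le> n"
  then show w: "word_prod [1, 0] \<in> Bn" by (intro word_prod_signed_perm) auto
  show "(if i = 0 then word_prod [1, 0] 1 < 0 else word_prod [1, 0] (int i + 1) < word_prod [1, 0] (int i)) \<longleftrightarrow> i = 0" for i
    by (subst rank_three_descents[OF w]) (auto simp: word_eval)
  show "\<exists>x. word_prod [1, 0] x = y \<and> (x < -1 \<longleftrightarrow> False)" if "y \<in> V" "0 < y" "(- 2) < y" "y < 2" for y
    using between_one_two[OF that(2,4)] by (intro exI[of _ "2"]) (simp add: word_eval)
qed (simp_all add: word_eval)

lemma arc_element_101: "2 \<le> n \<Longrightarrow> arc_element (word_prod [1, 0, 1]) 1 (- 1) 2 False"
\<comment> \<open>The one-line notation begins \<open>1, -2\<close>. The descent shows the endpoints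
  \<open>- 2\<close> and \<open>1\<close>; the required endpoints \<open>- 1\<close> and
  \<open>2\<close> are found at the mirrored positions.\<close>
proof (rule arc_elementI[where d = "-1" and c = "-2"])
  assume "2 \<le> n"
  then show w: "word_prod [1, 0, 1] \<in> Bn" by (intro word_prod_signed_perm) auto
  show "(if i = 0 then word_prod [1, 0, 1] 1 < 0 else word_prod [1, 0, 1] (int i + 1) < word_prod [1, 0, 1] (int i)) \<longleftrightarrow> i = 1" for i
    by (subst rank_three_descents[OF w]) (auto simp: word_eval)
  show "\<exists>x. word_prod [1, 0, 1] x = y \<and> (x < -2 \<longleftrightarrow> False)" if "y \<in> V" "0 < y" "(- 1) < y" "y < 2" for y
    using between_one_two[OF that(2,4)] by (intro exI[of _ "1"]) (simp add: word_eval)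
qed (simp_all add: word_eval)

lemma arc_element_010210: "3 \<le> n \<Longrightarrow> arc_element (word_prod [0, 1, 0, 2, 1, 0]) 0 (- 3) 3 True"
proof (rule arc_elementI[where d = "1" and c = "-1"])
  assume "3 \<le> n"
  then show w: "word_prod [0, 1, 0, 2, 1, 0] \<in> Bn" by (intro word_prod_signed_perm) auto
  show "(if i = 0 then word_prod [0, 1, 0, 2, 1, 0] 1 < 0 else word_prod [0, 1, 0, 2, 1, 0] (int i + 1) < word_prod [0, 1, 0, 2, 1, 0] (int i)) \<longleftrightarrow> i = 0" for i
    by (subst rank_three_descents[OF w]) (auto simp: word_eval)
  show "\<exists>x. word_prod [0, 1, 0, 2, 1, 0] x = y \<and> (x < -1 \<longleftrightarrow> True)" if "y \<in> V" "0 < y" "(- 3) < y" "y < 3" for y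
    using between_one_three[OF that(2,4)]
    by (rule disjE) (intro exI[of _ "-3"], simp add: word_eval, intro exI[of _ "-2"], simp add: word_eval)
qed (simp_all add: word_eval)

lemma arc_element_210: "3 \<le> n \<Longrightarrow> arc_element (word_prod [2, 1, 0]) 0 (- 3) 3 False"
proof (rule arc_elementI[where d = "1" and c = "-1"])
  assume "3 \<le> n"
  then show w: "word_prod [2, 1, 0] \<in> Bn" by (intro word_prod_signed_perm) auto
  show "(if i = 0 then word_prod [2, 1, 0] 1 < 0 else word_prod [2, 1, 0] (int i + 1) < word_prod [2, 1, 0] (int i)) \<longleftrightarrow> i = 0" for i
    by (subst rank_three_descents[OF w]) (auto simp: word_eval)
  show "\<exists>x. word_prod [2, 1, 0] x = y \<and> (x < -1 \<longleftrightarrow> False)" if "y \<in> V" "0 < y" "(- 3) < y" "y < 3" for y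
    using between_one_three[OF that(2,4)]
    by (rule disjE) (intro exI[of _ "2"], simp add: word_eval, intro exI[of _ "3"], simp add: word_eval)
qed (simp_all add: word_eval)

lemma arc_element_012: "3 \<le> n \<Longrightarrow> arc_element (word_prod [0, 1, 2]) 2 (- 1) 3 True"
proof (rule arc_elementI[where d = "3" and c = "2"])
  assume "3 \<le> n"
  then show w: "word_prod [0, 1, 2] \<in> Bn" by (intro word_prod_signed_perm) auto
  show "(if i = 0 then word_prod [0, 1, 2] 1 < 0 else word_prod [0, 1, 2] (int i + 1) < word_prod [0, 1, 2] (int i)) \<longleftrightarrow> i = 2" for i
    by (subst rank_three_descents[OF w]) (auto simp: word_eval)
  show "\<exists>x. word_prod [0, 1, 2] x = y \<and> (x < 2 \<longleftrightarrow> True)" if "y \<in> V" "0 < y" "(- 1) < y" "y < 3" for y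
    using between_one_three[OF that(2,4)]
    by (rule disjE) (intro exI[of _ "-3"], simp add: word_eval, intro exI[of _ "1"], simp add: word_eval)
qed (simp_all add: word_eval)

lemma arc_element_2101: "3 \<le> n \<Longrightarrow> arc_element (word_prod [2, 1, 0, 1]) 1 (- 1) 3 False"
proof (rule arc_elementI[where d = "-1" and c = "-2"])
  assume "3 \<le> n"
  then show w: "word_prod [2, 1, 0, 1] \<in> Bn" by (intro word_prod_signed_perm) auto
  show "(if i = 0 then word_prod [2, 1, 0, 1] 1 < 0 else word_prod [2, 1, 0, 1] (int i + 1) < word_prod [2, 1, 0, 1] (int i)) \<longleftrightarrow> i = 1" for i
    by (subst rank_three_descents[OF w]) (auto simp: word_eval)
  show "\<exists>x. word_prod [2, 1, 0, 1] x = y \<and> (x < -2 \<longleftrightarrow> False)" if "y \<in> V" "0 < y" "(- 1) < y" "y < 3" for y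
    using between_one_three[OF that(2,4)]
    by (rule disjE) (intro exI[of _ "1"], simp add: word_eval, intro exI[of _ "3"], simp add: word_eval)
qed (simp_all add: word_eval)

lemma arc_element_ascending:
  assumes "2 \<le> i" "i < n"
  shows "arc_element (word_prod [i - 1, i]) (i) (int i - 1) (int i + 1) True"
proof -
  define g where "g = word_prod [i - 1, i]"
  have B: "g \<in> Bn" unfolding g_def using assms by (intro word_prod_signed_perm) auto
  have w: "g x = (if x = int i - 1 then int i else if x = int i then int i + 1
      else if x = int i + 1 then int i - 1 else x)" if "0 < x" for x
    using that assms by (auto simp: g_def word_prod_Cons simple_refl_pos)
  have "arc_element g (i) (int i - 1) (int i + 1) True"
  proof (rule arc_elementI[OF B, where d = "hi (i)" and c = "lo (i)"])
    show "(if j = 0 then g 1 < 0 else g (int j + 1) < g (int j)) \<longleftrightarrow> j = i" for j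
      using assms by (auto simp: w)
    show "g (hi (i)) = int i - 1" "g (lo (i)) = int i + 1"
      using assms by (auto simp: w hi_def lo_def)
    show "\<exists>x. g x = y \<and> (x < lo (i) \<longleftrightarrow> True)" if "int i - 1 < y" "y < int i + 1" for y
      using assms that by (intro exI[of _ "y - 1"]) (auto simp: w lo_def)
  qed (use assms in auto)
  then show ?thesis by (simp only: g_def)
qed

lemma arc_element_descending:
  assumes "2 \<le> i" "i < n"
  shows "arc_element (word_prod [i, i - 1]) (i - 1) (int i - 1) (int i + 1) False"
proof -
  define g where "g = word_prod [i, i - 1]"
  have B: "g \<in> Bn" unfolding g_def using assms by (intro word_prod_signed_perm) auto
  have w: "g x = (if x = int i - 1 then int i + 1 else if x = int i then int i - 1
      else if x = int i + 1 then int i else x)" if "0 < x" for x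
    using that assms by (auto simp: g_def word_prod_Cons simple_refl_pos)
  have "arc_element g (i - 1) (int i - 1) (int i + 1) False"
  proof (rule arc_elementI[OF B, where d = "hi (i - 1)" and c = "lo (i - 1)"])
    show "(if j = 0 then g 1 < 0 else g (int j + 1) < g (int j)) \<longleftrightarrow> j = i - 1" for j
      using assms by (auto simp: w)
    show "g (hi (i - 1)) = int i - 1" "g (lo (i - 1)) = int i + 1"
      using assms by (auto simp: w hi_def lo_def)
    show "\<exists>x. g x = y \<and> (x < lo (i - 1) \<longleftrightarrow> False)" if "int i - 1 < y" "y < int i + 1" for y
      using assms that by (intro exI[of _ "y + 1"]) (auto simp: w lo_def)
  qed (use assms in auto)
  then show ?thesis by (simp only: g_def)
qed

lemma arc_element_ascending3:
  assumes "1 \<le> i" "i + 2 < n"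
  shows "arc_element (word_prod [i, i + 1, i + 2]) (i + 2) (int i) (int i + 3) True"
proof -
  define g where "g = word_prod [i, i + 1, i + 2]"
  have B: "g \<in> Bn" unfolding g_def using assms by (intro word_prod_signed_perm) auto
  have w: "g x = (if int i \<le> x \<and> x < int i + 3 then x + 1 else if x = int i + 3 then int i else x)" if "0 < x" for x
    using that assms by (auto simp: g_def word_prod_Cons simple_refl_pos)
  have "arc_element g (i + 2) (int i) (int i + 3) True"
  proof (rule arc_elementI[OF B, where d = "hi (i + 2)" and c = "lo (i + 2)"])
    show "(if j = 0 then g 1 < 0 else g (int j + 1) < g (int j)) \<longleftrightarrow> j = i + 2" for j
      using assms by (auto simp: w)
    show "g (hi (i + 2)) = int i" "g (lo (i + 2)) = int i + 3"
      using assms by (auto simp: w hi_def lo_def)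
    show "\<exists>x. g x = y \<and> (x < lo (i + 2) \<longleftrightarrow> True)" if "int i < y" "y < int i + 3" for y
      using assms that by (intro exI[of _ "y - 1"]) (auto simp: w lo_def)
  qed (use assms in auto)
  then show ?thesis by (simp only: g_def)
qed

lemma arc_element_descending3:
  assumes "1 \<le> i" "i + 2 < n"
  shows "arc_element (word_prod [i + 2, i + 1, i]) (i) (int i) (int i + 3) False"
proof -
  define g where "g = word_prod [i + 2, i + 1, i]"
  have B: "g \<in> Bn" unfolding g_def using assms by (intro word_prod_signed_perm) auto
  have w: "g x = (if int i < x \<and> x \<le> int i + 3 then x - 1 else if x = int i then int i + 3 else x)" if "0 < x" for x
    using that assms by (auto simp: g_def word_prod_Cons simple_refl_pos)
  have "arc_element g (i) (int i) (int i + 3) False"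
  proof (rule arc_elementI[OF B, where d = "hi (i)" and c = "lo (i)"])
    show "(if j = 0 then g 1 < 0 else g (int j + 1) < g (int j)) \<longleftrightarrow> j = i" for j
      using assms by (auto simp: w)
    show "g (hi (i)) = int i" "g (lo (i)) = int i + 3"
      using assms by (auto simp: w hi_def lo_def)
    show "\<exists>x. g x = y \<and> (x < lo (i) \<longleftrightarrow> False)" if "int i < y" "y < int i + 3" for y
      using assms that by (intro exI[of _ "y + 1"]) (auto simp: w lo_def)
  qed (use assms in auto)
  then show ?thesis by (simp only: g_def)
qed

section \<open>Arc diagrams\<close>

text \<open>The descent appears at \<open>lo k\<close> and again at \<open>- hi k\<close>. For
  \<open>k = 0\<close> these positions coincide, and the two triples are one symmetric arc.\<close>

lemma arc_diagram_eq:
  assumes g: "arc_element g k p q s"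
  shows "arc_diagram n g = {(p, q, {y \<in> V. p < y \<and> y < q \<and> before g y q}),
    (- q, - p, {y \<in> V. - q < y \<and> y < - p \<and> before g y (- p)})}"
proof -
  have B: "g \<in> Bn" using g by (rule arc_element_signed_perm)
  have k: "k < n" and desc: "\<And>i. i < n \<Longrightarrow> g (hi i) < g (lo i) \<longleftrightarrow> i = k"
    and pq: "g (hi k) = p \<and> g (lo k) = q \<or> g (- lo k) = p \<and> g (- hi k) = q"
    using g by (auto simp: arc_element_def)
  define arc where "arc a = (g (next_pos a), g a, g ` ({- int n..<a} - {0}) \<inter> {g (next_pos a)<..<g a})" for a
  have arc: "arc a = (g (next_pos a), g a, {y \<in> V. g (next_pos a) < y \<and> y < g a \<and> before g y (g a)})"
    if a: "a \<in> V" for a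
  proof -
    have "y \<in> g ` ({- int n..<a} - {0}) \<longleftrightarrow> y \<in> V \<and> before g y (g a)" for y
    proof
      assume "y \<in> g ` ({- int n..<a} - {0})"
      then obtain x where x: "x \<in> {- int n..<a} - {0}" "y = g x" by blast
      then have "x \<in> V" using a by (auto simp: V_def)
      then show "y \<in> V \<and> before g y (g a)"
        using x B by (simp add: before_def inv_apply signed_perm_in_V)
    next
      assume y: "y \<in> V \<and> before g y (g a)"
      then have "inv g y < a" "inv g y \<in> V"
        using B by (simp_all add: before_def inv_apply inv_in_V)
      then have "inv g y \<in> {- int n..<a} - {0}" by (auto simp: V_def)
      then show "y \<in> g ` ({- int n..<a} - {0})"
        using apply_inv[OF B, of y] by (metis imageI)
    qed
    then show ?thesis by (auto simp: arc_def)
  qed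
  have lo: "lo i \<in> {- int n..<int n} - {0}" "next_pos (lo i) = hi i" if "i < n" for i
    using that by (auto simp: lo_def hi_def next_pos_def)
  have hi: "- hi i \<in> {- int n..<int n} - {0}" "next_pos (- hi i) = - lo i" if "i < n" for i
    using that by (auto simp: lo_def hi_def next_pos_def)
  have "{a. a \<in> {- int n..<int n} - {0} \<and> g (next_pos a) < g a} = {lo k, - hi k}"
  proof (intro equalityI subsetI)
    fix a assume a: "a \<in> {a. a \<in> {- int n..<int n} - {0} \<and> g (next_pos a) < g a}"
    obtain i where i: "i < n" "a = lo i \<or> a = - hi i"
    proof (cases "a > 0")
      case True
      then show thesis using that[of "nat a"] a by (auto simp: lo_def)
    next
      case False
      then show thesis using that[of "nat (- a - 1)"] a by (auto simp: hi_def)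
    qed
    then have "g (hi i) < g (lo i)"
      using a lo(2)[OF i(1)] hi(2)[OF i(1)] by (auto simp: signed_perm_uminus[OF B])
    then show "a \<in> {lo k, - hi k}" using desc i by auto
  next
    fix a assume "a \<in> {lo k, - hi k}"
    then show "a \<in> {a. a \<in> {- int n..<int n} - {0} \<and> g (next_pos a) < g a}"
      using lo[OF k] hi[OF k] desc[OF k] by (auto simp: signed_perm_uminus[OF B])
  qed
  then have "arc_diagram n g = arc ` {lo k, - hi k}"
    unfolding arc_diagram_def arc_def by blast
  also have "\<dots> = {(p, q, {y \<in> V. p < y \<and> y < q \<and> before g y q}),
    (- q, - p, {y \<in> V. - q < y \<and> y < - p \<and> before g y (- p)})}"
    using pq lo(2)[OF k] hi(2)[OF k] lo_in_V[OF k] hi_in_V[OF k]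
    by (auto simp: arc signed_perm_uminus[OF B])
  finally show ?thesis .
qed

lemma delta_orb:
  assumes g: "arc_element g k p q s"
  shows delta_orb_ordinary: "0 < p \<Longrightarrow> delta_orb n g = {Ordinary p q (if s then {p<..<q} else {})}"
    and delta_orb_orbifold: "p = - q \<Longrightarrow> delta_orb n g = {Orbifold q (if s then {0<..<q} else {})}"
    and delta_orb_long: "\<lbrakk>p = - 1; 1 < q\<rbrakk> \<Longrightarrow> delta_orb n g = {Long 1 q {} (if s then {0<..<q} else {})}"
proof -
  note B = arc_element_signed_perm[OF g] and e = arc_element_edge[OF g]
  have pq: "p \<in> V" "q \<in> V" "p < q" using e by (auto simp: edge_def)
  define S where "S = {y \<in> V. p < y \<and> y < q \<and> before g y q}"
  define S' where "S' = {y \<in> V. - q < y \<and> y < - p \<and> before g y (- p)}"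
  have diagram: "arc_diagram n g = {(p, q, S), (- q, - p, S')}"
    unfolding S_def S'_def by (rule arc_diagram_eq[OF g])
  have V: "y \<in> V" if "p < y" "y < q" "y \<noteq> 0" for y
    using pq that by (auto simp: V_def)
  have S: "y \<in> S \<longleftrightarrow> s" if "0 < y" "p < y" "y < q" for y
    using that V[of y] arc_element_side[OF g, of y] by (simp add: S_def)
  \<comment> \<open>The half-turned arc has the mirrored complement on its left. The complement in
    \<open>orbifold_image\<close> undoes this, so both triples have the same image.\<close>
  have S': "- y \<in> S' \<longleftrightarrow> y \<notin> S" if "p < y" "y < q" "y \<noteq> 0" for y
  proof -
    have "- y \<in> S' \<longleftrightarrow> before g p y"
      using that V[of y] before_uminus[OF B, of y p] by (simp add: S'_def)
    also have "\<dots> \<longleftrightarrow> \<not> before g y p"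
      using not_before[OF B, of y p] that by auto
    also have "before g y p \<longleftrightarrow> y \<in> S"
      using edge_adjacent[OF e V[OF that]] that V[of y] by (auto simp: S_def)
    finally show ?thesis .
  qed
  have sub: "S \<subseteq> {p<..<q}" "S' \<subseteq> {- q<..<- p}" by (auto simp: S_def S'_def)
  show "delta_orb n g = {Ordinary p q (if s then {p<..<q} else {})}" if "0 < p"
  proof -
    have "S = (if s then {p<..<q} else {})"
      using S that sub by auto
    moreover have "{k \<in> {p<..<q}. - k \<notin> S'} = S"
      using S' sub that by auto
    ultimately show ?thesis
      using that pq by (simp add: delta_orb_def diagram orbifold_image_def)
  qed
  show "delta_orb n g = {Orbifold q (if s then {0<..<q} else {})}" if "p = - q"
  proof -
    have "S \<inter> {0<..} = (if s then {0<..<q} else {})"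
      using S that sub pq by auto
    moreover have "S' = S" using that by (simp add: S_def S'_def)
    ultimately show ?thesis
      using that pq by (simp add: delta_orb_def diagram orbifold_image_def)
  qed
  show "delta_orb n g = {Long 1 q {} (if s then {0<..<q} else {})}" if "p = - 1" "1 < q"
  proof -
    have "S \<inter> {0<..} = (if s then {0<..<q} else {})"
      using S that sub by auto
    moreover have "{k \<in> {0<..<q}. - k \<notin> S'} = S \<inter> {0<..}"
      using S' sub that by auto
    moreover have "S' \<inter> {0<..} = {}" using sub that by auto
    moreover have "{k \<in> {0<..<1}. - k \<notin> S} = {}" by auto
    ultimately show ?thesis
      using that by (simp add: delta_orb_def diagram orbifold_image_def)
  qed
qed

section \<open>Forcing\<close>

text \<open>Under the assumption on \<open>p\<close>, negative points between the endpoints occur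
  only for symmetric arcs, where their sides are opposite to those of their negatives. So agreement
  on positive points suffices for \<open>edge_transfer\<close>.\<close>

lemma arc_transfer:
  assumes \<theta>: "congruence \<theta>" and g: "arc_element g k p q s" and c: "contracts (weak_order n) \<theta> g"
    and e: "edge u w p q" and pq: "p = - q \<or> - 1 \<le> p"
    and side: "\<And>y. \<lbrakk>y \<in> V; 0 < y; p < y; y < q\<rbrakk> \<Longrightarrow> before w y q = s"
  shows "(u, w) \<in> \<theta>"
proof (rule edge_transfer[OF \<theta> arc_element_edge[OF g] e])
  show "(lower_elem (weak_order n) g, g) \<in> \<theta>"
    using c congruence_sym[OF \<theta>] by (auto simp: contracts_def)
  fix y assume y: "y \<in> V" "p < y" "y < q"
  show "before g y q = before w y q"
  proof (cases "0 < y")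
    case True
    then show ?thesis using y side arc_element_side[OF g, of y] by simp
  next
    case False
    then have "y < 0" using y by (auto simp: V_def)
    then have p: "p = - q" using y pq by linarith
    then have pos: "0 < - y" "- y \<in> V" "p < - y" "- y < q" using y \<open>y < 0\<close> by auto
    have "before g (- y) q = before w (- y) q"
      using side[of "- y"] arc_element_side[OF g, of "- y"] pos by simp
    moreover have "before g y q \<longleftrightarrow> \<not> before g (- y) q" "before w y q \<longleftrightarrow> \<not> before w (- y) q"
      using edge_symmetric_before[of _ g q "- y"] arc_element_edge[OF g]
        edge_symmetric_before[of u w q "- y"] e p pos y by auto
    ultimately show ?thesis by simp
  qed
qed

text \<open>\<open>c\<close> and \<open>c + 1\<close> are the two points passed on one side. The
  values \<open>- 1\<close> and \<open>- 3\<close> of \<open>p\<close> give the long and the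
  orbifold generators.\<close>

definition generator_arc :: "int \<Rightarrow> int \<Rightarrow> int \<Rightarrow> bool" where
  "generator_arc p q c \<longleftrightarrow> q = c + 2 \<and> (2 \<le> c \<and> p = c - 1 \<or> c = 1 \<and> (p = - 1 \<or> p = - 3))"

lemma next_pos_in_V: "\<lbrakk>c \<in> V; q \<in> V; c < q\<rbrakk> \<Longrightarrow> next_pos c \<in> V \<and> c < next_pos c \<and> next_pos c \<le> q"
  by (auto simp: next_pos_def V_def)

text \<open>In the case \<open>- q < p < 0\<close> the side of \<open>- p\<close> decides which endpoints can be moved: a hexagon step
  to \<open>m\<close> is possible if \<open>- m\<close> is on this side.\<close>

lemma same_side_force:
  assumes \<theta>: "congruence \<theta>"
    and base: "\<And>u w p q c. \<lbrakk>edge u w p q; generator_arc p q c; before w c q = before w (c + 1) q\<rbrakk> \<Longrightarrow> (u, w) \<in> \<theta>"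
    and "edge u w p q" "c \<in> V" "p < c" "next_pos c < q" "before w c q = before w (next_pos c) q"
  shows "(u, w) \<in> \<theta>"
  using assms(3-)
proof (induction "nat (q - p)" arbitrary: u w p q c rule: less_induct)
  case less
  have IH: "(u', w') \<in> \<theta>"
    if "edge u' w' p' q'" "q' - p' < q - p" "c' \<in> V" "p' < c'" "next_pos c' < q'"
      "before w' c' q' = before w' (next_pos c') q'" for u' w' p' q' c'
    using less.hyps[of q' p' u' w' c'] that by (auto simp: edge_def)
  \<comment> \<open>Formulated for any edge of length \<open>l\<close> with its own induction
    hypothesis, so that it also applies to the half-turn of an edge with
    \<open>p + q < 0\<close>.\<close>
  have positive: "(u, w) \<in> \<theta>"
    if e: "edge u w p q" and len: "q - p = l" and c: "c \<in> V" "p < c" "next_pos c < q"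
      "before w c q = before w (next_pos c) q" and pq0: "0 < p + q"
      and IH: "\<And>u' w' p' q' c'. \<lbrakk>edge u' w' p' q'; q' - p' < l; c' \<in> V; p' < c'; next_pos c' < q';
        before w' c' q' = before w' (next_pos c') q'\<rbrakk> \<Longrightarrow> (u', w') \<in> \<theta>"
    for u w p q c l
  proof -
    have w: "w \<in> Bn" and pq: "p \<in> V" "q \<in> V" "p < q"
      using e by (auto simp: edge_def)
    have V: "y \<in> V" if "- q \<le> y" "y \<le> q" "y \<noteq> 0" for y
      using pq(2) that by (auto simp: V_def)
    have lower: "(u, w) \<in> \<theta>"
      if m: "m \<in> V" "p < m" "m < q" "p + m \<noteq> 0" "m + q \<noteq> 0"
        "\<lbrakk>p < - m; - m < q\<rbrakk> \<Longrightarrow> before w (- m) q \<longleftrightarrow> before w (- p) q"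
        and c: "c \<in> V" "p < c" "next_pos c < m" "before w c q = before w (next_pos c) q" for m c
    proof -
      obtain u' w' where e': "edge u' w' p m" and side: "\<forall>y\<in>V. p < y \<longrightarrow> y < m \<longrightarrow> before w' y m = before w y q"
        and imp: "(u', w') \<in> \<theta> \<longrightarrow> (u, w) \<in> \<theta>"
        using hexagon_lower[OF \<theta> e m(1,2,3) _ m(4,5,6)] pq0 by auto
      have "c < next_pos c" by (auto simp: next_pos_def)
      then have "next_pos c \<in> V" using next_pos_in_V[OF c(1) m(1)] c by auto
      then have "(u', w') \<in> \<theta>"
        using IH[OF e', of c] c side m len \<open>c < next_pos c\<close> by auto
      then show ?thesis using imp by blast
    qed
    have upper: "(u, w) \<in> \<theta>"
      if m: "m \<in> V" "p < m" "m < q" "p + m \<noteq> 0" "m + q \<noteq> 0"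
        "\<lbrakk>p < - m; - m < q\<rbrakk> \<Longrightarrow> before w (- m) q \<longleftrightarrow> before w (- p) q"
        and c: "c \<in> V" "m < c" "next_pos c < q" "before w c q = before w (next_pos c) q" for m c
    proof -
      obtain u' w' where e': "edge u' w' m q" and side: "\<forall>y\<in>V. m < y \<longrightarrow> y < q \<longrightarrow> before w' y q = before w y q"
        and imp: "(u', w') \<in> \<theta> \<longrightarrow> (u, w) \<in> \<theta>"
        using hexagon_upper[OF \<theta> e m(1,2,3) _ m(4,5,6)] pq0 by auto
      have "c < next_pos c" by (auto simp: next_pos_def)
      then have "next_pos c \<in> V" using next_pos_in_V[OF c(1) pq(2)] c by auto
      then have "(u', w') \<in> \<theta>"
        using IH[OF e', of c] c side m len \<open>c < next_pos c\<close> by auto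
      then show ?thesis using imp by blast
    qed
    have next_pos: "next_pos y = y + 1" if "0 < y" for y
      using that by (simp add: next_pos_def)
    show "(u, w) \<in> \<theta>"
    proof (cases "0 < p")
      case True
      then have c': "next_pos c = c + 1" "2 \<le> c" using c by (auto simp: next_pos_def)
      consider "c + 2 < q" | "p < c - 1" | "q = c + 2" "p = c - 1" using c c' by linarith
      then show ?thesis
      proof cases
        case 1
        then show ?thesis using lower[of "c + 2" c] c c' V True by auto
      next
        case 2
        then show ?thesis using upper[of "c - 1" c] c c' V True by auto
      next
        case 3
        then show ?thesis using base[OF e, of c] c c' by (simp add: generator_arc_def)
      qed
    next
      case False
      define x where "x = - p"
      have x: "1 \<le> x" "x < q" "p = - x" "x \<in> V"
        using False pq0 pq by (auto simp: x_def V_def)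
      \<comment> \<open>The half-turned arc joins \<open>- q\<close> and \<open>- p\<close>, which
        are neighbours; \<open>\<sigma>\<close> is the side of the given arc on which it
        lies.\<close>
      define \<sigma> where "\<sigma> = before w x q"
      have \<sigma>: "\<sigma> \<longleftrightarrow> before w (- q) q"
      proof -
        have "before w (- q) q \<longleftrightarrow> before w (- q) p"
          using edge_adjacent[OF e, of "- q"] pq pq0 by auto
        also have "\<dots> \<longleftrightarrow> before w x q"
          using before_uminus_left[OF w, of q p] by (simp add: x_def)
        finally show ?thesis by (simp add: \<sigma>_def)
      qed
      \<comment> \<open>At least one of \<open>y\<close> and \<open>- y\<close> lies on side
        \<open>\<sigma>\<close>. If, say, \<open>- q\<close> precedes \<open>q\<close> and both
        \<open>y\<close> and \<open>- y\<close> follow \<open>q\<close>, then negation puts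
        \<open>y\<close> before \<open>- q\<close>, hence before \<open>q\<close>.\<close>
      have neg: "before w (- y) q = \<sigma>" if "before w y q \<noteq> \<sigma>" "- q < y" "y < q" "y \<noteq> 0" for y
      proof (rule ccontr)
        assume no: "before w (- y) q \<noteq> \<sigma>"
        have qy: "before w q z \<longleftrightarrow> \<not> before w z q" if "z \<noteq> q" for z
          using not_before[OF w, of z q] that by auto
        have "before w (- y) q \<longleftrightarrow> before w (- q) y"
          using before_uminus_left[OF w] .
        moreover have "before w q (- y) \<longleftrightarrow> before w y (- q)"
          using before_uminus_left[OF w, of "- q" "- y"] by simp
        ultimately show False
          using that no \<sigma> qy[of "- q"] qy[of y] qy[of "- y"] before_trans[of w] before_asym[of w]
          by (metis add.inverse_inverse neg_less_iff_less order_less_irrefl)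
      qed
      have p\<sigma>: "before w (- p) q = \<sigma>" by (simp add: \<sigma>_def x)
      \<comment> \<open>Both passed points are positive. Moving the lower endpoint to some
        \<open>- y\<close> keeps them, and this is admissible when \<open>y\<close> is on side
        \<open>\<sigma>\<close>. If there is no such \<open>y\<close> below \<open>x\<close>, all
        their negatives are on side \<open>\<sigma>\<close> and \<open>m = 1\<close> is
        admissible.\<close>
      have A: "(u, w) \<in> \<theta>" if c: "1 \<le> c" "c + 1 < q" "before w c q = before w (c + 1) q" for c
      proof (cases "x = 1")
        case x1: True
        show ?thesis
        proof (cases "c = 1")
          case True
          show ?thesis
          proof (cases "q = 3")
            case True
            then show ?thesis
              using base[OF e, of c] c \<open>c = 1\<close> x x1 by (simp add: generator_arc_def)
          next
            case False
            then show ?thesis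
              using lower[of 3 1] c True x x1 V by (auto simp: next_pos)
          qed
        next
          case False
          obtain u' w' where e': "edge u' w' 1 q" and side: "\<forall>y\<in>V. 1 < y \<longrightarrow> y < q \<longrightarrow> before w' y q = before w y q"
            and imp: "(u', w') \<in> \<theta> \<longrightarrow> (u, w) \<in> \<theta>"
            using octagon_long[OF \<theta>, of u w q] e x x1 by auto
          have "(u', w') \<in> \<theta>"
            using IH[OF e', of c] side c False V x x1 len by (auto simp: next_pos)
          then show ?thesis using imp by blast
        qed
      next
        case False
        then have x2: "2 \<le> x" using x by simp
        show ?thesis
        proof (cases "\<exists>y. 0 < y \<and> y < x \<and> before w y q = \<sigma>")
          case True
          then obtain y where "0 < y" "y < x" "before w y q = \<sigma>" by blast
          then show ?thesis
            using upper[of "- y" c] c x V p\<sigma> by (auto simp: next_pos)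
        next
          case False
          then have opp: "before w y q \<noteq> \<sigma>" "before w (- y) q = \<sigma>" if "0 < y" "y < x" for y
            using neg[of y] that x by auto
          show ?thesis
          proof (cases "c = 1")
            case True
            \<comment> \<open>With lower endpoint \<open>1\<close> the passed point \<open>1\<close>
              would be lost. But \<open>x\<close> is on side \<open>\<sigma>\<close> and
              \<open>1\<close>, \<open>2\<close> are not, so \<open>2 < x\<close>, and
              \<open>- 2\<close>, \<open>- 1\<close> are consecutive points on side
              \<open>\<sigma>\<close>. They survive when the upper endpoint is moved to
              \<open>1\<close>.\<close>
            then have "x \<noteq> 2" using c opp[of 1] x2 by (auto simp: \<sigma>_def)
            then have "before w (- 2) q = \<sigma>" "before w (- 1) q = \<sigma>" "2 < x"
              using opp[of 1] opp[of 2] x2 by auto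
            then show ?thesis
              using lower[of 1 "- 2"] x V p\<sigma> by (auto simp: next_pos_def)
          next
            case False
            then show ?thesis
              using upper[of 1 c] c x x2 V p\<sigma> opp[of 1] by (auto simp: next_pos)
          qed
        qed
      qed
      \<comment> \<open>Both passed points are negative. On side \<open>\<sigma>\<close> they allow
        moving the upper endpoint to \<open>y\<close>; otherwise \<open>y\<close> and
        \<open>y + 1\<close> are on side \<open>\<sigma>\<close> and form a positive pair.\<close>
      have B: "(u, w) \<in> \<theta>" if y: "1 \<le> y" "y + 1 < x" "before w (- y) q = before w (- y - 1) q" for y
      proof (cases "before w (- y) q = \<sigma>")
        case True
        have "next_pos (- y - 1) = - y" using y by (simp add: next_pos_def)
        show ?thesis
        proof (rule lower[of y "- y - 1"])
          show "y \<in> V" "- y - 1 \<in> V" using V[of y] V[of "- y - 1"] x y by auto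
          show "before w (- y - 1) q = before w (next_pos (- y - 1)) q"
            unfolding \<open>next_pos (- y - 1) = - y\<close> by (rule y(3)[symmetric])
          show "before w (- y) q = before w (- p) q" using True p\<sigma> by simp
        qed (use x y \<open>next_pos (- y - 1) = - y\<close> in linarith)+
      next
        case False
        then have "before w y q = \<sigma>" "before w (y + 1) q = \<sigma>"
          using neg[of y] neg[of "y + 1", unfolded minus_add_distrib add_uminus_conv_diff] y x by auto
        then show ?thesis using A[of y] x y by auto
      qed
      have "c \<noteq> 0" using c(1) by auto
      then consider "0 < c" | "c = - 1" | "c < - 1" by linarith
      then show ?thesis
      proof cases
        case 1
        then show ?thesis using A[of c] c by (simp add: next_pos)
      next
        case 3
        then have "next_pos c = 1 + c" by (simp add: next_pos_def)
        then show ?thesis using B[of "- c - 1"] c x 3 by auto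
      next
        case 2
        \<comment> \<open>The pair straddles the missing zero. One of its points is on side
          \<open>\<sigma>\<close>, hence both are, and so is \<open>2\<close> or \<open>- 2\<close>;
          this gives a consecutive pair of one sign.\<close>
        then have same: "before w (- 1) q = before w 1 q" and x2: "2 \<le> x"
          using c x by (auto simp: next_pos_def)
        have one: "before w 1 q = \<sigma>" "before w (- 1) q = \<sigma>" using neg[of 1] same x x2 by auto
        show ?thesis
        proof (cases "before w 2 q = \<sigma>")
          case True
          then show ?thesis using A[of 1] one x x2 by auto
        next
          case False
          then have "x \<noteq> 2" by (auto simp: \<sigma>_def)
          then have "before w (- 2) q = \<sigma>" "2 < x" using neg[of 2] False x x2 by auto
          then show ?thesis using B[of 1] one by auto
        qed
      qed
    qed
  qed
  note e = less.prems(1) and c = less.prems(2-5)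
  have w: "w \<in> Bn" and pq: "p \<in> V" "q \<in> V" "p < q"
    using e by (auto simp: edge_def)
  have c_next: "c < next_pos c" "next_pos c \<in> V"
    using next_pos_in_V[OF c(1) pq(2)] c by (auto simp: next_pos_def)
  consider "0 < p + q" | "p + q < 0" | "p = - q" by linarith
  then show ?case
  proof cases
    case 1
    then show ?thesis using positive[OF e refl c] IH by blast
  next
    case 2
    \<comment> \<open>The half-turn reverses both sides and order, so the pair starting at
      \<open>c\<close> becomes the pair starting at \<open>- next_pos c\<close>.\<close>
    have side: "before w (- y) (- p) \<longleftrightarrow> \<not> before w y q" if "y \<in> V" "p < y" "y < q" for y
      using before_uminus[OF w, of y p] not_before[OF w, of y p] edge_adjacent[OF e, of y] that by auto
    have "next_pos (- next_pos c) = - c" using c(1) by (auto simp: next_pos_def V_def)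
    moreover have "- p - - q = q - p" by simp
    ultimately show ?thesis
      using positive[OF edge_uminus[OF e], of "q - p" "- next_pos c"] IH 2 c c_next side[of c] side[of "next_pos c"]
      by auto
  next
    case 3
    have e': "edge u w (- q) q" using e 3 by simp
    have sym: "before w (- y) q \<longleftrightarrow> \<not> before w y q" if "y \<in> V" "- q < y" "y < q" for y
      using edge_symmetric_before[OF e', of y] that by auto
    \<comment> \<open>A symmetric arc separates \<open>- 1\<close> from \<open>1\<close>, and a
      negative pair on one side mirrors to a positive pair on the other. So a positive pair always
      exists.\<close>
    obtain d where d: "1 \<le> d" "d + 1 < q" "before w d q = before w (d + 1) q"
    proof -
      have "c \<noteq> 0" using c(1) by auto
      then consider "0 < c" | "c = - 1" | "c < - 1" by linarith
      then show thesis
      proof cases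
        case 1
        then show thesis using that[of c] c by (simp add: next_pos_def)
      next
        case 2
        then have "before w (- 1) q = before w 1 q" "1 \<in> V" "1 < q" using c c_next by (auto simp: next_pos_def)
        then show thesis using sym[of 1] by auto
      next
        case 3
        have n: "next_pos c = c + 1" using 3 by (simp add: next_pos_def)
        then have "before w (- c - 1) q = before w (- c) q"
          using sym[of c] sym[of "next_pos c"] c c_next \<open>p = - q\<close> by auto
        then show thesis using that[of "- c - 1"] 3 c \<open>p = - q\<close> by auto
      qed
    qed
    have V: "y \<in> V" if "1 \<le> y" "y \<le> q" for y
      using pq(2) that by (auto simp: V_def)
    have nd: "next_pos d = d + 1" using d by (simp add: next_pos_def)
    \<comment> \<open>For \<open>d = 1\<close> both endpoints shrink to
      \<open>\<plusminus>3\<close>. For \<open>2 \<le> d\<close> the point \<open>d - 1\<close> is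
      available as a lower endpoint and the arc becomes an ordinary one.\<close>
    consider "q = 3" | "3 < q" "d = 1" | "2 \<le> d" using d by linarith
    then show ?thesis
    proof cases
      case 1
      then have "d = 1" using d by linarith
      with d(3) have "before w 1 q = before w (1 + 1) q" by simp
      then show ?thesis using base[OF e, of 1] 3 1 by (simp add: generator_arc_def)
    next
      case 2
      obtain u' w' where "edge u' w' (- 3) 3" "\<forall>y\<in>V. - 3 < y \<longrightarrow> y < 3 \<longrightarrow> before w' y 3 = before w y q"
        and imp: "(u', w') \<in> \<theta> \<longrightarrow> (u, w) \<in> \<theta>"
        using octagon_symmetric_lower[OF \<theta> e', of 3] V 2 by auto
      then have "(u', w') \<in> \<theta>" using IH[of u' w' "- 3" 3 1] 2 3 d V nd by auto
      then show ?thesis using imp by blast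
    next
      case cd: 3
      obtain u' w' where "edge u' w' (d - 1) q" "\<forall>y\<in>V. d - 1 < y \<longrightarrow> y < q \<longrightarrow> before w' y q = before w y q"
        and imp: "(u', w') \<in> \<theta> \<longrightarrow> (u, w) \<in> \<theta>"
        using octagon_symmetric_upper[OF \<theta> e', of "d - 1"] V cd d by auto
      then have "(u', w') \<in> \<theta>" using IH[of u' w' "d - 1" q d] cd 3 d V nd by auto
      then show ?thesis using imp by blast
    qed
  qed
qed

section \<open>The bipartite biCambrian congruence\<close>

lemma exists_bipartite_generator:
  assumes "generator_arc p q c" "q \<le> int n"
  obtains g k where "g \<in> bipartite_generators n" "arc_element g k p q s"
proof -
  consider "2 \<le> c" "p = c - 1" "q = c + 2" | "p = - 1" "q = 3" | "p = - 3" "q = 3"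
    using assms(1) by (auto simp: generator_arc_def)
  then show thesis
  proof cases
    case 1
    define i where "i = nat p"
    have i: "1 \<le> i" "i + 2 < n" "p = int i" "q = int i + 3" "i \<in> {1..n - 3}"
      using 1 assms(2) by (auto simp: i_def)
    have mem: "word_prod [i, i + 1, i + 2] \<in> bipartite_generators n"
        "word_prod [i + 2, i + 1, i] \<in> bipartite_generators n"
      unfolding bipartite_generators_def using i(5) by blast+
    show thesis
    proof (cases s)
      case True
      then show thesis
        using that[OF mem(1)] arc_element_ascending3[OF i(1,2)] i(3,4) by simp
    next
      case False
      then show thesis
        using that[OF mem(2)] arc_element_descending3[OF i(1,2)] i(3,4) by simp
    qed
  next
    case 2
    then have "3 \<le> n" using assms(2) by simp
    then show thesis
      using that arc_element_012 arc_element_2101 2 by (cases s) (auto simp: bipartite_generators_def)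
  next
    case 3
    then have "3 \<le> n" using assms(2) by simp
    then show thesis
      using that arc_element_010210 arc_element_210 3 by (cases s) (auto simp: bipartite_generators_def)
  qed
qed

lemma bipartite_generator_arc:
  assumes "g \<in> bipartite_generators n"
  obtains k p q c s where "generator_arc p q c" "arc_element g k p q s"
proof -
  consider i where "i \<in> {1..n - 3}" "g = word_prod [i, i + 1, i + 2]"
    | i where "i \<in> {1..n - 3}" "g = word_prod [i + 2, i + 1, i]"
    | "3 \<le> n" "g = word_prod [0, 1, 0, 2, 1, 0]" | "3 \<le> n" "g = word_prod [2, 1, 0]"
    | "3 \<le> n" "g = word_prod [0, 1, 2]" | "3 \<le> n" "g = word_prod [2, 1, 0, 1]"
    using assms unfolding bipartite_generators_def by (auto split: if_splits)
  then show thesis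
  proof cases
    case (1 i)
    have "arc_element g (i + 2) (int i) (int i + 3) True"
      unfolding 1(2) by (rule arc_element_ascending3) (use 1 in auto)
    then show thesis by (rule that[where c = "int i + 1", rotated]) (use 1 in \<open>auto simp: generator_arc_def\<close>)
  next
    case (2 i)
    have "arc_element g i (int i) (int i + 3) False"
      unfolding 2(2) by (rule arc_element_descending3) (use 2 in auto)
    then show thesis by (rule that[where c = "int i + 1", rotated]) (use 2 in \<open>auto simp: generator_arc_def\<close>)
  next
    case 3
    have "arc_element g 0 (- 3) (3) True"
      unfolding 3(2) by (rule arc_element_010210) (use 3 in auto)
    then show thesis by (rule that[where c = "1", rotated]) (use 3 in \<open>auto simp: generator_arc_def\<close>)
  next
    case 4
    have "arc_element g 0 (- 3) (3) False"
      unfolding 4(2) by (rule arc_element_210) (use 4 in auto)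
    then show thesis by (rule that[where c = "1", rotated]) (use 4 in \<open>auto simp: generator_arc_def\<close>)
  next
    case 5
    have "arc_element g 2 (- 1) (3) True"
      unfolding 5(2) by (rule arc_element_012) (use 5 in auto)
    then show thesis by (rule that[where c = "1", rotated]) (use 5 in \<open>auto simp: generator_arc_def\<close>)
  next
    case 6
    have "arc_element g 1 (- 1) (3) False"
      unfolding 6(2) by (rule arc_element_2101) (use 6 in auto)
    then show thesis by (rule that[where c = "1", rotated]) (use 6 in \<open>auto simp: generator_arc_def\<close>)
  qed
qed

lemma exists_cambrian_generator:
  assumes "i < n" "2 \<le> i \<and> p = int i - 1 \<and> q = int i + 1 \<or> i = 1 \<and> q = 2 \<and> (p = - 1 \<or> p = - 2)"
  obtains g k where "g \<in> cambrian_generators n R" "arc_element g k p q (i \<in> R)"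
proof -
  consider "2 \<le> i" "p = int i - 1" "q = int i + 1" | "i = 1" "q = 2" "p = - 1" | "i = 1" "q = 2" "p = - 2"
    using assms(2) by blast
  then show thesis
  proof cases
    case 1
    have mem: "(if i \<in> R then word_prod [i - 1, i] else word_prod [i, i - 1]) \<in> cambrian_generators n R"
    proof -
      have "i \<in> {2..n - 1}" using 1 assms(1) by auto
      then show ?thesis unfolding cambrian_generators_def by blast
    qed
    show thesis
    proof (cases "i \<in> R")
      case True
      then show thesis
        using that[OF mem] arc_element_ascending[OF 1(1) assms(1)] 1(2,3) by simp
    next
      case False
      then show thesis
        using that[OF mem] arc_element_descending[OF 1(1) assms(1)] 1(2,3) by simp
    qed
  next
    case 2
    then have n: "2 \<le> n" using assms(1) by simp
    have mem: "(if i \<in> R then word_prod [0, 1] else word_prod [1, 0, 1]) \<in> cambrian_generators n R"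
      unfolding cambrian_generators_def using n 2(1) by simp
    show thesis
    proof (cases "i \<in> R")
      case True
      then show thesis using that[OF mem] arc_element_01[OF n] 2 by simp
    next
      case False
      then show thesis using that[OF mem] arc_element_101[OF n] 2 by simp
    qed
  next
    case 3
    then have n: "2 \<le> n" using assms(1) by simp
    have mem: "(if i \<in> R then word_prod [0, 1, 0] else word_prod [1, 0]) \<in> cambrian_generators n R"
      unfolding cambrian_generators_def using n 3(1) by simp
    show thesis
    proof (cases "i \<in> R")
      case True
      then show thesis using that[OF mem] arc_element_010[OF n] 3 by simp
    next
      case False
      then show thesis using that[OF mem] arc_element_10[OF n] 3 by simp
    qed
  qed
qed

lemma cambrian_generator_arc:
  assumes "g \<in> cambrian_generators n R"
  obtains i k p q where "1 \<le> i" "i < n" "p < int i" "int i < q" "arc_element g k p q (i \<in> R)"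
proof -
  consider "1 \<le> n - 1" "1 \<in> R" "g = word_prod [0, 1]" | "1 \<le> n - 1" "1 \<in> R" "g = word_prod [0, 1, 0]"
    | "1 \<le> n - 1" "1 \<notin> R" "g = word_prod [1, 0]" | "1 \<le> n - 1" "1 \<notin> R" "g = word_prod [1, 0, 1]"
    | i where "i \<in> {2..n - 1}" "i \<in> R" "g = word_prod [i - 1, i]"
    | i where "i \<in> {2..n - 1}" "i \<notin> R" "g = word_prod [i, i - 1]"
    using assms unfolding cambrian_generators_def by (auto split: if_splits)
  then show thesis
  proof cases
    case 1
    have "arc_element g (1) (- 1) (2) (1 \<in> R)"
      using arc_element_01 1 by simp
    then show thesis by (rule that[rotated 4]) (use 1 in auto)
  next
    case 2
    have "arc_element g (0) (- 2) (2) (1 \<in> R)"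
      using arc_element_010 2 by simp
    then show thesis by (rule that[rotated 4]) (use 2 in auto)
  next
    case 3
    have "arc_element g (0) (- 2) (2) (1 \<in> R)"
      using arc_element_10 3 by simp
    then show thesis by (rule that[rotated 4]) (use 3 in auto)
  next
    case 4
    have "arc_element g (1) (- 1) (2) (1 \<in> R)"
      using arc_element_101 4 by simp
    then show thesis by (rule that[rotated 4]) (use 4 in auto)
  next
    case (5 i)
    then have "i < n" by auto
    have "arc_element g (i) (int i - 1) (int i + 1) (i \<in> R)"
      using arc_element_ascending[of i] 5 \<open>i < n\<close> by simp
    then show thesis by (rule that[rotated 4]) (use 5 in auto)
  next
    case (6 i)
    then have "i < n" by auto
    have "arc_element g (i - 1) (int i - 1) (int i + 1) (i \<in> R)"
      using arc_element_descending[of i] 6 \<open>i < n\<close> by simp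
    then show thesis by (rule that[rotated 4]) (use 6 in auto)
  qed
qed

text \<open>The half-turn exchanges left and right, so \<open>- i\<close> is a right point iff \<open>i\<close> is a left point.\<close>

definition symmetric_designation :: "nat set \<Rightarrow> int set" where
  "symmetric_designation R = {v. 0 < v \<and> nat v \<in> R \<or> v < 0 \<and> nat (- v) \<notin> R}"

text \<open>Each Cambrian generator passes its distinguished point \<open>i\<close> on the side
  forbidden by the designation, so \<open>edge_in_designation_rel\<close> contracts it.\<close>

lemma cambrian_subset_designation_rel:
  "cambrian_congruence n R \<subseteq> designation_rel (symmetric_designation R)"
proof -
  have "contracts (weak_order n) (designation_rel (symmetric_designation R)) g"
    if g: "g \<in> cambrian_generators n R" for g
  proof -
    obtain i k p q where i: "1 \<le> i" "i < n" "p < int i" "int i < q" and a: "arc_element g k p q (i \<in> R)"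
      using cambrian_generator_arc[OF g] .
    have V: "int i \<in> V" using i by (simp add: V_def)
    have "(lower_elem (weak_order n) g, g) \<in> designation_rel (symmetric_designation R)"
    proof (rule edge_in_designation_rel[OF arc_element_edge[OF a] _ V i(3,4)])
      show "- v \<in> symmetric_designation R \<longleftrightarrow> v \<notin> symmetric_designation R" if "v \<in> V" for v
        using that by (auto simp: symmetric_designation_def V_def)
      show "int i \<in> symmetric_designation R \<longleftrightarrow> before g (int i) q"
        using arc_element_side[OF a V] i by (simp add: symmetric_designation_def)
    qed
    then show ?thesis
      using congruence_sym[OF congruence_designation_rel] by (simp add: contracts_def)
  qed
  then show ?thesis
    unfolding cambrian_congruence_def congruence_generated_by_def
    using congruence_designation_rel by blast
qed

text \<open>The two points passed on one side have opposite designations, so exactly one of them is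
  on the wrong side. Moving one endpoint of the arc onto the other point, or both endpoints
  symmetrically for the orbifold arc, leaves the arc of a Cambrian generator.\<close>

lemma cambrian_contracts_bipartite_generator:
  assumes \<theta>: "congruence \<theta>" and contr: "\<And>g. g \<in> cambrian_generators n R \<Longrightarrow> contracts (weak_order n) \<theta> g"
    and alt: "\<And>i. Suc i \<in> R \<longleftrightarrow> i \<notin> R" and g: "g \<in> bipartite_generators n"
  shows "contracts (weak_order n) \<theta> g"
proof -
  obtain k p q c s where arc: "generator_arc p q c" and a: "arc_element g k p q s"
    using bipartite_generator_arc[OF g] .
  let ?u = "lower_elem (weak_order n) g"
  have e: "edge ?u g p q" by (rule arc_element_edge[OF a])
  have pq: "p \<in> V" "q \<in> V" "p < q" using e by (auto simp: edge_def)
  have V: "y \<in> V" if "1 \<le> y" "y \<le> q" for y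
    using pq(2) that by (auto simp: V_def)
  have cambrian: "(u', w') \<in> \<theta>"
    if e': "edge u' w' p' q'"
      and pq': "2 \<le> i \<and> p' = int i - 1 \<and> q' = int i + 1 \<or> i = 1 \<and> q' = 2 \<and> (p' = - 1 \<or> p' = - 2)"
      and side': "before w' (int i) q' \<longleftrightarrow> i \<in> R" for u' w' p' q' i
  proof -
    have "q' \<in> V" using e' by (auto simp: edge_def)
    then have "i < n" using pq' by (auto simp: V_def)
    then obtain h l where h: "h \<in> cambrian_generators n R" "arc_element h l p' q' (i \<in> R)"
      using exists_cambrian_generator pq' by blast
    show ?thesis
    proof (rule arc_transfer[OF \<theta> h(2) contr[OF h(1)] e'])
      show "p' = - q' \<or> - 1 \<le> p'" using pq' by auto
      fix y assume "0 < y" "p' < y" "y < q'"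
      then have "y = int i" using pq' by auto
      then show "before w' y q' \<longleftrightarrow> i \<in> R" using side' by simp
    qed
  qed
  have side: "before g y q = s" if "0 < y" "p < y" "y < q" for y
    using arc_element_side[OF a V] that by simp
  consider "1 \<le> p" "q = p + 3" | "p = - 1" "q = 3" | "p = - 3" "q = 3"
    using arc by (auto simp: generator_arc_def)
  then have "(?u, g) \<in> \<theta>"
  proof cases
    case 1
    show ?thesis
    proof (cases "s \<longleftrightarrow> nat (p + 1) \<in> R")
      case True
      obtain u' w' where e': "edge u' w' p (p + 2)"
        "\<forall>y\<in>V. p < y \<longrightarrow> y < p + 2 \<longrightarrow> before w' y (p + 2) = before g y q"
        and imp: "(u', w') \<in> \<theta> \<longrightarrow> (?u, g) \<in> \<theta>"
        using hexagon_lower[OF \<theta> e, of "p + 2"] V 1 by auto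
      have "(u', w') \<in> \<theta>"
        using cambrian[OF e'(1), of "nat (p + 1)"] e'(2) V[of "p + 1"] side[of "p + 1"] 1 True by auto
      then show ?thesis using imp by blast
    next
      case False
      have "nat (p + 2) = Suc (nat (p + 1))" using 1 by simp
      then have s: "s \<longleftrightarrow> nat (p + 2) \<in> R"
        using alt[of "nat (p + 1)"] False by metis
      obtain u' w' where e': "edge u' w' (p + 1) q"
        "\<forall>y\<in>V. p + 1 < y \<longrightarrow> y < q \<longrightarrow> before w' y q = before g y q"
        and imp: "(u', w') \<in> \<theta> \<longrightarrow> (?u, g) \<in> \<theta>"
        using hexagon_upper[OF \<theta> e, of "p + 1"] V 1 by auto
      have "(u', w') \<in> \<theta>"
        using cambrian[OF e'(1), of "nat (p + 2)"] e'(2) V[of "p + 2"] side[of "p + 2"] 1 s by auto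
      then show ?thesis using imp by blast
    qed
  next
    case 2
    show ?thesis
    proof (cases "s \<longleftrightarrow> 1 \<in> R")
      case True
      obtain u' w' where e': "edge u' w' (- 1) 2" "\<forall>y\<in>V. - 1 < y \<longrightarrow> y < 2 \<longrightarrow> before w' y 2 = before g y q"
        and imp: "(u', w') \<in> \<theta> \<longrightarrow> (?u, g) \<in> \<theta>"
        using hexagon_lower[OF \<theta> e, of 2] V 2 by auto
      have "(u', w') \<in> \<theta>"
        using cambrian[OF e'(1), of 1] e'(2) V[of 1] side[of 1] 2 True by auto
      then show ?thesis using imp by blast
    next
      case False
      then have s: "s \<longleftrightarrow> 2 \<in> R" using alt[of 1] by (simp add: numeral_2_eq_2)
      have e1: "edge ?u g (- 1) q" using e 2 by simp
      obtain u' w' where e': "edge u' w' 1 q" "\<forall>y\<in>V. 1 < y \<longrightarrow> y < q \<longrightarrow> before w' y q = before g y q"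
        and imp: "(u', w') \<in> \<theta> \<longrightarrow> (?u, g) \<in> \<theta>"
        using octagon_long[OF \<theta> e1] 2 by auto
      have "(u', w') \<in> \<theta>"
        using cambrian[OF e'(1), of 2] e'(2) V[of 2] side[of 2] 2 s by auto
      then show ?thesis using imp by blast
    qed
  next
    case 3
    have e1: "edge ?u g (- q) q" using e 3 by simp
    show ?thesis
    proof (cases "s \<longleftrightarrow> 1 \<in> R")
      case True
      obtain u' w' where e': "edge u' w' (- 2) 2" "\<forall>y\<in>V. - 2 < y \<longrightarrow> y < 2 \<longrightarrow> before w' y 2 = before g y q"
        and imp: "(u', w') \<in> \<theta> \<longrightarrow> (?u, g) \<in> \<theta>"
        using octagon_symmetric_lower[OF \<theta> e1, of 2] V 3 by auto
      have "(u', w') \<in> \<theta>"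
        using cambrian[OF e'(1), of 1] e'(2) V[of 1] side[of 1] 3 True by auto
      then show ?thesis using imp by blast
    next
      case False
      then have s: "s \<longleftrightarrow> 2 \<in> R" using alt[of 1] by (simp add: numeral_2_eq_2)
      obtain u' w' where e': "edge u' w' 1 q" "\<forall>y\<in>V. 1 < y \<longrightarrow> y < q \<longrightarrow> before w' y q = before g y q"
        and imp: "(u', w') \<in> \<theta> \<longrightarrow> (?u, g) \<in> \<theta>"
        using octagon_symmetric_upper[OF \<theta> e1, of 1] V 3 by auto
      have "(u', w') \<in> \<theta>"
        using cambrian[OF e'(1), of 2] e'(2) V[of 2] side[of 2] 3 s by auto
      then show ?thesis using imp by blast
    qed
  qed
  then show ?thesis using congruence_sym[OF \<theta>] by (simp add: contracts_def)
qed

lemma bipartite_contracts: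
  assumes \<theta>: "congruence \<theta>" and contr: "\<And>g. g \<in> bipartite_generators n \<Longrightarrow> contracts (weak_order n) \<theta> g"
    and e: "edge u w p q" and arc: "generator_arc p q c" and same: "before w c q = before w (c + 1) q"
  shows "(u, w) \<in> \<theta>"
proof -
  have "q \<in> V" using e by (simp add: edge_def)
  then have "q \<le> int n" by (simp add: V_def)
  then obtain g k where g: "g \<in> bipartite_generators n" "arc_element g k p q (before w c q)"
    using exists_bipartite_generator[OF arc] by blast
  show ?thesis
  proof (rule arc_transfer[OF \<theta> g(2) contr[OF g(1)] e])
    show "p = - q \<or> - 1 \<le> p" using arc by (auto simp: generator_arc_def)
    fix y assume "0 < y" "p < y" "y < q"
    then have "y = c \<or> y = c + 1" using arc by (auto simp: generator_arc_def)
    then show "before w y q = before w c q" using same by auto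
  qed
qed

lemma exists_consecutive_change:
  assumes "a \<in> V" "b \<in> V" "a < b" "P a \<noteq> P b"
  obtains c where "c \<in> V" "a \<le> c" "next_pos c \<le> b" "P c \<noteq> P (next_pos c)"
proof -
  have "\<exists>c\<in>V. a \<le> c \<and> next_pos c \<le> b \<and> P c \<noteq> P (next_pos c)"
    using assms
  proof (induction "nat (b - a)" arbitrary: a rule: less_induct)
    case less
    note nxt = next_pos_in_V[OF less.prems(1-3)]
    show ?case
    proof (cases "P a = P (next_pos a)")
      case True
      then have "next_pos a < b" using nxt less.prems by (auto simp: order_le_less)
      then obtain c where "c \<in> V" "next_pos a \<le> c" "next_pos c \<le> b" "P c \<noteq> P (next_pos c)"
        using less.hyps[of "next_pos a"] less.prems nxt True by auto
      then show ?thesis using nxt by (intro bexI[of _ c]) auto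
    next
      case False
      then show ?thesis using less.prems nxt by auto
    qed
  qed
  then show thesis using that by blast
qed

text \<open>The alternation continues across the missing zero because \<open>- 1\<close> has the
  designation opposite to that of \<open>1\<close>.\<close>

lemma next_pos_symmetric_designation:
  assumes "c \<in> V" "next_pos c \<in> V"
  shows "next_pos c \<in> symmetric_designation {i. odd i} \<longleftrightarrow> c \<notin> symmetric_designation {i. odd i}"
  using assms by (auto simp: symmetric_designation_def next_pos_def V_def even_nat_iff nat_add_distrib)

lemma symmetric_designation_even:
  "v \<in> V \<Longrightarrow> v \<in> symmetric_designation {i. even i} \<longleftrightarrow> v \<notin> symmetric_designation {i. odd i}"
  by (auto simp: symmetric_designation_def V_def)

text \<open>\<open>P\<close> marks the points on the wrong side for the odd designation. The even
  designation is complementary, so its wrong points are those without \<open>P\<close>, and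
  \<open>P\<close> changes between two consecutive points. Their designations differ as well, hence
  their sides agree.\<close>

lemma edge_same_side:
  assumes e: "edge u w p q"
    and odd: "(u, w) \<in> designation_rel (symmetric_designation {i. odd i})"
    and even: "(u, w) \<in> designation_rel (symmetric_designation {i. even i})"
  obtains c where "c \<in> V" "p < c" "next_pos c < q" "before w c q = before w (next_pos c) q"
proof -
  let ?R = "symmetric_designation {i. odd i}"
  define P where "P v \<longleftrightarrow> (v \<in> ?R \<longleftrightarrow> before w v q)" for v
  obtain i where i: "i \<in> V" "p < i" "i < q" "P i"
    using edge_in_designation_relD[OF e odd] unfolding P_def by blast
  obtain j where "j \<in> V" "p < j" "j < q" "j \<in> symmetric_designation {i. even i} \<longleftrightarrow> before w j q"
    using edge_in_designation_relD[OF e even] .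
  then have j: "j \<in> V" "p < j" "j < q" "\<not> P j"
    using symmetric_designation_even by (auto simp: P_def)
  obtain c where c: "c \<in> V" "p < c" "next_pos c < q" "P c \<noteq> P (next_pos c)"
  proof (cases "i < j")
    case True
    then show thesis
      using exists_consecutive_change[of i j P] i j that by force
  next
    case False
    then have "j < i" using i j by (metis linorder_cases)
    then show thesis
      using exists_consecutive_change[of j i P] i j that by force
  qed
  have "q \<in> V" using e by (simp add: edge_def)
  moreover have "c < q" using c by (auto simp: next_pos_def split: if_splits)
  ultimately have "next_pos c \<in> V" using next_pos_in_V c by blast
  then have "before w c q = before w (next_pos c) q"
    using c(4) next_pos_symmetric_designation[OF c(1)] by (auto simp: P_def)
  with c that show thesis by blast
qed

lemma bipartite_biCambrian_eq:
  "bipartite_biCambrian_congruence n = congruence_generated_by (weak_order n) (bipartite_generators n)"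
proof (intro equalityI subrelI)
  fix x y assume "(x, y) \<in> bipartite_biCambrian_congruence n"
  then have xy: "(x, y) \<in> designation_rel (symmetric_designation {i. odd i})"
      "(x, y) \<in> designation_rel (symmetric_designation {i. even i})"
    using cambrian_subset_designation_rel unfolding bipartite_biCambrian_congruence_def by blast+
  then have B: "x \<in> Bn" "y \<in> Bn"
    by (auto simp: designation_rel_def)
  have "(x, y) \<in> \<theta>"
    if \<theta>: "congruence \<theta>" and contr: "\<And>g. g \<in> bipartite_generators n \<Longrightarrow> contracts (weak_order n) \<theta> g" for \<theta>
  proof -
    \<comment> \<open>Chains of edges run between comparable elements, so \<open>x\<close> and
      \<open>y\<close> are each linked to their meet.\<close>
    have meet: "(weak_meet x y, x) \<in> \<theta>"
      if xy: "(x, y) \<in> designation_rel (symmetric_designation {i. odd i})"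
        "(x, y) \<in> designation_rel (symmetric_designation {i. even i})" for x y
    proof -
      have B: "x \<in> Bn" "y \<in> Bn" "weak_meet x y \<in> Bn"
        using xy weak_meet_closed by (auto simp: designation_rel_def)
      have sub: "(weak_meet x y) \<preceq> x"
        using inversions_weak_meet_subset B by blast
      show ?thesis
      proof (rule congruence_chain[OF \<theta> B(3,1) sub])
        fix v v' p q assume e: "edge v v' p q"
          and le: "(weak_meet x y) \<preceq> v" "v' \<preceq> x"
        have vv': "v \<in> Bn" "v' \<in> Bn" "v \<preceq> v'"
          using e by (auto simp: edge_def)
        have rel: "(v, v') \<in> designation_rel R" if R: "(x, y) \<in> designation_rel R" for R
        proof -
          note cong = congruence_designation_rel[of R]
          have "(weak_meet y x, weak_meet x x) \<in> designation_rel R"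
            using congruence_meet[OF cong congruence_sym[OF cong R] B(1)] .
          then have "(weak_meet x y, x) \<in> designation_rel R"
            using B by (simp add: weak_meet_comm[of y] weak_meet_absorb)
          then have "(weak_meet x y, v') \<in> designation_rel R"
            using congruence_convex(1)[OF cong] vv' le by blast
          then show ?thesis
            using congruence_convex(2)[OF cong] vv' le by blast
        qed
        obtain c where "c \<in> V" "p < c" "next_pos c < q" "before v' c q = before v' (next_pos c) q"
          using edge_same_side[OF e rel[OF xy(1)] rel[OF xy(2)]] .
        then show "(v, v') \<in> \<theta>"
          using same_side_force[OF \<theta> _ e] bipartite_contracts[OF \<theta> contr] by blast
      qed
    qed
    have "(y, x) \<in> designation_rel (symmetric_designation {i. odd i})"
        "(y, x) \<in> designation_rel (symmetric_designation {i. even i})"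
      using xy congruence_sym[OF congruence_designation_rel] by blast+
    then have "(weak_meet x y, y) \<in> \<theta>"
      using meet weak_meet_comm by metis
    then show ?thesis
      using meet[OF xy] congruence_sym[OF \<theta>] congruence_trans[OF \<theta>] by blast
  qed
  then show "(x, y) \<in> congruence_generated_by (weak_order n) (bipartite_generators n)"
    unfolding congruence_generated_by_def by blast
next
  fix x y assume xy: "(x, y) \<in> congruence_generated_by (weak_order n) (bipartite_generators n)"
  \<comment> \<open>Both parity classes alternate, so one argument covers the two
    designations.\<close>
  have "(x, y) \<in> cambrian_congruence n R" if alt: "\<And>i. Suc i \<in> R \<longleftrightarrow> i \<notin> R" for R
    using xy cambrian_contracts_bipartite_generator[OF _ _ alt]
    unfolding cambrian_congruence_def congruence_generated_by_def by blast
  then show "(x, y) \<in> bipartite_biCambrian_congruence n"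
    by (simp add: bipartite_biCambrian_congruence_def)
qed

lemma bipartite_generator_join_irreducible:
  "g \<in> bipartite_generators n \<Longrightarrow> join_irreducible (weak_order n) g"
  using bipartite_generator_arc arc_element_join_irreducible by metis

section \<open>The arcs of the generators\<close>

lemma ordinary_arcs:
  assumes "i \<in> {1..n - 3}"
  shows "{delta_orb n (word_prod [i, i + 1, i + 2]), delta_orb n (word_prod [i + 2, i + 1, i])}
    = {{Ordinary (int i) (int i + 3) S} | S. is_type_B_arc n (Ordinary (int i) (int i + 3) S) \<and>
         (int i + 1 \<in> S \<longleftrightarrow> int i + 2 \<in> S)}"
proof -
  have i: "1 \<le> i" "i + 2 < n" using assms by auto
  have "{int i<..<int i + 3} = {int i + 1, int i + 2}" by auto
  moreover have "S \<subseteq> {a, b} \<and> (a \<in> S \<longleftrightarrow> b \<in> S) \<longleftrightarrow> S = {} \<or> S = {a, b}" for S and a b :: int by auto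
  ultimately have S: "is_type_B_arc n (Ordinary (int i) (int i + 3) S) \<and> (int i + 1 \<in> S \<longleftrightarrow> int i + 2 \<in> S)
      \<longleftrightarrow> S = {} \<or> S = {int i<..<int i + 3}" for S
    using i by simp
  show ?thesis
    unfolding S using i delta_orb_ordinary[OF arc_element_ascending3[OF i]]
      delta_orb_ordinary[OF arc_element_descending3[OF i]] by auto
qed

lemma orbifold_arcs:
  assumes "3 \<le> n"
  shows "{delta_orb n (word_prod [0, 1, 0, 2, 1, 0]), delta_orb n (word_prod [2, 1, 0])}
    = {{Orbifold 3 S} | S. is_type_B_arc n (Orbifold 3 S) \<and> (1 \<in> S \<longleftrightarrow> 2 \<in> S)}"
proof -
  have "{1..<3} = {1, 2 :: int}" "{0<..<3} = {1, 2 :: int}" by auto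
  moreover have "S \<subseteq> {1, 2} \<and> (1 \<in> S \<longleftrightarrow> 2 \<in> S) \<longleftrightarrow> S = {} \<or> S = {1, 2}" for S :: "int set" by auto
  ultimately have S: "is_type_B_arc n (Orbifold 3 S) \<and> (1 \<in> S \<longleftrightarrow> 2 \<in> S) \<longleftrightarrow> S = {} \<or> S = {0<..<3}" for S
    using assms by simp
  show ?thesis
    unfolding S using delta_orb_orbifold[OF arc_element_010210[OF assms]]
      delta_orb_orbifold[OF arc_element_210[OF assms]] by auto
qed

lemma long_arcs:
  assumes "3 \<le> n"
  shows "{delta_orb n (word_prod [0, 1, 2]), delta_orb n (word_prod [2, 1, 0, 1])}
    = {{Long 1 3 S T} | S T. is_type_B_arc n (Long 1 3 S T) \<and> (1 \<in> T \<longleftrightarrow> 2 \<in> T)}"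
proof -
  have "{1..<3} = {1, 2 :: int}" "{0<..<3} = {1, 2 :: int}" by auto
  moreover have "T \<subseteq> {1, 2} \<and> (1 \<in> T \<longleftrightarrow> 2 \<in> T) \<longleftrightarrow> T = {} \<or> T = {1, 2}" for T :: "int set" by auto
  moreover have "is_type_B_arc n (Long 1 3 S T) \<longleftrightarrow> S = {} \<and> T \<subseteq> {1..<3}" for S T
    using assms by auto
  ultimately have ST: "is_type_B_arc n (Long 1 3 S T) \<and> (1 \<in> T \<longleftrightarrow> 2 \<in> T)
      \<longleftrightarrow> S = {} \<and> (T = {} \<or> T = {0<..<3})" for S T
    by metis
  show ?thesis
    unfolding ST using delta_orb_long[OF arc_element_012[OF assms]]
      delta_orb_long[OF arc_element_2101[OF assms]] by auto
qed

end

theorem theorem6p7: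
  fixes n :: nat
  assumes "1 \<le> n"
  shows "bipartite_biCambrian_congruence n
           = congruence_generated_by (weak_order n) (bipartite_generators n)
       \<and> (\<forall>w\<in>bipartite_generators n. join_irreducible (weak_order n) w)
       \<and> (\<forall>i\<in>{1..n - 3}.
            {delta_orb n (word_prod [i, i + 1, i + 2]), delta_orb n (word_prod [i + 2, i + 1, i])}
              = {{Ordinary (int i) (int i + 3) S} | S.
                   is_type_B_arc n (Ordinary (int i) (int i + 3) S) \<and>
                   (int i + 1 \<in> S \<longleftrightarrow> int i + 2 \<in> S)})
       \<and> (3 \<le> n \<longrightarrow>
            {delta_orb n (word_prod [0, 1, 0, 2, 1, 0]), delta_orb n (word_prod [2, 1, 0])}
              = {{Orbifold 3 S} | S.
                   is_type_B_arc n (Orbifold 3 S) \<and> (1 \<in> S \<longleftrightarrow> 2 \<in> S)})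
       \<and> (3 \<le> n \<longrightarrow>
            {delta_orb n (word_prod [0, 1, 2]), delta_orb n (word_prod [2, 1, 0, 1])}
              = {{Long 1 3 S T} | S T.
                   is_type_B_arc n (Long 1 3 S T) \<and> (1 \<in> T \<longleftrightarrow> 2 \<in> T)})"
  by (intro conjI ballI impI hyperoctahedral.bipartite_biCambrian_eq
      hyperoctahedral.bipartite_generator_join_irreducible hyperoctahedral.ordinary_arcs
      hyperoctahedral.orbifold_arcs hyperoctahedral.long_arcs)

end
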